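(* Let $G$ be a compact Abelian group, and let $\Omega_+$ be a symmetric Borel subset of $G$ with $0\in\operatorname{int}\Omega_+$. Then the Delsarte problem $$\mathcal{D}_G(\Omega_+):=\sup\left\{\int_G\varphi\,d\lambda_G:\ \varphi\in\mathcal{F}_G(\Omega_+,G)\right\}$$ has dual problem $$\mathcal{D}_G(\Omega_+)^*:=\inf\{\alpha\in\mathbb{R}:\ \alpha\delta_0-\lambda_G\in -M^*(\Omega_+)+T_0(G)\},$$ and the strong duality relation $$\mathcal{D}_G(\Omega_+)=\mathcal{D}_G(\Omega_+)^*$$ holds.
   Context: $G$ is a compact (Hausdorff) Abelian group, written additively with identity $0$, normalised Haar measure $\lambda_G$ ($\lambda_G(G)=1$) and dual group $\widehat G$. A set $S\subset G$ is symmetric if $-S=S$; $S^c=G\setminus S$. $C(G)$ is the space of continuous real-valued functions on $G$, $\widehat\varphi$ is the Fourier transform of $\varphi$, and $M(G)$ is the space of real-valued regular signed Borel measures on $G$. $\delta_0\in M(G)$ is the Dirac measure at $0$. Function class (no restriction on the set of negativity): $$\mathcal{F}_G(\Omega_+,G)=\{\varphi\in C(G):\ \widehat\varphi\ge 0,\ \varphi(0)=1,\ \varphi|_{\Omega_+^c}\le 0\}.$$ For $\Theta\subset G$: $M^*(\Theta):=\{\mu\in M(G):\ \mu \text{ is a non-negative measure and } \operatorname{supp}(\mu)\subseteq\overline{G\setminus\Theta}\}$. A measure $\mu\in M(G)$ is positive definite if $\int_G u\star\widetilde u\,d\mu\ge 0$ for all continuous (complex-valued) functions $u$ on $G$, where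 $\widetilde u(g):=\overline{u(-g)}$ and $\star$ is convolution with respect to $\lambda_G$. $T_0(G)$ is the set of all positive definite $\tau\in M(G)$ with $\tau(G)=0$. Sums of sets of measures are Minkowski sums. Sense of "dual problem": put $Q:=\{\varphi\in C(G):\varphi|_{\Omega_+^c}\le0\}$ and $Q^*:=\{\mu\in M(G):\int_G\varphi\,d\mu\ge0\ \forall\varphi\in Q\}$. Let $\mathbf 1$ denote the trivial character. The primal problem is written as $\mathcal{D}_G(\Omega_+)=1/(1+u)$, where $$u=\inf\Big\{\sum_{\gamma\ne\mathbf 1}f(\gamma):\ f\in\ell^1(\widehat G),\ f\ge0,\ \mathbf 1+\sum_{\gamma\ne\mathbf 1}f(\gamma)\gamma\in Q\Big\}.$$ The linear programming dual of $u$ is $$v=\sup\Big\{-\mu(G):\ \mu\in Q^*,\ \int_G\gamma\,d\mu\le1\ \forall\gamma\ne\mathbf 1\Big\}$$ (inequalities between Fourier transforms include that the quantities are real), and $\mathcal{D}_G(\Omega_+)^*$ is the dual problem in the sense that $\mathcal{D}_G(\Omega_+)^*=1/(1+v)$. *)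

theory Defs
  imports "HOL-Analysis.Analysis"
begin

section \<open>Regular Borel measures, signed measures and their integrals\<close>

definition regular_borel_measure :: "'a::topological_space measure \<Rightarrow> bool" where
  "regular_borel_measure M \<longleftrightarrow> sets M = sets borel \<and>
     (\<forall>B\<in>sets borel.
        emeasure M B = (SUP K\<in>{K. K \<subseteq> B \<and> compact K}. emeasure M K) \<and>
        emeasure M B = (INF U\<in>{U. B \<subseteq> U \<and> open U}. emeasure M U))"

text \<open>
  A finite signed Borel measure is a real-valued set function. Only its values on Borel sets are
  meaningful, so two such functions represent the same measure iff they agree on all Borel sets.
\<close>

definition signed_borel_measure :: "('a::topological_space set \<Rightarrow> real) \<Rightarrow> bool" where
  "signed_borel_measure \<mu> \<longleftrightarrow> \<mu> {} = 0 \<and>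
     (\<forall>A::nat \<Rightarrow> 'a set. range A \<subseteq> sets borel \<longrightarrow> disjoint_family A \<longrightarrow>
        (\<lambda>n. \<mu> (A n)) sums \<mu> (\<Union>n. A n))"

text \<open>
  The Jordan decomposition: the positive part of \<open>\<mu>\<close> at \<open>A\<close> is the supremum of \<open>\<mu> B\<close> over Borel sets
  \<open>B \<subseteq> A\<close>. Negative values of \<open>\<mu> B\<close> are truncated to \<open>0\<close> by \<^const>\<open>ennreal\<close>, which does not affect
  the supremum, since \<open>B = {}\<close> is admissible.
\<close>

definition positive_part :: "('a::topological_space set \<Rightarrow> real) \<Rightarrow> 'a measure" where
  "positive_part \<mu> =
     measure_of UNIV (sets borel) (\<lambda>A. SUP B\<in>{B \<in> sets borel. B \<subseteq> A}. ennreal (\<mu> B))"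

definition negative_part :: "('a::topological_space set \<Rightarrow> real) \<Rightarrow> 'a measure" where
  "negative_part \<mu> = positive_part (\<lambda>A. - \<mu> A)"

definition total_variation :: "('a::topological_space set \<Rightarrow> real) \<Rightarrow> 'a measure" where
  "total_variation \<mu> = measure_of UNIV (sets borel)
     (\<lambda>A. emeasure (positive_part \<mu>) A + emeasure (negative_part \<mu>) A)"

definition signed_integral ::
    "('a::topological_space set \<Rightarrow> real) \<Rightarrow> ('a \<Rightarrow> 'b::{banach, second_countable_topology}) \<Rightarrow> 'b" where
  "signed_integral \<mu> f = (LINT x|positive_part \<mu>. f x) - (LINT x|negative_part \<mu>. f x)"

definition regular_signed_measures :: "('a::topological_space set \<Rightarrow> real) set" where
  "regular_signed_measures =
     {\<mu>. signed_borel_measure \<mu> \<and> regular_borel_measure (total_variation \<mu>)}"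

definition signed_support :: "('a::topological_space set \<Rightarrow> real) \<Rightarrow> 'a set" where
  "signed_support \<mu> = {x. \<forall>U. open U \<and> x \<in> U \<longrightarrow> emeasure (total_variation \<mu>) U > 0}"


section \<open>Harmonic analysis on a compact Abelian group\<close>

definition normalized_haar :: "'a::topological_ab_group_add measure \<Rightarrow> bool" where
  "normalized_haar haar \<longleftrightarrow> regular_borel_measure haar \<and> emeasure haar UNIV = 1 \<and>
     (\<forall>a. \<forall>B\<in>sets borel. emeasure haar ((+) a ` B) = emeasure haar B)"

definition dual_group :: "('a::topological_ab_group_add \<Rightarrow> complex) set" where
  "dual_group = {\<gamma>. continuous_on UNIV \<gamma> \<and> (\<forall>x. norm (\<gamma> x) = 1) \<and> (\<forall>x y. \<gamma> (x + y) = \<gamma> x * \<gamma> y)}"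

abbreviation trivial_character :: "'a::topological_ab_group_add \<Rightarrow> complex" where
  "trivial_character \<equiv> (\<lambda>_. 1)"

definition fourier_transform ::
    "'a::topological_ab_group_add measure \<Rightarrow> ('a \<Rightarrow> real) \<Rightarrow> ('a \<Rightarrow> complex) \<Rightarrow> complex" where
  "fourier_transform haar \<phi> \<gamma> = (LINT x|haar. of_real (\<phi> x) * cnj (\<gamma> x))"

definition convolve ::
    "'a::topological_ab_group_add measure \<Rightarrow> ('a \<Rightarrow> complex) \<Rightarrow> ('a \<Rightarrow> complex) \<Rightarrow> 'a \<Rightarrow> complex" where
  "convolve haar f g x = (LINT y|haar. f y * g (x - y))"

text \<open>
  Here and below, inequalities between complex numbers are those of
  \<^theory>\<open>HOL-Library.Complex_Order\<close>; in particular, \<open>0 \<le> z\<close> and \<open>z \<le> 1\<close> entail that \<open>z\<close> is real.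
\<close>

definition positive_definite_measure ::
    "'a::topological_ab_group_add measure \<Rightarrow> ('a set \<Rightarrow> real) \<Rightarrow> bool" where
  "positive_definite_measure haar \<mu> \<longleftrightarrow>
     (\<forall>u::'a \<Rightarrow> complex. continuous_on UNIV u \<longrightarrow>
        0 \<le> signed_integral \<mu> (convolve haar u (\<lambda>g. cnj (u (- g)))))"


section \<open>The Delsarte problem and its dual\<close>

definition delsarte_class ::
    "'a::topological_ab_group_add measure \<Rightarrow> 'a set \<Rightarrow> ('a \<Rightarrow> real) set" where
  "delsarte_class haar \<Omega> =
     {\<phi>. continuous_on UNIV \<phi> \<and> (\<forall>\<gamma>\<in>dual_group. 0 \<le> fourier_transform haar \<phi> \<gamma>) \<and>
         \<phi> 0 = 1 \<and> (\<forall>x\<in>- \<Omega>. \<phi> x \<le> 0)}"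

definition delsarte :: "'a::topological_ab_group_add measure \<Rightarrow> 'a set \<Rightarrow> ereal" where
  "delsarte haar \<Omega> = (SUP \<phi>\<in>delsarte_class haar \<Omega>. ereal (LINT x|haar. \<phi> x))"

definition Mstar :: "'a::topological_space set \<Rightarrow> ('a set \<Rightarrow> real) set" where
  "Mstar \<Theta> = {\<mu> \<in> regular_signed_measures.
     (\<forall>B\<in>sets borel. 0 \<le> \<mu> B) \<and> signed_support \<mu> \<subseteq> closure (- \<Theta>)}"

definition T0 :: "'a::topological_ab_group_add measure \<Rightarrow> ('a set \<Rightarrow> real) set" where
  "T0 haar = {\<tau> \<in> regular_signed_measures. positive_definite_measure haar \<tau> \<and> \<tau> UNIV = 0}"

text \<open>
  The existential statement below unfolds membership of \<open>\<alpha>\<delta>\<^sub>0 - haar\<close> in the Minkowski sum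
  \<open>- Mstar \<Omega> + T0 haar\<close>; \<open>indicator B 0\<close> is the Dirac measure at \<open>0\<close>.
\<close>

definition delsarte_dual :: "'a::topological_ab_group_add measure \<Rightarrow> 'a set \<Rightarrow> ereal" where
  "delsarte_dual haar \<Omega> =
     (INF \<alpha>\<in>{\<alpha>::real. \<exists>\<mu>\<in>Mstar \<Omega>. \<exists>\<tau>\<in>T0 haar.
               \<forall>B\<in>sets borel. \<alpha> * indicator B 0 - measure haar B = - \<mu> B + \<tau> B}. ereal \<alpha>)"


section \<open>The pair of linear programs relating the two problems\<close>

definition Qcone :: "'a::topological_space set \<Rightarrow> ('a \<Rightarrow> real) set" where
  "Qcone \<Omega> = {\<phi>. continuous_on UNIV \<phi> \<and> (\<forall>x\<in>- \<Omega>. \<phi> x \<le> 0)}"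

definition Qcone_dual :: "'a::topological_space set \<Rightarrow> ('a set \<Rightarrow> real) set" where
  "Qcone_dual \<Omega> = {\<mu> \<in> regular_signed_measures. \<forall>\<phi>\<in>Qcone \<Omega>. 0 \<le> signed_integral \<mu> \<phi>}"

definition primal_lp :: "'a::topological_ab_group_add set \<Rightarrow> ereal" where
  "primal_lp \<Omega> =
     (INF f\<in>{f :: ('a \<Rightarrow> complex) \<Rightarrow> real.
              (\<lambda>\<gamma>. \<bar>f \<gamma>\<bar>) summable_on dual_group \<and> (\<forall>\<gamma>\<in>dual_group. 0 \<le> f \<gamma>) \<and>
              (\<exists>\<phi>\<in>Qcone \<Omega>. \<forall>x. complex_of_real (\<phi> x) =
                 1 + (\<Sum>\<^sub>\<infinity>\<gamma>\<in>dual_group - {trivial_character}. of_real (f \<gamma>) * \<gamma> x))}.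
        ereal (\<Sum>\<^sub>\<infinity>\<gamma>\<in>dual_group - {trivial_character}. f \<gamma>))"

definition dual_lp :: "'a::topological_ab_group_add set \<Rightarrow> ereal" where
  "dual_lp \<Omega> =
     (SUP \<mu>\<in>{\<mu> \<in> Qcone_dual \<Omega>.
              \<forall>\<gamma>\<in>dual_group - {trivial_character}. signed_integral \<mu> \<gamma> \<le> 1}. ereal (- \<mu> UNIV))"

end

theory Submission
  imports Defs
begin

text \<open>
  Both extremal problems are turned into linear programs on the dual group, and the gap between
  these is closed by a compactness argument.

  Harmonic analysis. Everything rests on the fact that the characters separate the points of the
  group (\<open>characters_separate_0\<close>). It is obtained from an extremal problem: among the functions
  \<open>u\<close> with \<open>\<integral> \<bar>u\<bar>\<^sup>2 = 1\<close>, the mean square of an average of the autocorrelation \<open>u \<star> u~\<close> is nearly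
  maximised. Comparing \<open>u\<close> with \<open>u + c u(\<cdot> + a)\<close>, \<open>\<bar>c\<bar> = 1\<close>, puts every cluster point into the
  equality case of the triangle inequality, hence makes it an eigenfunction of all translations,
  which is a multiple of a character. Trigonometric polynomials are then dense by
  Stone-Weierstrass. Consequently, a continuous function with nonnegative Fourier coefficients
  equals its absolutely convergent Fourier series (\<open>fourier_inversion\<close>), and a measure is positive
  definite iff it integrates all characters to nonnegative numbers
  (\<open>positive_definite_measure_iff\<close>).

  The two linear programs. Dividing the Fourier series of an admissible \<open>\<phi>\<close> with \<open>\<integral> \<phi> > 0\<close> by its
  constant term turns the normalisation \<open>\<phi> 0 = 1\<close> into \<open>\<integral> \<phi> = 1 / (1 + \<Sum> f \<gamma>)\<close>; since
  \<open>s \<mapsto> 1 / (1 + s)\<close> is a decreasing bijection, the supremum of one side corresponds to the infimum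
  of the other (\<open>delsarte_eq\<close>). On the dual side, the cone dual to \<open>Qcone \<Omega>\<close> consists of the
  measures \<open>- P\<close>, where \<open>P \<ge> 0\<close> is carried by the closure of \<open>- \<Omega>\<close>. A measure \<open>\<tau> = \<alpha> \<delta>\<^sub>0 - \<lambda> + P\<close>
  has total mass \<open>\<alpha> - 1 + P(G)\<close> and integrates a nontrivial character \<open>\<gamma>\<close> to \<open>\<alpha> + \<integral> \<gamma> dP\<close>. So \<open>\<tau>\<close>
  is positive definite of mass \<open>0\<close> exactly if \<open>- P / \<alpha>\<close> is feasible for the dual program with
  value \<open>(1 - \<alpha>) / \<alpha>\<close> (\<open>admissible_eq\<close>).

  Duality. Integrating an admissible function against \<open>\<tau>\<close> gives \<open>\<integral> \<phi> \<le> \<alpha>\<close> (\<open>weak_duality\<close>). For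
  the converse let \<open>D < 1\<close> be the optimum and \<open>b = D / (1 - D)\<close>. Wanted is a probability measure
  on the closure of \<open>- \<Omega>\<close> under which every nontrivial character has integral at least \<open>- b\<close>.
  Finitely additive probabilities form a compact set, so finitely many characters may be
  considered at a time; there, a least squares solution that violated some constraint would have
  its violations as coefficients of an admissible function with integral above \<open>D\<close>
  (\<open>finitely_many_constraints\<close>). The resulting finitely additive probability is replaced by a
  Radon measure with the same integrals of continuous functions (\<open>integral_radon\<close>).
\<close>

section \<open>Signed combinations of finite Borel measures\<close>

definition finite_borel :: "'a::topological_space measure \<Rightarrow> bool" where
  "finite_borel M \<longleftrightarrow> finite_measure M \<and> sets M = sets borel"

lemma finite_borelD:
  assumes "finite_borel M"
  shows "finite_measure M" "sets M = sets borel" "space M = UNIV"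
  using assms sets_eq_imp_space_eq[of M borel] by (auto simp: finite_borel_def)

lemma finite_borel_integrable:
  fixes f :: "'a::topological_space \<Rightarrow> 'b::{banach, second_countable_topology}"
  assumes "finite_borel M" "f \<in> borel_measurable borel" "\<And>x. norm (f x) \<le> C"
  shows "integrable M f"
proof (rule finite_measure.integrable_const_bound)
  show "finite_measure M" using assms(1) by (simp add: finite_borelD)
  show "f \<in> borel_measurable M"
    using assms(1,2) by (simp add: finite_borelD cong: measurable_cong_sets)
  show "AE x in M. norm (f x) \<le> C" using assms(3) by simp
qed

lemma finite_borel_integral_bound:
  fixes f :: "'a::topological_space \<Rightarrow> 'b::{banach, second_countable_topology}"
  assumes "finite_borel M" "f \<in> borel_measurable borel" "\<And>x. norm (f x) \<le> C"
  shows "norm (LINT x|M. f x) \<le> C * measure M UNIV"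
proof -
  have int: "integrable M f" by (rule finite_borel_integrable[OF assms])
  interpret finite_measure M using assms(1) by (rule finite_borelD)
  have "norm (LINT x|M. f x) \<le> (LINT x|M. norm (f x))" by (rule integral_norm_bound)
  also have "\<dots> \<le> (LINT x|M. C)"
    using int assms(3) by (intro integral_mono) auto
  also have "\<dots> = C * measure M UNIV"
    using assms(1) by (simp add: finite_borelD)
  finally show ?thesis .
qed

text \<open>
  Rounding \<open>f\<close> down to multiples of \<open>1 / n\<close> gives a function with finitely many values, for which
  the claim is a finite combination of the hypotheses; the error is at most \<open>1 / n\<close> times the
  total weight.
\<close>

lemma weighted_integral_eq_0_real:
  fixes P :: "'i \<Rightarrow> 'a::topological_space measure" and f :: "'a \<Rightarrow> real"
  assumes fin: "finite I" and P: "\<And>i. i \<in> I \<Longrightarrow> finite_borel (P i)"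
    and f: "f \<in> borel_measurable borel" and C: "\<And>x. \<bar>f x\<bar> \<le> C"
    and zero: "\<And>B. B \<in> sets borel \<Longrightarrow> (\<Sum>i\<in>I. c i * measure (P i) B) = 0"
  shows "(\<Sum>i\<in>I. c i * (LINT x|P i. f x)) = 0"
proof -
  define S where "S = (\<Sum>i\<in>I. \<bar>c i\<bar> * measure (P i) UNIV)"
  have bound: "\<bar>\<Sum>i\<in>I. c i * (LINT x|P i. f x)\<bar> \<le> S / real n" if n: "n > 0" for n :: nat
  proof -
    define k where "k x = \<lfloor>real n * f x\<rfloor>" for x
    define K where "K = {\<lfloor>real n * (- C)\<rfloor>..\<lfloor>real n * C\<rfloor>}"
    define g where "g x = real_of_int (k x) / real n" for x
    have kK: "k x \<in> K" for x
    proof -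
      have "- C \<le> f x" "f x \<le> C" using C[of x] by linarith+
      then have "real n * (- C) \<le> real n * f x" "real n * f x \<le> real n * C"
        by (intro mult_left_mono; simp)+
      then show ?thesis unfolding k_def K_def by (auto intro!: floor_mono)
    qed
    have km: "{x. k x = j} \<in> sets borel" for j
      using measurable_sets[OF f, of "{y. \<lfloor>real n * y\<rfloor> = j}"] unfolding k_def
      by (auto simp: vimage_def)
    have geq: "g x = (\<Sum>j\<in>K. (of_int j / real n) * indicator {x. k x = j} x)" for x
    proof -
      have "(\<Sum>j\<in>K. (of_int j / real n) * indicator {x. k x = j} x)
          = (\<Sum>j\<in>K. if j = k x then of_int j / real n else 0)"
        by (intro sum.cong) (auto simp: indicator_def)
      also have "\<dots> = g x" using kK[of x] by (simp add: g_def K_def)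
      finally show ?thesis by simp
    qed
    have gf: "\<bar>f x - g x\<bar> \<le> 1 / real n" for x
    proof -
      have "\<bar>real n * f x - real_of_int (k x)\<bar> \<le> 1" unfolding k_def by linarith
      moreover have "f x - g x = (real n * f x - real_of_int (k x)) / real n"
        using n by (simp add: g_def field_simps)
      ultimately show ?thesis using n by (simp add: divide_right_mono)
    qed
    have gm: "g \<in> borel_measurable borel"
      using f unfolding g_def k_def by measurable
    have gb: "\<bar>g x\<bar> \<le> C + 1 / real n" for x using gf[of x] C[of x] by linarith
    have intg: "(LINT x|P i. g x) = (\<Sum>j\<in>K. (of_int j / real n) * measure (P i) {x. k x = j})"
      if i: "i \<in> I" for i
    proof -
      interpret finite_measure "P i" using P[OF i] by (rule finite_borelD)
      have "(LINT x|P i. g x) = (LINT x|P i. (\<Sum>j\<in>K. (of_int j / real n) * indicator {x. k x = j} x))"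
        by (simp add: geq)
      also have "\<dots> = (\<Sum>j\<in>K. (LINT x|P i. (of_int j / real n) * indicator {x. k x = j} x))"
        using km finite_borelD(2)[OF P[OF i]]
        by (intro Bochner_Integration.integral_sum integrable_mult_right)
           (simp add: less_top[symmetric])
      also have "\<dots> = (\<Sum>j\<in>K. (of_int j / real n) * measure (P i) {x. k x = j})"
        using finite_borelD(3)[OF P[OF i]] by simp
      finally show ?thesis .
    qed
    have "(\<Sum>i\<in>I. c i * (LINT x|P i. g x))
        = (\<Sum>i\<in>I. \<Sum>j\<in>K. (of_int j / real n) * (c i * measure (P i) {x. k x = j}))"
      by (intro sum.cong refl) (simp add: intg sum_distrib_left algebra_simps)
    also have "\<dots> = (\<Sum>j\<in>K. (of_int j / real n) * (\<Sum>i\<in>I. c i * measure (P i) {x. k x = j}))"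
      by (subst sum.swap) (simp add: sum_distrib_left)
    also have "\<dots> = 0" using zero[OF km] by simp
    finally have g0: "(\<Sum>i\<in>I. c i * (LINT x|P i. g x)) = 0" .
    have "(\<Sum>i\<in>I. c i * (LINT x|P i. f x)) = (\<Sum>i\<in>I. c i * (LINT x|P i. f x - g x))"
    proof -
      have "(LINT x|P i. f x - g x) = (LINT x|P i. f x) - (LINT x|P i. g x)" if "i \<in> I" for i
        using finite_borel_integrable[OF P[OF that] f, of C] C
          finite_borel_integrable[OF P[OF that] gm, of "C + 1 / real n"] gb
        by (intro Bochner_Integration.integral_diff) auto
      then have "(\<Sum>i\<in>I. c i * (LINT x|P i. f x - g x))
           = (\<Sum>i\<in>I. c i * (LINT x|P i. f x)) - (\<Sum>i\<in>I. c i * (LINT x|P i. g x))"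
        by (simp add: sum_subtractf right_diff_distrib)
      then show ?thesis using g0 by simp
    qed
    also have "\<bar>\<dots>\<bar> \<le> (\<Sum>i\<in>I. \<bar>c i\<bar> * (1 / real n * measure (P i) UNIV))"
    proof (rule order_trans[OF sum_abs] , rule sum_mono)
      fix i assume i: "i \<in> I"
      have "norm (LINT x|P i. f x - g x) \<le> 1 / real n * measure (P i) UNIV"
        using P[OF i] f gm gf by (intro finite_borel_integral_bound) auto
      then show "\<bar>c i * (LINT x|P i. f x - g x)\<bar> \<le> \<bar>c i\<bar> * (1 / real n * measure (P i) UNIV)"
        unfolding abs_mult by (intro mult_left_mono) auto
    qed
    also have "\<dots> = S / real n" by (simp add: S_def sum_divide_distrib)
    finally show ?thesis .
  qed
  have "(\<lambda>n. S / real n) \<longlonglongrightarrow> 0" by (rule lim_const_over_n)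
  then have "\<bar>\<Sum>i\<in>I. c i * (LINT x|P i. f x)\<bar> \<le> 0"
    using bound by (intro LIMSEQ_le_const) (auto intro!: exI[of _ 1])
  then show ?thesis by simp
qed

text \<open>
  A linear relation between finite measures passes to the integrals of bounded functions; this is
  how integrals against a signed measure are computed from any representation of it as a real
  combination of measures.
\<close>

lemma weighted_integral_eq_0:
  fixes P :: "'i \<Rightarrow> 'a::topological_space measure" and f :: "'a \<Rightarrow> complex"
  assumes fin: "finite I" and P: "\<And>i. i \<in> I \<Longrightarrow> finite_borel (P i)"
    and f: "f \<in> borel_measurable borel" and C: "\<And>x. norm (f x) \<le> C"
    and zero: "\<And>B. B \<in> sets borel \<Longrightarrow> (\<Sum>i\<in>I. c i * measure (P i) B) = 0"
  shows "(\<Sum>i\<in>I. of_real (c i) * (LINT x|P i. f x)) = 0"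
proof (rule complex_eqI)
  have int: "integrable (P i) f" if "i \<in> I" for i
    using finite_borel_integrable[OF P[OF that] f C] .
  have re: "(\<Sum>i\<in>I. c i * (LINT x|P i. Re (f x))) = 0"
    using f C abs_Re_le_cmod order_trans
    by (intro weighted_integral_eq_0_real[OF fin P _ _ zero]) (auto, blast)
  have im: "(\<Sum>i\<in>I. c i * (LINT x|P i. Im (f x))) = 0"
    using f C abs_Im_le_cmod order_trans
    by (intro weighted_integral_eq_0_real[OF fin P _ _ zero]) (auto, blast)
  show "Re (\<Sum>i\<in>I. of_real (c i) * (LINT x|P i. f x)) = Re 0"
    using re int by simp
  show "Im (\<Sum>i\<in>I. of_real (c i) * (LINT x|P i. f x)) = Im 0"
    using im int by simp
qed

section \<open>The Jordan decomposition of a signed measure\<close>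

lemma disjoint_family_binaryset:
  assumes "A \<inter> B = {}"
  shows "disjoint_family (binaryset A B)"
proof -
  have "binaryset A B m \<inter> binaryset A B n = {}" if "m \<noteq> n" for m n
    using assms that by (cases "m = 0"; cases "n = 0"; cases "m = Suc 0"; cases "n = Suc 0")
      (auto simp: binaryset_def)
  then show ?thesis by (simp add: disjoint_family_on_def)
qed

lemma signed_borel_additive:
  assumes \<mu>: "signed_borel_measure \<mu>" and A: "A \<in> sets borel" and B: "B \<in> sets borel"
    and dis: "A \<inter> B = {}"
  shows "\<mu> (A \<union> B) = \<mu> A + \<mu> B"
proof -
  have "range (binaryset A B) \<subseteq> sets borel" using \<mu> A B
    by (auto simp: range_binaryset_eq)
  then have "(\<lambda>n. \<mu> (binaryset A B n)) sums \<mu> (\<Union>n. binaryset A B n)"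
    using \<mu> disjoint_family_binaryset[OF dis] unfolding signed_borel_measure_def by blast
  moreover have "(\<lambda>n. \<mu> (binaryset A B n)) sums (\<mu> A + \<mu> B)"
    using \<mu> by (intro binaryset_sums) (auto simp: signed_borel_measure_def)
  ultimately show ?thesis by (simp add: UN_binaryset_eq sums_unique2)
qed

lemma signed_borel_Diff:
  assumes \<mu>: "signed_borel_measure \<mu>" and A: "A \<in> sets borel" and B: "B \<in> sets borel"
    and sub: "B \<subseteq> A"
  shows "\<mu> (A - B) = \<mu> A - \<mu> B"
  using signed_borel_additive[OF \<mu> B, of "A - B"] A B sub
  by (auto simp: Un_absorb1)

lemma signed_borel_uminus:
  "signed_borel_measure \<mu> \<Longrightarrow> signed_borel_measure (\<lambda>A. - \<mu> A)"
  by (auto simp: signed_borel_measure_def intro: sums_minus)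

text \<open>
  The set function from which \<^const>\<open>positive_part\<close> is built. It is given a name because
  \<^const>\<open>positive_part\<close> takes these values only once countable additivity is known.
\<close>

definition upper_variation :: "('a::topological_space set \<Rightarrow> real) \<Rightarrow> 'a set \<Rightarrow> ennreal" where
  "upper_variation \<mu> A = (SUP B\<in>{B \<in> sets borel. B \<subseteq> A}. ennreal (\<mu> B))"

lemma upper_variation_upper: "B \<in> sets borel \<Longrightarrow> B \<subseteq> A \<Longrightarrow> ennreal (\<mu> B) \<le> upper_variation \<mu> A"
  unfolding upper_variation_def by (rule SUP_upper) auto

lemma upper_variation_add:
  assumes \<mu>: "signed_borel_measure \<mu>" and dis: "A \<inter> B = {}"
  shows "upper_variation \<mu> A + upper_variation \<mu> B \<le> upper_variation \<mu> (A \<union> B)"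
proof -
  have *: "ennreal (\<mu> X) + ennreal (\<mu> Y) \<le> upper_variation \<mu> (A \<union> B)"
    if X: "X \<in> sets borel" "X \<subseteq> A" and Y: "Y \<in> sets borel" "Y \<subseteq> B" for X Y
  proof -
    have add: "\<mu> (X \<union> Y) = \<mu> X + \<mu> Y"
      using that dis by (intro signed_borel_additive[OF \<mu>]) auto
    \<comment> \<open>Truncation at \<open>0\<close> makes \<^const>\<open>ennreal\<close> additive only for equal signs; a set of negative measure is
        replaced by the empty set.\<close>
    consider "\<mu> X \<ge> 0" "\<mu> Y \<ge> 0" | "\<mu> X < 0" | "\<mu> Y < 0" by linarith
    then show ?thesis
    proof cases
      case 1
      have "ennreal (\<mu> (X \<union> Y)) \<le> upper_variation \<mu> (A \<union> B)"
        using that by (intro upper_variation_upper) auto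
      then show ?thesis using 1 add by simp
    next
      case 2
      have "ennreal (\<mu> Y) \<le> upper_variation \<mu> (A \<union> B)"
        using that by (intro upper_variation_upper) auto
      then show ?thesis using 2 by (simp add: ennreal_neg)
    next
      case 3
      have "ennreal (\<mu> X) \<le> upper_variation \<mu> (A \<union> B)"
        using that by (intro upper_variation_upper) auto
      then show ?thesis using 3 by (simp add: ennreal_neg)
    qed
  qed
  have "upper_variation \<mu> A + ennreal (\<mu> Y) \<le> upper_variation \<mu> (A \<union> B)"
    if Y: "Y \<in> sets borel" "Y \<subseteq> B" for Y
    unfolding upper_variation_def[of \<mu> A]
    by (subst ennreal_SUP_add_left[symmetric]) (auto intro!: SUP_least *[OF _ _ Y])
  then show ?thesis
    unfolding upper_variation_def[of \<mu> B]
    by (subst ennreal_SUP_add_right) (auto intro!: SUP_least)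
qed

text \<open>
  Disjoint Borel subsets of the \<open>A i\<close> can be united, which gives \<open>\<le>\<close>; a Borel subset \<open>B\<close> of the
  union splits into the \<open>B \<inter> A i\<close>, which gives \<open>\<ge>\<close>.
\<close>

lemma countably_additive_upper_variation:
  assumes \<mu>: "signed_borel_measure \<mu>"
  shows "countably_additive (sets borel) (upper_variation \<mu>)"
proof (rule countably_additiveI)
  fix A :: "nat \<Rightarrow> 'a set"
  assume A: "range A \<subseteq> sets borel" and dis: "disjoint_family A"
  have fin: "(\<Sum>i<n. upper_variation \<mu> (A i)) \<le> upper_variation \<mu> (\<Union>i<n. A i)" for n
  proof (induction n)
    case (Suc n)
    have "(\<Sum>i<Suc n. upper_variation \<mu> (A i))
        \<le> upper_variation \<mu> (\<Union>i<n. A i) + upper_variation \<mu> (A n)"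
      using Suc by (simp add: add_right_mono)
    also have "\<dots> \<le> upper_variation \<mu> ((\<Union>i<n. A i) \<union> A n)"
    proof (rule upper_variation_add[OF \<mu>])
      show "(\<Union>i<n. A i) \<inter> A n = {}"
      proof -
        have "A i \<inter> A n = {}" if "i < n" for i
          using dis that unfolding disjoint_family_on_def by (metis UNIV_I less_irrefl)
        then show ?thesis by blast
      qed
    qed
    also have "(\<Union>i<n. A i) \<union> A n = (\<Union>i<Suc n. A i)" by (auto simp: less_Suc_eq)
    finally show ?case .
  qed simp
  have mono: "upper_variation \<mu> X \<le> upper_variation \<mu> Y" if "X \<subseteq> Y" for X Y
    unfolding upper_variation_def using that by (intro SUP_subset_mono) auto
  show "(\<Sum>i. upper_variation \<mu> (A i)) = upper_variation \<mu> (\<Union>i. A i)"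
  proof (rule antisym)
    show "(\<Sum>i. upper_variation \<mu> (A i)) \<le> upper_variation \<mu> (\<Union>i. A i)"
      unfolding suminf_eq_SUP
      by (intro SUP_least order_trans[OF fin] mono) auto
    show "upper_variation \<mu> (\<Union>i. A i) \<le> (\<Sum>i. upper_variation \<mu> (A i))"
      unfolding upper_variation_def[of \<mu> "\<Union>i. A i"]
    proof (rule SUP_least, clarify)
      fix B :: "'a set" assume B: "B \<in> sets borel" "B \<subseteq> (\<Union>i. A i)"
      have "range (\<lambda>n. B \<inter> A n) \<subseteq> sets borel" using A B by auto
      moreover have "disjoint_family (\<lambda>n. B \<inter> A n)"
        using dis by (rule disjoint_family_on_bisimulation) auto
      ultimately have "(\<lambda>n. \<mu> (B \<inter> A n)) sums \<mu> (\<Union>n. B \<inter> A n)"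
        using \<mu> unfolding signed_borel_measure_def by blast
      also have "(\<Union>n. B \<inter> A n) = B" using B by auto
      finally have s: "(\<lambda>n. \<mu> (B \<inter> A n)) sums \<mu> B" .
      have "(\<lambda>n. ennreal (\<Sum>i<n. \<mu> (B \<inter> A i))) \<longlonglongrightarrow> ennreal (\<mu> B)"
        using s unfolding sums_def by (rule tendsto_ennrealI)
      moreover have "ennreal (\<Sum>i<n. \<mu> (B \<inter> A i)) \<le> (\<Sum>i. upper_variation \<mu> (A i))" for n
      proof -
        have "ennreal (\<Sum>i<n. \<mu> (B \<inter> A i)) \<le> (\<Sum>i<n. ennreal (\<mu> (B \<inter> A i)))"
        proof (induction n)
          case (Suc n)
          have "ennreal (a + b) \<le> ennreal a + ennreal b" for a b
            by (cases "0 \<le> a"; cases "0 \<le> b")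
               (auto simp: ennreal_neg intro!: ennreal_leI)
          then show ?case using Suc
            by (simp) (meson add_right_mono order_trans)
        qed simp
        also have "\<dots> \<le> (\<Sum>i<n. upper_variation \<mu> (A i))"
          using A B by (intro sum_mono upper_variation_upper) auto
        also have "\<dots> \<le> (\<Sum>i. upper_variation \<mu> (A i))"
          by (rule sum_le_suminf) auto
        finally show ?thesis .
      qed
      ultimately show "ennreal (\<mu> B) \<le> (\<Sum>i. upper_variation \<mu> (A i))"
        by (intro LIMSEQ_le_const2) auto
    qed
  qed
qed

lemma sets_positive_part [simp]: "sets (positive_part \<mu>) = sets borel"
  and space_positive_part [simp]: "space (positive_part \<mu>) = UNIV"
  using sets.sets_measure_of_eq[of borel] by (auto simp: positive_part_def space_measure_of_conv)

lemma sets_total_variation [simp]: "sets (total_variation \<mu>) = sets borel"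
  and space_total_variation [simp]: "space (total_variation \<mu>) = UNIV"
  using sets.sets_measure_of_eq[of borel] by (auto simp: total_variation_def space_measure_of_conv)

lemma emeasure_positive_part:
  assumes \<mu>: "signed_borel_measure \<mu>" and A: "A \<in> sets borel"
  shows "emeasure (positive_part \<mu>) A = upper_variation \<mu> A"
proof (rule emeasure_measure_of[where \<Omega>=UNIV and A="sets borel"])
  show "positive_part \<mu> = measure_of UNIV (sets borel) (upper_variation \<mu>)"
    by (simp add: positive_part_def upper_variation_def[abs_def])
  have "upper_variation \<mu> {} = 0"
    using \<mu> by (auto simp: upper_variation_def signed_borel_measure_def bot_ennreal[symmetric]
        intro!: SUP_eqI)
  then show "positive (sets (positive_part \<mu>)) (upper_variation \<mu>)"
    by (simp add: positive_def)
  show "countably_additive (sets (positive_part \<mu>)) (upper_variation \<mu>)"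
    using countably_additive_upper_variation[OF \<mu>] by simp
qed (use A in auto)

text \<open>
  If the upper variation were infinite on the whole space, one could repeatedly split off a piece of
  measure at least \<open>1\<close> in absolute value while keeping infinite upper variation on the rest. The
  pieces are disjoint, so the series of their measures would have to converge.
\<close>

lemma upper_variation_finite:
  assumes \<mu>: "signed_borel_measure \<mu>"
  shows "upper_variation \<mu> UNIV < \<infinity>"
proof (rule ccontr)
  assume "\<not> ?thesis"
  then have top: "upper_variation \<mu> UNIV = \<infinity>"
    by (metis infinity_ennreal_def top.not_eq_extremum)
  define Inf where "Inf E \<longleftrightarrow> E \<in> sets borel \<and> upper_variation \<mu> E = \<infinity>" for E
  have split: "\<exists>A\<in>sets borel. A \<subseteq> E \<and> 1 \<le> \<bar>\<mu> A\<bar> \<and> Inf (E - A)" if E: "Inf E" for E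
  proof -
    have "ennreal (\<bar>\<mu> E\<bar> + 1) < upper_variation \<mu> E" using E by (simp add: Inf_def)
    then obtain B where B: "B \<in> sets borel" "B \<subseteq> E" "ennreal (\<bar>\<mu> E\<bar> + 1) < ennreal (\<mu> B)"
      unfolding upper_variation_def less_SUP_iff by auto
    then have big: "\<bar>\<mu> E\<bar> + 1 < \<mu> B"
      by (metis abs_ge_zero add_nonneg_nonneg ennreal_less_iff zero_le_one)
    have "(\<Sum>i. upper_variation \<mu> (binaryset B (E - B) i)) = upper_variation \<mu> (\<Union>i. binaryset B (E - B) i)"
      using countably_additive_upper_variation[OF \<mu>] B E disjoint_family_binaryset[of B "E - B"]
      unfolding countably_additive_def Inf_def
      by (auto simp: range_binaryset_eq UN_binaryset_eq)
    also have "(\<Sum>i. upper_variation \<mu> (binaryset B (E - B) i))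
        = upper_variation \<mu> B + upper_variation \<mu> (E - B)"
      using \<mu> by (intro suminf_binaryset_eq)
        (auto simp: upper_variation_def signed_borel_measure_def bot_ennreal[symmetric] intro!: SUP_eqI)
    also have "upper_variation \<mu> (\<Union>i. binaryset B (E - B) i) = \<infinity>"
      using B E by (simp add: UN_binaryset_eq Inf_def Un_absorb1)
    finally consider "upper_variation \<mu> (E - B) = \<infinity>" | "upper_variation \<mu> B = \<infinity>"
      by (auto simp: infinity_ennreal_def)
    then show ?thesis
    proof cases
      case 1
      then show ?thesis using B E big by (intro bexI[of _ B]) (auto simp: Inf_def)
    next
      case 2
      have "\<mu> (E - B) = \<mu> E - \<mu> B"
        using B E by (intro signed_borel_Diff[OF \<mu>]) (auto simp: Inf_def)
      moreover have "E - (E - B) = B" using B by auto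
      ultimately show ?thesis using B E big 2
        by (intro bexI[of _ "E - B"]) (auto simp: Inf_def)
    qed
  qed
  then obtain piece where piece: "\<And>E. Inf E \<Longrightarrow> piece E \<in> sets borel \<and> piece E \<subseteq> E \<and> 1 \<le> \<bar>\<mu> (piece E)\<bar> \<and> Inf (E - piece E)"
    by metis
  define E where "E n = ((\<lambda>E. E - piece E) ^^ n) UNIV" for n :: nat
  define A where "A n = piece (E n)" for n
  have EInf: "Inf (E n)" for n
    by (induction n) (auto simp: E_def Inf_def[of UNIV] top piece)
  have Esuc: "E (Suc n) = E n - A n" for n by (simp add: E_def A_def)
  have Emono: "E n \<subseteq> E m" if "m \<le> n" for m n
    using that by (induction rule: dec_induct) (auto simp: Esuc)
  have A: "A n \<in> sets borel" "A n \<subseteq> E n" "1 \<le> \<bar>\<mu> (A n)\<bar>" for n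
    using piece[OF EInf[of n]] by (auto simp: A_def)
  have "A m \<inter> A n = {}" if "m < n" for m n
    using A(2)[of n] Emono[of "Suc m" n] that by (auto simp: Esuc)
  then have dis: "disjoint_family A"
    unfolding disjoint_family_on_def by (metis Int_commute linorder_neqE_nat)
  have "range A \<subseteq> sets borel" using A(1) by auto
  then have "(\<lambda>n. \<mu> (A n)) sums \<mu> (\<Union>n. A n)"
    using \<mu> dis unfolding signed_borel_measure_def by blast
  then have "(\<lambda>n. \<mu> (A n)) \<longlonglongrightarrow> 0" by (intro summable_LIMSEQ_zero sums_summable)
  then obtain n where "\<bar>\<mu> (A n)\<bar> < 1"
    using LIMSEQ_D[of "\<lambda>n. \<mu> (A n)" 0 1] by auto
  with A(3)[of n] show False by simp
qed

lemma finite_borel_positive_part: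
  assumes "signed_borel_measure \<mu>"
  shows "finite_borel (positive_part \<mu>)"
  using upper_variation_finite[OF assms]
  by (auto simp: finite_borel_def emeasure_positive_part[OF assms] less_top intro!: finite_measureI)

lemma finite_borel_negative_part:
  assumes "signed_borel_measure \<mu>"
  shows "finite_borel (negative_part \<mu>)"
  unfolding negative_part_def by (intro finite_borel_positive_part signed_borel_uminus assms)

text \<open>
  For \<open>B \<subseteq> A\<close> the identity \<open>\<mu> B = \<mu> A - \<mu> (A - B)\<close> trades large values of \<open>\<mu>\<close> for large values of
  \<open>- \<mu>\<close>; taking the supremum over \<open>B\<close> on either side gives the two inequalities.
\<close>

lemma jordan_decomposition:
  assumes \<mu>: "signed_borel_measure \<mu>" and A: "A \<in> sets borel"
  shows "\<mu> A = measure (positive_part \<mu>) A - measure (negative_part \<mu>) A"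
proof -
  interpret p: finite_measure "positive_part \<mu>"
    using finite_borel_positive_part[OF \<mu>] by (rule finite_borelD)
  interpret n: finite_measure "negative_part \<mu>"
    using finite_borel_negative_part[OF \<mu>] by (rule finite_borelD)
  have p: "ennreal (measure (positive_part \<mu>) A) = upper_variation \<mu> A"
    by (simp add: p.emeasure_eq_measure[symmetric] emeasure_positive_part[OF \<mu> A])
  have n: "ennreal (measure (negative_part \<mu>) A) = upper_variation (\<lambda>A. - \<mu> A) A"
    unfolding negative_part_def
    by (simp add: n.emeasure_eq_measure[symmetric, unfolded negative_part_def]
        emeasure_positive_part[OF signed_borel_uminus[OF \<mu>] A])
  have up: "\<mu> B \<le> measure (positive_part \<mu>) A" "- \<mu> B \<le> measure (negative_part \<mu>) A"
    if B: "B \<in> sets borel" "B \<subseteq> A" for B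
    using upper_variation_upper[OF B, of \<mu>] upper_variation_upper[OF B, of "\<lambda>A. - \<mu> A"]
    by (auto simp: p[symmetric] n[symmetric] ennreal_le_iff)
  have "upper_variation \<mu> A \<le> ennreal (\<mu> A + measure (negative_part \<mu>) A)"
    unfolding upper_variation_def
  proof (rule SUP_least, clarify)
    fix B assume B: "B \<in> sets borel" "B \<subseteq> A"
    have "\<mu> (A - B) = \<mu> A - \<mu> B" using B A by (intro signed_borel_Diff[OF \<mu>])
    with up(2)[of "A - B"] A B show "ennreal (\<mu> B) \<le> ennreal (\<mu> A + measure (negative_part \<mu>) A)"
      by (intro ennreal_leI) auto
  qed
  then have 1: "measure (positive_part \<mu>) A \<le> \<mu> A + measure (negative_part \<mu>) A"
    using up(2)[OF A order_refl] by (simp add: p[symmetric] ennreal_le_iff)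
  have "upper_variation (\<lambda>A. - \<mu> A) A \<le> ennreal (measure (positive_part \<mu>) A - \<mu> A)"
    unfolding upper_variation_def
  proof (rule SUP_least, clarify)
    fix B assume B: "B \<in> sets borel" "B \<subseteq> A"
    have "\<mu> (A - B) = \<mu> A - \<mu> B" using B A by (intro signed_borel_Diff[OF \<mu>])
    with up(1)[of "A - B"] A B show "ennreal (- \<mu> B) \<le> ennreal (measure (positive_part \<mu>) A - \<mu> A)"
      by (intro ennreal_leI) auto
  qed
  then have 2: "measure (negative_part \<mu>) A \<le> measure (positive_part \<mu>) A - \<mu> A"
    using up(1)[OF A order_refl] by (simp add: n[symmetric] ennreal_le_iff)
  from 1 2 show ?thesis by simp
qed

lemma signed_integral_combination:
  fixes P :: "'i \<Rightarrow> 'a::topological_space measure" and f :: "'a \<Rightarrow> complex"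
  assumes \<mu>: "signed_borel_measure \<mu>" and fin: "finite I"
    and P: "\<And>i. i \<in> I \<Longrightarrow> finite_borel (P i)"
    and eq: "\<And>B. B \<in> sets borel \<Longrightarrow> \<mu> B = (\<Sum>i\<in>I. c i * measure (P i) B)"
    and f: "f \<in> borel_measurable borel" and C: "\<And>x. norm (f x) \<le> C"
  shows "signed_integral \<mu> f = (\<Sum>i\<in>I. of_real (c i) * (LINT x|P i. f x))"
proof -
  \<comment> \<open>\<open>Inl\<close> indexes the two Jordan parts and \<open>Inr\<close> the given measures, so that the two representations
      of \<open>\<mu>\<close> become one vanishing combination.\<close>
  define J where "J = insert (Inl True) (insert (Inl False) (Inr ` I))"
  define Q where "Q j = (case j of Inl b \<Rightarrow> if b then positive_part \<mu> else negative_part \<mu> | Inr i \<Rightarrow> P i)" for j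
  define d where "d j = (case j of Inl b \<Rightarrow> if b then 1 else -1 | Inr i \<Rightarrow> - c i)" for j
  have sumJ: "(\<Sum>j\<in>J. h j) = h (Inl True) + h (Inl False) + (\<Sum>i\<in>I. h (Inr i))"
    for h :: "bool + 'i \<Rightarrow> 'b::comm_ring"
    using fin by (auto simp: J_def sum.reindex inj_on_def image_iff)
  have "(\<Sum>j\<in>J. of_real (d j) * (LINT x|Q j. f x)) = 0"
  proof (rule weighted_integral_eq_0[OF _ _ f C])
    show "finite J" using fin by (simp add: J_def)
    show "finite_borel (Q j)" if "j \<in> J" for j
      using that P finite_borel_positive_part[OF \<mu>] finite_borel_negative_part[OF \<mu>]
      by (auto simp: J_def Q_def)
    show "(\<Sum>j\<in>J. d j * measure (Q j) B) = 0" if B: "B \<in> sets borel" for B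
      using eq[OF B] jordan_decomposition[OF \<mu> B]
      by (simp add: sumJ d_def Q_def sum_negf)
  qed
  then show ?thesis
    by (simp add: sumJ d_def Q_def sum_negf signed_integral_def)
qed

lemma signed_integral_combination_real:
  fixes P :: "'i \<Rightarrow> 'a::topological_space measure" and f :: "'a \<Rightarrow> real"
  assumes \<mu>: "signed_borel_measure \<mu>" and fin: "finite I"
    and P: "\<And>i. i \<in> I \<Longrightarrow> finite_borel (P i)"
    and eq: "\<And>B. B \<in> sets borel \<Longrightarrow> \<mu> B = (\<Sum>i\<in>I. c i * measure (P i) B)"
    and f: "f \<in> borel_measurable borel" and C: "\<And>x. \<bar>f x\<bar> \<le> C"
  shows "signed_integral \<mu> f = (\<Sum>i\<in>I. c i * (LINT x|P i. f x))"
proof -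
  have "complex_of_real (signed_integral \<mu> f) = signed_integral \<mu> (\<lambda>x. complex_of_real (f x))"
    by (simp add: signed_integral_def)
  also have "\<dots> = (\<Sum>i\<in>I. of_real (c i) * (LINT x|P i. complex_of_real (f x)))"
    using f C by (intro signed_integral_combination[OF \<mu> fin P eq, where C=C]) auto
  also have "\<dots> = complex_of_real (\<Sum>i\<in>I. c i * (LINT x|P i. f x))" by simp
  finally show ?thesis by (simp only: of_real_eq_iff)
qed


section \<open>Regularity\<close>

text \<open>
  For finite Borel measures this is regularity, in a form that measures dominated by regular ones
  inherit.
\<close>

definition approximable :: "'a::topological_space measure \<Rightarrow> bool" where
  "approximable M \<longleftrightarrow> (\<forall>B\<in>sets borel. \<forall>\<epsilon>>0. \<exists>K U. compact K \<and> K \<subseteq> B \<and> open U \<and> B \<subseteq> U \<and>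
     measure M (U - K) < \<epsilon>)"

lemma approximableE:
  assumes "approximable M" "B \<in> sets borel" "\<epsilon> > 0"
  obtains K U where "compact K" "K \<subseteq> B" "open U" "B \<subseteq> U" "measure M (U - K) < \<epsilon>"
  using assms unfolding approximable_def by metis

lemma approximable_if_regular:
  fixes M :: "'a::t2_space measure"
  assumes M: "finite_borel M" and reg: "regular_borel_measure M"
  shows "approximable M"
  unfolding approximable_def
proof (intro ballI allI impI)
  fix B :: "'a set" and \<epsilon> :: real assume B: "B \<in> sets borel" and \<epsilon>: "\<epsilon> > 0"
  interpret finite_measure M using M by (rule finite_borelD)
  note [simp] = finite_borelD(2)[OF M]
  have inner: "emeasure M B = (SUP K\<in>{K. K \<subseteq> B \<and> compact K}. emeasure M K)"
    and outer: "emeasure M B = (INF U\<in>{U. B \<subseteq> U \<and> open U}. emeasure M U)"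
    using reg B unfolding regular_borel_measure_def by blast+
  have "\<exists>K. compact K \<and> K \<subseteq> B \<and> measure M B - \<epsilon> / 2 < measure M K"
  proof (cases "measure M B < \<epsilon> / 2")
    case True
    then show ?thesis by (intro exI[of _ "{}"]) auto
  next
    case False
    then have "ennreal (measure M B - \<epsilon> / 2) < (SUP K\<in>{K. K \<subseteq> B \<and> compact K}. emeasure M K)"
      using \<epsilon> unfolding inner[symmetric] unfolding emeasure_eq_measure by (intro ennreal_lessI) auto
    then obtain K where K: "K \<subseteq> B" "compact K" "ennreal (measure M B - \<epsilon> / 2) < emeasure M K"
      unfolding less_SUP_iff by auto
    then have "measure M B - \<epsilon> / 2 < measure M K"
      using False by (simp add: emeasure_eq_measure ennreal_less_iff)
    then show ?thesis using K by blast
  qed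
  then obtain K where K: "compact K" "K \<subseteq> B" "measure M B - \<epsilon> / 2 < measure M K" by blast
  have "(INF U\<in>{U. B \<subseteq> U \<and> open U}. emeasure M U) < ennreal (measure M B + \<epsilon> / 2)"
    using \<epsilon> unfolding outer[symmetric] unfolding emeasure_eq_measure
    by (intro ennreal_lessI) (auto simp: add_nonneg_pos)
  then obtain U where U: "B \<subseteq> U" "open U" "emeasure M U < ennreal (measure M B + \<epsilon> / 2)"
    unfolding INF_less_iff by auto
  then have "measure M U < measure M B + \<epsilon> / 2"
    by (simp add: emeasure_eq_measure ennreal_less_iff)
  moreover have "measure M (U - K) = measure M U - measure M K"
    using K U compact_imp_closed[OF K(1)] by (intro finite_measure_Diff) auto
  ultimately show "\<exists>K U. compact K \<and> K \<subseteq> B \<and> open U \<and> B \<subseteq> U \<and> measure M (U - K) < \<epsilon>"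
    using K U by (intro exI[of _ K] exI[of _ U]) auto
qed

lemma regular_if_approximable:
  fixes M :: "'a::t2_space measure"
  assumes M: "finite_borel M" and app: "approximable M"
  shows "regular_borel_measure M"
  unfolding regular_borel_measure_def
proof (intro conjI ballI)
  interpret finite_measure M using M by (rule finite_borelD)
  note [simp] = finite_borelD(2)[OF M]
  show "sets M = sets borel" by simp
  fix B :: "'a set" assume B: "B \<in> sets borel"
  have close: "\<exists>K U. compact K \<and> K \<subseteq> B \<and> open U \<and> B \<subseteq> U \<and>
       emeasure M B \<le> emeasure M K + ennreal e \<and> emeasure M U \<le> emeasure M B + ennreal e"
    if e: "e > 0" for e
  proof -
    obtain K U where KU: "compact K" "K \<subseteq> B" "open U" "B \<subseteq> U" "measure M (U - K) < e"
      by (rule approximableE[OF app B e])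
    have Kc: "K \<in> sets borel" "U \<in> sets borel" using KU(3) compact_imp_closed[OF KU(1)] by auto
    have "measure M (U - K) = measure M U - measure M K"
      using KU Kc by (intro finite_measure_Diff) auto
    moreover have "measure M K \<le> measure M B" "measure M B \<le> measure M U"
      using KU Kc B by (auto intro!: finite_measure_mono)
    ultimately have "measure M B \<le> measure M K + e" "measure M U \<le> measure M B + e"
      using KU by auto
    then show ?thesis
      using KU e by (intro exI[of _ K] exI[of _ U])
        (auto simp: emeasure_eq_measure ennreal_plus[symmetric] simp del: ennreal_plus)
  qed
  show "emeasure M B = (SUP K\<in>{K. K \<subseteq> B \<and> compact K}. emeasure M K)"
  proof (rule antisym)
    show "(SUP K\<in>{K. K \<subseteq> B \<and> compact K}. emeasure M K) \<le> emeasure M B"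
      using B by (auto intro!: SUP_least emeasure_mono)
    show "emeasure M B \<le> (SUP K\<in>{K. K \<subseteq> B \<and> compact K}. emeasure M K)"
    proof (rule ennreal_le_epsilon)
      fix e :: real assume "0 < e"
      then obtain K where K: "compact K" "K \<subseteq> B" "emeasure M B \<le> emeasure M K + ennreal e"
        using close by blast
      then have "emeasure M K \<le> (SUP K\<in>{K. K \<subseteq> B \<and> compact K}. emeasure M K)"
        by (intro SUP_upper) auto
      with K(3) show "emeasure M B \<le> (SUP K\<in>{K. K \<subseteq> B \<and> compact K}. emeasure M K) + ennreal e"
        by (meson add_right_mono order_trans)
    qed
  qed
  show "emeasure M B = (INF U\<in>{U. B \<subseteq> U \<and> open U}. emeasure M U)"
  proof (rule antisym)
    show "emeasure M B \<le> (INF U\<in>{U. B \<subseteq> U \<and> open U}. emeasure M U)"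
      by (auto intro!: INF_greatest emeasure_mono)
    show "(INF U\<in>{U. B \<subseteq> U \<and> open U}. emeasure M U) \<le> emeasure M B"
    proof (rule ennreal_le_epsilon)
      fix e :: real assume "0 < e"
      then obtain U where U: "open U" "B \<subseteq> U" "emeasure M U \<le> emeasure M B + ennreal e"
        using close by blast
      then have "(INF U\<in>{U. B \<subseteq> U \<and> open U}. emeasure M U) \<le> emeasure M U"
        by (intro INF_lower) auto
      with U(3) show "(INF U\<in>{U. B \<subseteq> U \<and> open U}. emeasure M U) \<le> emeasure M B + ennreal e"
        by (meson order_trans)
    qed
  qed
qed

text \<open>
  The union of the compact sets and the intersection of the open sets that serve the single
  measures serve all of them at once, hence also \<open>T\<close>.
\<close>

lemma approximable_dominated:
  fixes T :: "'a::t2_space measure"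
  assumes fin: "finite I" and P: "\<And>i. i \<in> I \<Longrightarrow> finite_borel (P i)"
    and app: "\<And>i. i \<in> I \<Longrightarrow> approximable (P i)" and c: "\<And>i. i \<in> I \<Longrightarrow> c i \<ge> 0"
    and le: "\<And>B. B \<in> sets borel \<Longrightarrow> measure T B \<le> (\<Sum>i\<in>I. c i * measure (P i) B)"
  shows "approximable T"
  unfolding approximable_def
proof (intro ballI allI impI)
  fix B :: "'a set" and \<epsilon> :: real assume B: "B \<in> sets borel" and \<epsilon>: "\<epsilon> > 0"
  define \<delta> where "\<delta> = \<epsilon> / (sum c I + 1)"
  have pos: "sum c I \<ge> 0" using c by (rule sum_nonneg)
  then have \<delta>: "\<delta> > 0" using \<epsilon> by (simp add: \<delta>_def)
  have "\<forall>i\<in>I. \<exists>K U. compact K \<and> K \<subseteq> B \<and> open U \<and> B \<subseteq> U \<and> measure (P i) (U - K) < \<delta>"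
    using app B \<delta> by (auto simp: approximable_def)
  then obtain K U where KU: "\<And>i. i \<in> I \<Longrightarrow> compact (K i) \<and> K i \<subseteq> B \<and> open (U i) \<and> B \<subseteq> U i \<and>
      measure (P i) (U i - K i) < \<delta>"
    by metis
  define K' where "K' = (\<Union>i\<in>I. K i)"
  define U' where "U' = (\<Inter>i\<in>I. U i)"
  have K': "compact K'" "K' \<subseteq> B" and U': "open U'" "B \<subseteq> U'"
    using KU fin unfolding K'_def U'_def by (auto intro!: compact_UN)
  have small: "measure (P i) (U' - K') \<le> \<delta>" if i: "i \<in> I" for i
  proof -
    interpret finite_measure "P i" using P[OF i] by (rule finite_borelD)
    have "measure (P i) (U' - K') \<le> measure (P i) (U i - K i)"
      using KU[OF i] i compact_imp_closed[of "K i"] finite_borelD(2)[OF P[OF i]]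
      by (intro finite_measure_mono) (auto simp: U'_def K'_def)
    with KU[OF i] show ?thesis by simp
  qed
  have "measure T (U' - K') \<le> (\<Sum>i\<in>I. c i * measure (P i) (U' - K'))"
    using K' U' compact_imp_closed[OF K'(1)] by (intro le sets.Diff) auto
  also have "\<dots> \<le> (\<Sum>i\<in>I. c i * \<delta>)"
    using c small by (intro sum_mono mult_left_mono) auto
  also have "\<dots> = sum c I * \<delta>" by (simp add: sum_distrib_right)
  also have "\<dots> < (sum c I + 1) * \<delta>" using \<delta> by simp
  also have "\<dots> = \<epsilon>" using pos by (simp add: \<delta>_def)
  finally show "\<exists>K U. compact K \<and> K \<subseteq> B \<and> open U \<and> B \<subseteq> U \<and> measure T (U - K) < \<epsilon>"
    using K' U' by blast
qed

lemma emeasure_total_variation: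
  assumes \<mu>: "signed_borel_measure \<mu>" and A: "A \<in> sets borel"
  shows "emeasure (total_variation \<mu>) A = emeasure (positive_part \<mu>) A + emeasure (negative_part \<mu>) A"
proof (rule emeasure_measure_of[where \<Omega>=UNIV and A="sets borel"])
  show "countably_additive (sets (total_variation \<mu>))
      (\<lambda>A. emeasure (positive_part \<mu>) A + emeasure (negative_part \<mu>) A)"
    by (rule countably_additiveI)
      (simp add: suminf_add[symmetric] suminf_emeasure negative_part_def)
qed (use A in \<open>auto simp: total_variation_def positive_def\<close>)

lemma finite_borel_total_variation:
  assumes "signed_borel_measure \<mu>"
  shows "finite_borel (total_variation \<mu>)"
proof -
  interpret p: finite_measure "positive_part \<mu>"
    using finite_borel_positive_part[OF assms] by (rule finite_borelD)
  interpret n: finite_measure "negative_part \<mu>"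
    using finite_borel_negative_part[OF assms] by (rule finite_borelD)
  show ?thesis
    by (auto simp: finite_borel_def emeasure_total_variation[OF assms] intro!: finite_measureI)
qed

lemma measure_total_variation:
  assumes \<mu>: "signed_borel_measure \<mu>" and A: "A \<in> sets borel"
  shows "measure (total_variation \<mu>) A = measure (positive_part \<mu>) A + measure (negative_part \<mu>) A"
proof -
  interpret p: finite_measure "positive_part \<mu>"
    using finite_borel_positive_part[OF \<mu>] by (rule finite_borelD)
  interpret n: finite_measure "negative_part \<mu>"
    using finite_borel_negative_part[OF \<mu>] by (rule finite_borelD)
  interpret t: finite_measure "total_variation \<mu>"
    using finite_borel_total_variation[OF \<mu>] by (rule finite_borelD)
  show ?thesis
    using emeasure_total_variation[OF \<mu> A]
    by (simp add: p.emeasure_eq_measure n.emeasure_eq_measure t.emeasure_eq_measure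
        ennreal_plus[symmetric] del: ennreal_plus)
qed

lemma signed_borel_combination:
  fixes P :: "'i \<Rightarrow> 'a::topological_space measure"
  assumes P: "\<And>i. i \<in> I \<Longrightarrow> finite_borel (P i)"
    and eq: "\<And>B. B \<in> sets borel \<Longrightarrow> \<mu> B = (\<Sum>i\<in>I. c i * measure (P i) B)"
  shows "signed_borel_measure \<mu>"
  unfolding signed_borel_measure_def
proof (intro conjI allI impI)
  show "\<mu> {} = 0" by (simp add: eq)
  fix A :: "nat \<Rightarrow> 'a set"
  assume A: "range A \<subseteq> sets borel" and dis: "disjoint_family A"
  have "(\<lambda>n. \<Sum>i\<in>I. c i * measure (P i) (A n)) sums (\<Sum>i\<in>I. c i * measure (P i) (\<Union>n. A n))"
  proof (intro sums_sum sums_mult)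
    fix i assume i: "i \<in> I"
    interpret finite_measure "P i" using P[OF i] by (rule finite_borelD)
    show "(\<lambda>n. measure (P i) (A n)) sums measure (P i) (\<Union>n. A n)"
      using A dis finite_borelD(2)[OF P[OF i]] by (intro finite_measure_UNION) auto
  qed
  moreover have "\<mu> (A n) = (\<Sum>i\<in>I. c i * measure (P i) (A n))" for n
    using A by (intro eq) auto
  moreover have "\<mu> (\<Union>n. A n) = (\<Sum>i\<in>I. c i * measure (P i) (\<Union>n. A n))"
    using A by (intro eq) auto
  ultimately show "(\<lambda>n. \<mu> (A n)) sums \<mu> (\<Union>n. A n)" by simp
qed

lemma measure_positive_part_le:
  assumes \<mu>: "signed_borel_measure \<mu>" and A: "A \<in> sets borel"
    and le: "\<And>B. B \<in> sets borel \<Longrightarrow> B \<subseteq> A \<Longrightarrow> \<mu> B \<le> S"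
  shows "measure (positive_part \<mu>) A \<le> S"
proof -
  interpret finite_measure "positive_part \<mu>"
    using finite_borel_positive_part[OF \<mu>] by (rule finite_borelD)
  have S: "S \<ge> 0" using le[of "{}"] \<mu> by (simp add: signed_borel_measure_def)
  have "ennreal (measure (positive_part \<mu>) A) \<le> ennreal S"
    unfolding emeasure_eq_measure[symmetric] emeasure_positive_part[OF \<mu> A] upper_variation_def
    by (intro SUP_least ennreal_leI) (auto intro: le)
  then show ?thesis using S by simp
qed

text \<open>
  Both Jordan parts of a combination are dominated by the combination with coefficients \<open>\<bar>c i\<bar>\<close>,
  so the total variation inherits regularity from the given measures.
\<close>

lemma regular_combination:
  fixes P :: "'i \<Rightarrow> 'a::t2_space measure"
  assumes fin: "finite I" and P: "\<And>i. i \<in> I \<Longrightarrow> finite_borel (P i)"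
    and app: "\<And>i. i \<in> I \<Longrightarrow> approximable (P i)"
    and eq: "\<And>B. B \<in> sets borel \<Longrightarrow> \<mu> B = (\<Sum>i\<in>I. c i * measure (P i) B)"
  shows "\<mu> \<in> regular_signed_measures"
proof -
  have \<mu>: "signed_borel_measure \<mu>" by (rule signed_borel_combination[OF P eq])
  have abs: "\<bar>\<mu> B\<bar> \<le> (\<Sum>i\<in>I. \<bar>c i\<bar> * measure (P i) A)"
    if B: "B \<in> sets borel" "B \<subseteq> A" and A: "A \<in> sets borel" for A B
  proof -
    have "\<bar>\<mu> B\<bar> \<le> (\<Sum>i\<in>I. \<bar>c i\<bar> * measure (P i) B)"
      unfolding eq[OF B(1)] by (rule order_trans[OF sum_abs]) (simp add: abs_mult)
    also have "\<dots> \<le> (\<Sum>i\<in>I. \<bar>c i\<bar> * measure (P i) A)"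
    proof (intro sum_mono mult_left_mono)
      fix i assume i: "i \<in> I"
      interpret finite_measure "P i" using P[OF i] by (rule finite_borelD)
      show "measure (P i) B \<le> measure (P i) A"
        using B A finite_borelD(2)[OF P[OF i]] by (intro finite_measure_mono) auto
    qed simp
    finally show ?thesis .
  qed
  have "measure (total_variation \<mu>) A \<le> (\<Sum>i\<in>I. (2 * \<bar>c i\<bar>) * measure (P i) A)"
    if A: "A \<in> sets borel" for A
  proof -
    have "measure (positive_part \<mu>) A \<le> (\<Sum>i\<in>I. \<bar>c i\<bar> * measure (P i) A)"
      using abs[OF _ _ A] by (intro measure_positive_part_le[OF \<mu> A]) (auto simp: abs_le_iff)
    moreover have "measure (negative_part \<mu>) A \<le> (\<Sum>i\<in>I. \<bar>c i\<bar> * measure (P i) A)"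
      unfolding negative_part_def using abs[OF _ _ A]
      by (intro measure_positive_part_le[OF signed_borel_uminus[OF \<mu>] A]) (auto simp: abs_le_iff)
    ultimately show ?thesis
      by (simp add: measure_total_variation[OF \<mu> A] sum_distrib_left[symmetric] mult.assoc)
  qed
  then have "approximable (total_variation \<mu>)"
    by (intro approximable_dominated[OF fin P app, where c="\<lambda>i. 2 * \<bar>c i\<bar>"]) auto
  then show ?thesis
    using \<mu> regular_if_approximable[OF finite_borel_total_variation[OF \<mu>]]
    by (simp add: regular_signed_measures_def)
qed

lemma nonneg_signed_measure:
  assumes \<mu>: "signed_borel_measure \<mu>" and nn: "\<And>B. B \<in> sets borel \<Longrightarrow> 0 \<le> \<mu> B"
    and A: "A \<in> sets borel"
  shows "measure (positive_part \<mu>) A = \<mu> A" "measure (negative_part \<mu>) A = 0"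
    "measure (total_variation \<mu>) A = \<mu> A"
proof -
  have "measure (negative_part \<mu>) A \<le> 0"
    unfolding negative_part_def using nn
    by (intro measure_positive_part_le[OF signed_borel_uminus[OF \<mu>] A]) auto
  then show "measure (negative_part \<mu>) A = 0" using measure_nonneg[of _ A] by (rule antisym)
  then show "measure (positive_part \<mu>) A = \<mu> A" "measure (total_variation \<mu>) A = \<mu> A"
    using jordan_decomposition[OF \<mu> A] measure_total_variation[OF \<mu> A] by auto
qed

lemma regular_signed_measuresD:
  assumes "\<mu> \<in> regular_signed_measures"
  shows "signed_borel_measure \<mu>" "approximable (total_variation \<mu> :: 'a::t2_space measure)"
  using assms approximable_if_regular[OF finite_borel_total_variation]
  by (auto simp: regular_signed_measures_def)

section \<open>The Dirac measure\<close>

definition dirac :: "'a::topological_space \<Rightarrow> 'a measure" where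
  "dirac a = distr (count_space {()}) borel (\<lambda>_. a)"

lemma finite_borel_dirac: "finite_borel (dirac a)"
  by (auto simp: finite_borel_def dirac_def intro!: finite_measure.finite_measure_distr
      finite_measure_count_space)

lemma measure_dirac: "B \<in> sets borel \<Longrightarrow> measure (dirac a) B = indicator B a"
  by (auto simp: dirac_def measure_distr measure_count_space indicator_def vimage_def)

lemma integral_dirac:
  fixes f :: "'a::topological_space \<Rightarrow> 'b::{banach, second_countable_topology}"
  assumes "f \<in> borel_measurable borel"
  shows "(LINT x|dirac a. f x) = f a"
  using assms by (simp add: dirac_def integral_distr lebesgue_integral_count_space_finite)

lemma approximable_dirac: "approximable (dirac (a :: 'a::t2_space))"
  unfolding approximable_def
proof (intro ballI allI impI)
  fix B :: "'a set" and \<epsilon> :: real assume "B \<in> sets borel" "\<epsilon> > 0"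
  then show "\<exists>K U. compact K \<and> K \<subseteq> B \<and> open U \<and> B \<subseteq> U \<and> measure (dirac a) (U - K) < \<epsilon>"
  proof (cases "a \<in> B")
    case True
    then show ?thesis using \<open>\<epsilon> > 0\<close>
      by (intro exI[of _ "{a}"] exI[of _ UNIV]) (auto simp: measure_dirac)
  next
    case False
    then show ?thesis using \<open>\<epsilon> > 0\<close>
      by (intro exI[of _ "{}"] exI[of _ "- {a}"]) (auto simp: measure_dirac)
  qed
qed

section \<open>Radon measures from finitely additive states\<close>

definition bdd :: "('a \<Rightarrow> real) \<Rightarrow> bool" where
  "bdd f \<longleftrightarrow> (\<exists>C. \<forall>x. \<bar>f x\<bar> \<le> C)"

text \<open>
  A finitely additive probability, as a functional on all bounded functions, measurable or not. It
  is described by pointwise equations and inequalities, hence by closed conditions for pointwise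
  convergence.
\<close>

definition state :: "(('a \<Rightarrow> real) \<Rightarrow> real) \<Rightarrow> bool" where
  "state \<Lambda> \<longleftrightarrow>
     (\<forall>f g. bdd f \<longrightarrow> bdd g \<longrightarrow> \<Lambda> (\<lambda>x. f x + g x) = \<Lambda> f + \<Lambda> g) \<and>
     (\<forall>c f. bdd f \<longrightarrow> \<Lambda> (\<lambda>x. c * f x) = c * \<Lambda> f) \<and>
     (\<forall>f. bdd f \<longrightarrow> (\<forall>x. 0 \<le> f x) \<longrightarrow> 0 \<le> \<Lambda> f) \<and>
     \<Lambda> (\<lambda>_. 1) = 1"

lemma bddI: "(\<And>x. \<bar>f x\<bar> \<le> C) \<Longrightarrow> bdd f"
  by (auto simp: bdd_def)

lemma bdd_const [simp]: "bdd (\<lambda>_. c)"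
  by (rule bddI[of _ "\<bar>c\<bar>"]) simp

lemma bdd_indicator [simp]: "bdd (indicator A)"
  by (rule bddI[of _ 1]) (simp add: indicator_def)

lemma bdd_add [simp]: "bdd f \<Longrightarrow> bdd g \<Longrightarrow> bdd (\<lambda>x. f x + g x)"
  unfolding bdd_def by (metis abs_triangle_ineq add_mono order_trans)

lemma bdd_cmult [simp]: "bdd f \<Longrightarrow> bdd (\<lambda>x. c * f x)"
  unfolding bdd_def by (metis abs_ge_zero abs_mult mult_left_mono)

lemma bdd_diff [simp]: "bdd f \<Longrightarrow> bdd g \<Longrightarrow> bdd (\<lambda>x. f x - g x)"
  using bdd_add[of f "\<lambda>x. (-1) * g x"] bdd_cmult[of g "-1"] by simp

lemma bdd_sum [simp]: "(\<And>i. i \<in> I \<Longrightarrow> bdd (f i)) \<Longrightarrow> bdd (\<lambda>x. \<Sum>i\<in>I. f i x)"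
  by (induction I rule: infinite_finite_induct) auto

lemma compact_separation:
  fixes S T :: "'a::t2_space set"
  assumes "compact (UNIV :: 'a set)" "closed S" "closed T" "S \<inter> T = {}"
  obtains U V where "open U" "open V" "S \<subseteq> U" "T \<subseteq> V" "U \<inter> V = {}"
proof -
  have "normal_space (euclidean :: 'a topology)"
    using assms(1) by (intro compact_Hausdorff_or_regular_imp_normal_space)
      (auto simp: compact_space_def Hausdorff_space_def disjnt_def separation_t2)
  then show ?thesis
    using assms that unfolding normal_space_def disjnt_def closed_closedin[symmetric] open_openin[symmetric]
    by metis
qed

lemma compact_Urysohn:
  fixes S T :: "'a::t2_space set"
  assumes "compact (UNIV :: 'a set)" "closed S" "closed T" "S \<inter> T = {}"
  obtains f :: "'a \<Rightarrow> real" where "continuous_on UNIV f" "\<And>x. 0 \<le> f x" "\<And>x. f x \<le> 1"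
    "\<And>x. x \<in> S \<Longrightarrow> f x = 1" "\<And>x. x \<in> T \<Longrightarrow> f x = 0"
proof -
  have "normal_space (euclidean :: 'a topology)"
    using assms(1) by (intro compact_Hausdorff_or_regular_imp_normal_space)
      (auto simp: compact_space_def Hausdorff_space_def disjnt_def separation_t2)
  then obtain f :: "'a \<Rightarrow> real" where "continuous_map euclidean (top_of_set {0..1}) f" "f ` T \<subseteq> {0}" "f ` S \<subseteq> {1}"
    using Urysohn_lemma[of euclidean T S 0 1] assms by (auto simp: disjnt_def)
  then show ?thesis
    by (intro that[of f]) (auto simp: continuous_map_in_subtopology image_subset_iff)
qed

text \<open>
  A finitely additive probability on all subsets of a compact space is turned into a Radon measure
  that integrates continuous functions in the same way: closed sets determine the inner content of
  open sets, open sets determine an outer measure, and Caratheodory's construction applies.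
\<close>

locale compact_state =
  fixes \<Lambda> :: "('a::t2_space \<Rightarrow> real) \<Rightarrow> real"
  assumes compact_space: "compact (UNIV :: 'a set)" and st: "state \<Lambda>"
begin

lemma add: "bdd f \<Longrightarrow> bdd g \<Longrightarrow> \<Lambda> (\<lambda>x. f x + g x) = \<Lambda> f + \<Lambda> g"
  and cmult: "bdd f \<Longrightarrow> \<Lambda> (\<lambda>x. c * f x) = c * \<Lambda> f"
  and nonneg: "bdd f \<Longrightarrow> (\<And>x. 0 \<le> f x) \<Longrightarrow> 0 \<le> \<Lambda> f"
  and one: "\<Lambda> (\<lambda>_. 1) = 1"
  using st by (auto simp: state_def)

lemma const: "\<Lambda> (\<lambda>_. c) = c"
  using cmult[of "\<lambda>_. 1" c] one by simp

lemma diff: "bdd f \<Longrightarrow> bdd g \<Longrightarrow> \<Lambda> (\<lambda>x. f x - g x) = \<Lambda> f - \<Lambda> g"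
  using add[of f "\<lambda>x. (-1) * g x"] cmult[of g "-1"] bdd_cmult[of g "-1"] by simp

lemma mono:
  assumes "bdd f" "bdd g" "\<And>x. f x \<le> g x"
  shows "\<Lambda> f \<le> \<Lambda> g"
proof -
  have "0 \<le> \<Lambda> (\<lambda>x. g x - f x)" using assms by (intro nonneg bdd_diff) auto
  also have "\<dots> = \<Lambda> g - \<Lambda> f" using assms by (intro diff)
  finally show ?thesis by simp
qed

lemma sum:
  assumes "\<And>i. i \<in> I \<Longrightarrow> bdd (f i)"
  shows "\<Lambda> (\<lambda>x. \<Sum>i\<in>I. f i x) = (\<Sum>i\<in>I. \<Lambda> (f i))"
  using assms by (induction I rule: infinite_finite_induct) (auto simp: const add)

definition content :: "'a set \<Rightarrow> real" where "content A = \<Lambda> (indicator A)"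

lemma content_mono: "A \<subseteq> B \<Longrightarrow> content A \<le> content B"
  unfolding content_def by (intro mono) (auto simp: indicator_def)

lemma content_nonneg: "0 \<le> content A"
  unfolding content_def by (intro nonneg) auto

lemma content_disjoint: "A \<inter> B = {} \<Longrightarrow> content (A \<union> B) = content A + content B"
proof -
  assume dis: "A \<inter> B = {}"
  have "indicator (A \<union> B) = (\<lambda>x. indicator A x + indicator B x :: real)"
    using dis by (auto simp: indicator_def fun_eq_iff)
  then show ?thesis by (simp add: content_def add)
qed

lemma content_subadd: "content (A \<union> B) \<le> content A + content B"
proof -
  have "\<Lambda> (indicator (A \<union> B)) \<le> \<Lambda> (\<lambda>x. indicator A x + indicator B x)"
    by (intro mono bdd_add bdd_indicator) (auto simp: indicator_def)
  then show ?thesis by (simp add: content_def add)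
qed

lemma content_empty: "content {} = 0"
proof -
  have "(indicator {} :: 'a \<Rightarrow> real) = (\<lambda>_. 0)" by (simp add: fun_eq_iff)
  then show ?thesis using const[of 0] by (simp add: content_def)
qed

lemma content_UNIV: "content UNIV = 1"
  using one by (simp add: content_def indicator_def)

definition inner_content :: "'a set \<Rightarrow> ennreal" where
  "inner_content U = (SUP C\<in>{C. closed C \<and> C \<subseteq> U}. ennreal (content C))"

definition outer :: "'a set \<Rightarrow> ennreal" where
  "outer A = (INF U\<in>{U. open U \<and> A \<subseteq> U}. inner_content U)"

lemma content_le_inner: "closed C \<Longrightarrow> C \<subseteq> U \<Longrightarrow> ennreal (content C) \<le> inner_content U"
  unfolding inner_content_def by (rule SUP_upper) auto

lemma inner_le_content: "inner_content U \<le> ennreal (content U)"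
  unfolding inner_content_def by (auto intro!: SUP_least ennreal_leI content_mono)

lemma inner_mono: "U \<subseteq> V \<Longrightarrow> inner_content U \<le> inner_content V"
  unfolding inner_content_def by (intro SUP_subset_mono) auto

lemma outer_open: "open U \<Longrightarrow> outer U = inner_content U"
  unfolding outer_def by (intro antisym INF_lower INF_greatest) (auto intro: inner_mono)

lemma outer_mono: "A \<subseteq> B \<Longrightarrow> outer A \<le> outer B"
  unfolding outer_def by (intro INF_superset_mono) auto

lemma outer_le_inner: "open U \<Longrightarrow> A \<subseteq> U \<Longrightarrow> outer A \<le> inner_content U"
  unfolding outer_def by (rule INF_lower) auto

text \<open>
  A closed set covered by two open sets is the union of two closed sets, each inside one of them,
  by normality of the space.
\<close>

lemma inner_subadd:
  assumes "open U" "open V"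
  shows "inner_content (U \<union> V) \<le> inner_content U + inner_content V"
  unfolding inner_content_def[of "U \<union> V"]
proof (rule SUP_least, clarify)
  fix C assume C: "closed C" "C \<subseteq> U \<union> V"
  have "closed (C - U)" "closed (C - V)" "(C - U) \<inter> (C - V) = {}" using C assms by auto
  then obtain W1 W2 where W: "open W1" "open W2" "C - U \<subseteq> W1" "C - V \<subseteq> W2" "W1 \<inter> W2 = {}"
    using compact_separation[OF compact_space] by metis
  have "C = (C - W1) \<union> (C - W2)" using W by auto
  then have "content C \<le> content (C - W1) + content (C - W2)" by (metis content_subadd)
  then have "ennreal (content C) \<le> ennreal (content (C - W1)) + ennreal (content (C - W2))"
    by (simp add: content_nonneg ennreal_plus[symmetric] del: ennreal_plus)
  also have "\<dots> \<le> inner_content U + inner_content V"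
    using C W by (intro add_mono content_le_inner) auto
  finally show "ennreal (content C) \<le> inner_content U + inner_content V" .
qed

text \<open>
  Closed sets are compact, so a countable open cover may be replaced by a finite one.
\<close>

lemma inner_countably_subadd:
  fixes U :: "nat \<Rightarrow> 'a set"
  assumes U: "\<And>n. open (U n)"
  shows "inner_content (\<Union>n. U n) \<le> (\<Sum>n. inner_content (U n))"
  unfolding inner_content_def[of "\<Union>n. U n"]
proof (rule SUP_least, clarify)
  fix C assume C: "closed C" "C \<subseteq> (\<Union>n. U n)"
  have fin: "inner_content (\<Union>i<n. U i) \<le> (\<Sum>i<n. inner_content (U i))" for n
  proof (induction n)
    case 0
    show ?case using inner_le_content[of "{}"] by (simp add: content_empty)
  next
    case (Suc n)
    have "(\<Union>i<Suc n. U i) = (\<Union>i<n. U i) \<union> U n" by (auto simp: less_Suc_eq)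
    then have "inner_content (\<Union>i<Suc n. U i) \<le> inner_content (\<Union>i<n. U i) + inner_content (U n)"
      using U by (auto intro!: inner_subadd)
    also have "\<dots> \<le> (\<Sum>i<Suc n. inner_content (U i))" using Suc by (simp add: add_right_mono)
    finally show ?case .
  qed
  have "compact C" using compact_Int_closed[OF compact_space C(1)] by simp
  then obtain I where I: "finite I" "C \<subseteq> (\<Union>i\<in>I. U i)"
    using compactE_image[of C UNIV U] C U by metis
  then have "I \<subseteq> {..<Suc (Max (insert 0 I))}"
    by (auto simp: less_Suc_eq_le)
  then have "C \<subseteq> (\<Union>i<Suc (Max (insert 0 I)). U i)"
    using I(2) by blast
  then have "ennreal (content C) \<le> inner_content (\<Union>i<Suc (Max (insert 0 I)). U i)"
    by (intro content_le_inner C)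
  also have "\<dots> \<le> (\<Sum>i<Suc (Max (insert 0 I)). inner_content (U i))" by (rule fin)
  also have "\<dots> \<le> (\<Sum>n. inner_content (U n))" by (rule sum_le_suminf) auto
  finally show "ennreal (content C) \<le> (\<Sum>n. inner_content (U n))" .
qed

lemma outer_finite: "outer A \<le> 1"
  using outer_le_inner[of UNIV A] inner_le_content[of UNIV] by (simp add: content_UNIV)

lemma outer_approx:
  assumes "e > 0"
  obtains U where "open U" "A \<subseteq> U" "inner_content U \<le> outer A + ennreal e"
proof -
  have "outer A < outer A + ennreal e"
  proof (cases "outer A")
    case (real r)
    then show ?thesis using assms
      by (simp add: ennreal_plus[symmetric] ennreal_less_iff del: ennreal_plus)
  next
    case top
    then show ?thesis using outer_finite[of A] by (simp add: top_unique)
  qed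
  then obtain U where "open U" "A \<subseteq> U" "inner_content U < outer A + ennreal e"
    unfolding outer_def[of A] INF_less_iff by auto
  then show ?thesis using that less_imp_le by blast
qed

lemma outer_countably_subadd:
  fixes A :: "nat \<Rightarrow> 'a set"
  shows "outer (\<Union>n. A n) \<le> (\<Sum>n. outer (A n))"
proof (rule ennreal_le_epsilon)
  fix e :: real assume e: "0 < e"
  have "\<exists>U. open U \<and> A n \<subseteq> U \<and> inner_content U \<le> outer (A n) + ennreal (e * (1/2) ^ Suc n)" for n
    using outer_approx[of "e * (1/2) ^ Suc n" "A n"] e by (metis half_gt_zero_iff mult_pos_pos zero_less_one zero_less_power)
  then obtain U where U: "\<And>n. open (U n)" "\<And>n. A n \<subseteq> U n"
    "\<And>n. inner_content (U n) \<le> outer (A n) + ennreal (e * (1/2) ^ Suc n)" by metis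
  have "outer (\<Union>n. A n) \<le> inner_content (\<Union>n. U n)"
    using U(1,2) by (intro outer_le_inner) auto
  also have "\<dots> \<le> (\<Sum>n. inner_content (U n))" by (rule inner_countably_subadd[OF U(1)])
  also have "\<dots> \<le> (\<Sum>n. outer (A n) + ennreal (e * (1/2) ^ Suc n))"
    by (intro suminf_le U) auto
  also have "\<dots> = (\<Sum>n. outer (A n)) + (\<Sum>n. ennreal (e * (1/2) ^ Suc n))"
    by (rule suminf_add[symmetric]) auto
  also have "(\<Sum>n. ennreal (e * (1/2) ^ Suc n)) = ennreal e"
  proof (rule suminf_ennreal_eq)
    show "0 \<le> e * (1/2) ^ Suc n" for n using e by simp
    show "(\<lambda>n. e * (1/2) ^ Suc n) sums e" using sums_mult[OF power_half_series, of e] by simp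
  qed
  finally show "outer (\<Union>n. A n) \<le> (\<Sum>n. outer (A n)) + ennreal e" .
qed

lemma outer_empty: "outer {} = 0"
  using outer_open[of "{}"] inner_le_content[of "{}"] by (simp add: content_empty)

lemma outer_subadd: "outer (A \<union> B) \<le> outer A + outer B"
proof -
  have "outer (\<Union>n. binaryset A B n) \<le> (\<Sum>n. outer (binaryset A B n))" by (rule outer_countably_subadd)
  also have "\<dots> = outer A + outer B" by (rule suminf_binaryset_eq) (rule outer_empty)
  finally show ?thesis by (simp add: UN_binaryset_eq)
qed

text \<open>
  An open set \<open>U\<close> splits the measure of an open set \<open>V\<close> additively: a closed set inside \<open>U \<inter> V\<close> leaves an open
  remainder of \<open>V\<close> that still contains \<open>V - U\<close>, and finite additivity applies to the two disjoint
  closed sets.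
\<close>

lemma outer_split_open:
  assumes U: "open U" and V: "open V"
  shows "outer (U \<inter> V) + outer (V - U) \<le> inner_content V"
proof -
  have "ennreal (content C) + outer (V - U) \<le> inner_content V" if C: "closed C" "C \<subseteq> U \<inter> V" for C
  proof -
    have "outer (V - U) \<le> inner_content (V - C)"
      using C V by (intro outer_le_inner) auto
    moreover have "ennreal (content C) + inner_content (V - C) \<le> inner_content V"
      unfolding inner_content_def[of "V - C"]
    proof -
      have ne: "{D. closed D \<and> D \<subseteq> V - C} \<noteq> {}" by auto
      have "ennreal (content C) + ennreal (content D) \<le> inner_content V" if D: "closed D" "D \<subseteq> V - C" for D
      proof -
      have "content (C \<union> D) = content C + content D" using D by (intro content_disjoint) auto
      then have "ennreal (content C) + ennreal (content D) = ennreal (content (C \<union> D))"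
        by (simp add: content_nonneg)
      also have "\<dots> \<le> inner_content V" using C D by (intro content_le_inner) auto
      finally show ?thesis .
      qed
      then show "ennreal (content C) + (SUP D\<in>{D. closed D \<and> D \<subseteq> V - C}. ennreal (content D)) \<le> inner_content V"
        unfolding ennreal_SUP_add_right[OF ne] by (auto intro!: SUP_least)
    qed
    ultimately show ?thesis by (meson add_left_mono order_trans)
  qed
  then have "inner_content (U \<inter> V) + outer (V - U) \<le> inner_content V"
    unfolding inner_content_def[of "U \<inter> V"]
    by (subst ennreal_SUP_add_left[symmetric]) (auto intro!: SUP_least)
  then show ?thesis using outer_open[OF open_Int[OF U V]] by simp
qed

lemma open_in_lambda_system:
  assumes "open U"
  shows "U \<in> lambda_system UNIV (Pow UNIV) outer"
proof -
  have "outer (U \<inter> X) + outer ((UNIV - U) \<inter> X) = outer X" for X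
  proof (rule antisym)
    have "outer ((U \<inter> X) \<union> ((UNIV - U) \<inter> X)) \<le> outer (U \<inter> X) + outer ((UNIV - U) \<inter> X)"
      by (rule outer_subadd)
    also have "(U \<inter> X) \<union> ((UNIV - U) \<inter> X) = X" by auto
    finally show "outer X \<le> outer (U \<inter> X) + outer ((UNIV - U) \<inter> X)" .
    show "outer (U \<inter> X) + outer ((UNIV - U) \<inter> X) \<le> outer X"
      unfolding outer_def[of X]
    proof (rule INF_greatest, clarify)
      fix V assume V: "open V" "X \<subseteq> V"
      have "outer (U \<inter> X) + outer ((UNIV - U) \<inter> X) \<le> outer (U \<inter> V) + outer (V - U)"
        using V by (intro add_mono outer_mono) auto
      also have "\<dots> \<le> inner_content V" using assms V by (intro outer_split_open)
      finally show "outer (U \<inter> X) + outer ((UNIV - U) \<inter> X) \<le> inner_content V" .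
    qed
  qed
  then show ?thesis by (simp add: lambda_system_def)
qed

definition radon :: "'a measure" where
  "radon = measure_of UNIV (sets borel) outer"

lemma sets_radon [simp]: "sets radon = sets borel"
  and space_radon [simp]: "space radon = UNIV"
  using sets.sets_measure_of_eq[of borel] by (auto simp: radon_def space_measure_of_conv)

lemma emeasure_radon:
  assumes "A \<in> sets borel"
  shows "emeasure radon A = outer A"
proof -
  have ms: "measure_space UNIV (lambda_system UNIV (Pow UNIV) outer) outer"
  proof (rule sigma_algebra.caratheodory_lemma[OF sigma_algebra_Pow])
    show "outer_measure_space (Pow UNIV) outer"
      by (auto simp: outer_measure_space_def positive_def increasing_def countably_subadditive_def
          outer_empty outer_mono outer_countably_subadd)
  qed
  have "sigma_algebra UNIV (lambda_system UNIV (Pow UNIV) outer)"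
    using ms by (simp add: measure_space_def)
  moreover have "{U::'a set. open U} \<subseteq> lambda_system UNIV (Pow UNIV) outer"
    using open_in_lambda_system by blast
  ultimately have "sigma_sets UNIV {U::'a set. open U} \<subseteq> lambda_system UNIV (Pow UNIV) outer"
    by (rule sigma_algebra.sigma_sets_subset)
  then have "sets borel \<subseteq> lambda_system UNIV (Pow UNIV) outer"
    by (simp add: borel_def)
  then have "measure_space UNIV (sets borel) outer"
    using sets.sigma_algebra_axioms[of "borel :: 'a measure"]
    by (intro measure_down[OF ms]) (simp add: space_borel)
  then have "positive (sets radon) outer" "countably_additive (sets radon) outer"
    by (simp_all add: measure_space_def)
  then show ?thesis
    using assms by (intro emeasure_measure_of[OF radon_def]) auto
qed

lemma finite_borel_radon: "finite_borel radon"
  using outer_finite[of UNIV] by (auto simp: finite_borel_def emeasure_radon top_unique intro!: finite_measureI)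

sublocale radon: finite_measure radon
  using finite_borel_radon by (rule finite_borelD)

text \<open>
  Passing from the content to the measure, closed sets can only gain and open sets can only lose
  mass.
\<close>

lemma content_le_radon:
  assumes "closed C"
  shows "content C \<le> measure radon C"
proof -
  have "ennreal (content C) \<le> outer C"
    unfolding outer_def by (auto intro!: INF_greatest content_le_inner assms)
  also have "\<dots> = ennreal (measure radon C)"
    using assms by (simp add: emeasure_radon[symmetric] radon.emeasure_eq_measure)
  finally show ?thesis by simp
qed

lemma radon_le_content:
  assumes "open U"
  shows "measure radon U \<le> content U"
proof -
  have "ennreal (measure radon U) = outer U"
    using assms by (simp add: emeasure_radon[symmetric] radon.emeasure_eq_measure)
  also have "\<dots> \<le> ennreal (content U)"
    using assms inner_le_content by (simp add: outer_open)
  finally show ?thesis by (simp add: content_nonneg)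
qed

lemma measure_radon_UNIV: "measure radon UNIV = 1"
  using content_le_radon[of UNIV] radon_le_content[of UNIV] by (simp add: content_UNIV)

lemma radon_outside:
  assumes "closed K" "\<Lambda> (indicator K) = 1"
  shows "measure radon (- K) = 0"
proof -
  have "content (K \<union> - K) = content K + content (- K)" by (rule content_disjoint) auto
  then have "content (- K) = 0" using assms by (simp add: content_UNIV content_def[of K])
  then have "measure radon (- K) \<le> 0" using radon_le_content[of "- K"] assms(1) by (simp add: open_Compl)
  then show ?thesis by (simp add: measure_le_0_iff)
qed

text \<open>
  Outer approximation holds by construction; inner approximation of a set is outer approximation
  of its complement.
\<close>

lemma approximable_radon: "approximable radon"
  unfolding approximable_def
proof (intro ballI allI impI)
  fix B :: "'a set" and \<epsilon> :: real assume B: "B \<in> sets borel" and \<epsilon>: "\<epsilon> > 0"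
  have out: "\<exists>U. open U \<and> A \<subseteq> U \<and> measure radon (U - A) \<le> \<epsilon> / 4" if A: "A \<in> sets borel" for A
  proof -
    obtain U where U: "open U" "A \<subseteq> U" "inner_content U \<le> outer A + ennreal (\<epsilon> / 4)"
      using \<epsilon> outer_approx[of "\<epsilon> / 4" A] by (metis divide_pos_pos zero_less_numeral)
    then have "emeasure radon U \<le> emeasure radon A + ennreal (\<epsilon> / 4)"
      using A by (simp add: emeasure_radon outer_open)
    then have "measure radon U \<le> measure radon A + \<epsilon> / 4"
      using \<epsilon> by (simp add: radon.emeasure_eq_measure ennreal_plus[symmetric] del: ennreal_plus)
    moreover have "measure radon (U - A) = measure radon U - measure radon A"
      using U A by (intro radon.finite_measure_Diff) auto
    ultimately show ?thesis using U by auto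
  qed
  obtain U where U: "open U" "B \<subseteq> U" "measure radon (U - B) \<le> \<epsilon> / 4" using out[OF B] by blast
  obtain V where V: "open V" "- B \<subseteq> V" "measure radon (V - - B) \<le> \<epsilon> / 4" using out[of "- B"] B by auto
  have K: "closed (- V)" "- V \<subseteq> B" using V by auto
  have "compact (- V)" using compact_Int_closed[OF compact_space K(1)] by simp
  moreover have "measure radon (U - - V) < \<epsilon>"
  proof -
    have "measure radon (U - - V) \<le> measure radon ((U - B) \<union> (V - - B))"
      using U V B by (intro radon.finite_measure_mono) auto
    also have "\<dots> \<le> measure radon (U - B) + measure radon (V - - B)"
      using U V B by (intro measure_subadditive) (auto simp: less_top[symmetric])
    also have "\<dots> < \<epsilon>" using U V \<epsilon> by linarith
    finally show ?thesis .
  qed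
  ultimately show "\<exists>K U. compact K \<and> K \<subseteq> B \<and> open U \<and> B \<subseteq> U \<and> measure radon (U - K) < \<epsilon>"
    using K U by blast
qed

text \<open>
  A number \<open>t\<close> of \<open>[0, n]\<close> lies between the numbers of integers \<open>i < n\<close> with \<open>i + 1 \<le> t\<close> and with
  \<open>i \<le> t\<close>. Applied to \<open>t = n f x\<close>, this compares \<open>f\<close> with averages of indicators of its level
  sets.
\<close>

lemma count_levels:
  fixes t :: real
  shows "t \<le> real n \<Longrightarrow> t \<le> (\<Sum>i<n. of_bool (real i \<le> t))"
    and "0 \<le> t \<Longrightarrow> (\<Sum>i<n. of_bool (real (Suc i) \<le> t)) \<le> t"
proof -
  show "t \<le> (\<Sum>i<n. of_bool (real i \<le> t))" if "t \<le> real n"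
    using that
  proof (induction n)
    case (Suc n)
    show ?case
    proof (cases "t \<le> real n")
      case True
      then show ?thesis using Suc by auto
    next
      case False
      then have "(\<Sum>i<Suc n. of_bool (real i \<le> t)) = (\<Sum>i<Suc n. 1 :: real)"
        by (intro sum.cong) auto
      then show ?thesis using Suc by simp
    qed
  qed simp
  show "(\<Sum>i<n. of_bool (real (Suc i) \<le> t)) \<le> t" if "0 \<le> t"
  proof (induction n)
    case (Suc n)
    show ?case
    proof (cases "real (Suc n) \<le> t")
      case True
      then have "(\<Sum>i<Suc n. of_bool (real (Suc i) \<le> t)) = (\<Sum>i<Suc n. 1 :: real)"
        by (intro sum.cong) auto
      then show ?thesis using True by simp
    next
      case False
      then show ?thesis using Suc by simp
    qed
  qed (use that in simp)
qed

text \<open>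
  An inequality between the two functionals passes from closed sets to functions because the
  superlevel sets \<open>{f \<ge> i / n}\<close> are closed, and the averages of their indicators over \<open>i = 0..n-1\<close>
  and over \<open>i = 1..n\<close> enclose \<open>f\<close> and differ by at most \<open>1 / n\<close>.
\<close>

lemma state_le_integral_01:
  assumes f: "continuous_on UNIV f" and f01: "\<And>x. 0 \<le> f x" "\<And>x. f x \<le> 1"
  shows "\<Lambda> f \<le> (LINT x|radon. f x)"
proof -
  have fm: "f \<in> borel_measurable borel" using f by (rule borel_measurable_continuous_onI)
  have bf: "bdd f" by (intro bddI[of _ 1]) (simp add: abs_of_nonneg f01)
  have int: "integrable radon f"
    using f01 by (intro finite_borel_integrable[OF finite_borel_radon fm, of 1]) auto
  have step: "\<Lambda> f \<le> (LINT x|radon. f x) + 1 / real n" if n: "n > 0" for n :: nat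
  proof -
    define L where "L i = {x. real i / real n \<le> f x}" for i :: nat
    have Lc: "closed (L i)" for i unfolding L_def by (intro closed_Collect_le f continuous_on_const)
    have Lind: "indicator (L i) x = (of_bool (real i \<le> real n * f x) :: real)" for i x
      using n by (simp add: L_def indicator_def field_simps)
    have upper: "real n * f x \<le> (\<Sum>i<n. indicator (L i) x)" for x
      unfolding Lind using n f01[of x] by (intro count_levels(1)) (simp add: mult_left_le)
    have lower: "(\<Sum>i<n. indicator (L (Suc i)) x) \<le> real n * f x" for x
      unfolding Lind using f01[of x] by (intro count_levels(2)) simp
    have "real n * \<Lambda> f = \<Lambda> (\<lambda>x. real n * f x)" using cmult[OF bf] by simp
    also have "\<dots> \<le> \<Lambda> (\<lambda>x. \<Sum>i<n. indicator (L i) x)"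
      by (intro mono upper bdd_cmult bf bdd_sum) auto
    also have "\<dots> = (\<Sum>i<n. content (L i))" by (simp add: sum content_def)
    also have "\<dots> \<le> (\<Sum>i<n. measure radon (L i))" by (intro sum_mono content_le_radon Lc)
    also have "\<dots> \<le> 1 + (\<Sum>i<n. measure radon (L (Suc i)))"
    proof -
      have "(\<Sum>i<n. measure radon (L i)) \<le> (\<Sum>i<Suc n. measure radon (L i))" by simp
      also have "\<dots> = measure radon (L 0) + (\<Sum>i<n. measure radon (L (Suc i)))"
        by (rule sum.lessThan_Suc_shift)
      also have "measure radon (L 0) \<le> 1"
        using radon.finite_measure_mono[of "L 0" UNIV] by (simp add: measure_radon_UNIV)
      finally show ?thesis by simp
    qed
    also have "(\<Sum>i<n. measure radon (L (Suc i))) = (\<Sum>i<n. LINT x|radon. indicator (L (Suc i)) x)"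
      by simp
    also have "\<dots> = (LINT x|radon. (\<Sum>i<n. indicator (L (Suc i)) x))"
      using Lc by (intro Bochner_Integration.integral_sum[symmetric]) (auto simp: less_top[symmetric])
    also have "\<dots> \<le> (LINT x|radon. real n * f x)"
      using Lc int lower
      by (intro integral_mono Bochner_Integration.integrable_sum) (auto simp: less_top[symmetric])
    also have "\<dots> = real n * (LINT x|radon. f x)" by simp
    finally have "real n * \<Lambda> f \<le> 1 + real n * (LINT x|radon. f x)" by simp
    then show ?thesis using n by (simp add: field_simps)
  qed
  have "(\<lambda>n. (LINT x|radon. f x) + 1 / real n) \<longlonglongrightarrow> (LINT x|radon. f x) + 0"
    by (intro tendsto_add tendsto_const lim_const_over_n)
  then show ?thesis
    using step by (intro LIMSEQ_le_const[of _ "LINT x|radon. f x"]) (auto intro!: exI[of _ 1])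
qed

text \<open>
  The one-sided estimate, applied to \<open>g\<close> and to \<open>1 - g\<close>, is an equality, since both functionals
  are normalised. A bounded \<open>f\<close> is an affine image of such a \<open>g\<close> with values in \<open>[0, 1]\<close>.
\<close>

lemma integral_radon:
  assumes f: "continuous_on UNIV f"
  shows "(LINT x|radon. f x) = \<Lambda> f"
proof -
  have "compact (f ` UNIV)" using f compact_space by (rule compact_continuous_image)
  then obtain C0 where C0: "\<And>x. \<bar>f x\<bar> \<le> C0"
    using compact_imp_bounded[of "range f"] by (auto simp: bounded_iff)
  define C where "C = C0 + 1"
  have C: "\<bar>f x\<bar> \<le> C" "C > 0" for x using C0[of x] abs_ge_zero[of "f x"] unfolding C_def by linarith+
  define g where "g x = (f x + C) / (2 * C)" for x
  have g: "continuous_on UNIV g" unfolding g_def using C(2) by (intro continuous_intros f) auto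
  have g01: "0 \<le> g x" "g x \<le> 1" for x
    using C(1)[of x] C(2) by (auto simp: g_def abs_le_iff field_simps)
  have bg: "bdd g" by (intro bddI[of _ 1]) (simp add: abs_of_nonneg g01)
  have int: "integrable radon g"
    using g01 by (intro finite_borel_integrable[OF finite_borel_radon borel_measurable_continuous_onI[OF g], of 1]) auto
  have "\<Lambda> g \<le> (LINT x|radon. g x)" by (rule state_le_integral_01[OF g g01])
  moreover have "(LINT x|radon. g x) \<le> \<Lambda> g"
  proof -
    have "\<Lambda> (\<lambda>x. 1 - g x) \<le> (LINT x|radon. 1 - g x)"
      using g01 by (intro state_le_integral_01 continuous_intros g) auto
    moreover have "\<Lambda> (\<lambda>x. 1 - g x) = 1 - \<Lambda> g"
      using bg by (simp add: diff const)
    moreover have "(LINT x|radon. 1 - g x) = 1 - (LINT x|radon. g x)"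
      using int by (simp add: measure_radon_UNIV)
    ultimately show ?thesis by simp
  qed
  ultimately have eq: "(LINT x|radon. g x) = \<Lambda> g" by simp
  have fg: "f x = (2 * C) * g x - C" for x using C(2) by (simp add: g_def)
  have "(LINT x|radon. f x) = (LINT x|radon. (2 * C) * g x - C)" by (simp add: fg[symmetric])
  also have "\<dots> = 2 * C * (LINT x|radon. g x) - C"
    using int by (simp add: measure_radon_UNIV)
  also have "\<dots> = \<Lambda> (\<lambda>x. (2 * C) * g x - C)"
    using diff[of "\<lambda>x. (2 * C) * g x" "\<lambda>_. C"] bdd_cmult[OF bg] cmult[OF bg] by (simp add: eq const)
  also have "\<dots> = \<Lambda> f" by (simp add: fg[symmetric])
  finally show ?thesis .
qed

end

section \<open>Continuous functions and Haar measure on a compact Abelian group\<close>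

abbreviation cont :: "('a::topological_space \<Rightarrow> 'b::topological_space) \<Rightarrow> bool" where
  "cont f \<equiv> continuous_on UNIV f"

lemma cont_shift:
  fixes f :: "'a::topological_ab_group_add \<Rightarrow> 'b::topological_space"
  assumes "cont f"
  shows "cont (\<lambda>x. f (x + a))" "cont (\<lambda>x. f (a + x))" "cont (\<lambda>x. f (x - a))" "cont (\<lambda>x. f (a - x))"
  by (rule continuous_on_compose2[OF assms]; auto intro!: continuous_intros)+

lemma contI_uniform:
  fixes f :: "'a::topological_ab_group_add \<Rightarrow> 'b::real_normed_vector"
  assumes "\<And>\<epsilon>. \<epsilon> > 0 \<Longrightarrow> \<exists>U. open U \<and> 0 \<in> U \<and> (\<forall>x. \<forall>t\<in>U. norm (f (x + t) - f x) \<le> \<epsilon>)"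
  shows "cont f"
  unfolding continuous_on_def
proof (intro ballI tendstoI)
  fix x :: 'a and \<epsilon> :: real assume "\<epsilon> > 0"
  then obtain U where U: "open U" "0 \<in> U" "\<And>x t. t \<in> U \<Longrightarrow> norm (f (x + t) - f x) \<le> \<epsilon> / 2"
    using assms[of "\<epsilon> / 2"] by auto
  have "open ((\<lambda>y. y - x) -` U)" by (intro open_vimage U continuous_intros)
  moreover have "x \<in> (\<lambda>y. y - x) -` U" using U by simp
  moreover have "dist (f y) (f x) < \<epsilon>" if "y \<in> (\<lambda>y. y - x) -` U" for y
    using U(3)[of "y - x" x] that \<open>\<epsilon> > 0\<close> by (simp add: dist_norm)
  ultimately show "\<forall>\<^sub>F y in at x within UNIV. dist (f y) (f x) < \<epsilon>"
    unfolding eventually_at_topological by blast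
qed

lemma open_neighbourhood_sum:
  fixes W :: "'a::topological_ab_group_add set"
  assumes "open W" "0 \<in> W"
  obtains V where "open V" "0 \<in> V" "\<And>x y. x \<in> V \<Longrightarrow> y \<in> V \<Longrightarrow> x + y \<in> W"
proof -
  have "open ((\<lambda>(x, y). x + y) -` W)"
    unfolding case_prod_beta by (intro open_vimage assms continuous_intros)
  moreover have "(0, 0) \<in> (\<lambda>(x, y). x + y) -` W" using assms by simp
  ultimately obtain A B where "open A" "open B" "(0, 0) \<in> A \<times> B" "A \<times> B \<subseteq> (\<lambda>(x, y). x + y) -` W"
    by (rule open_prod_elim)
  then show ?thesis by (intro that[of "A \<inter> B"]) auto
qed

lemma open_neighbourhood_diff:
  fixes W :: "'a::topological_ab_group_add set"
  assumes "open W" "0 \<in> W"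
  obtains V where "open V" "0 \<in> V" "\<And>x y. x \<in> V \<Longrightarrow> y \<in> V \<Longrightarrow> x - y \<in> W"
proof -
  have "open ((\<lambda>(x, y). x - y) -` W)"
    unfolding case_prod_beta by (intro open_vimage assms continuous_intros)
  moreover have "(0, 0) \<in> (\<lambda>(x, y). x - y) -` W" using assms by simp
  ultimately obtain A B where "open A" "open B" "(0, 0) \<in> A \<times> B" "A \<times> B \<subseteq> (\<lambda>(x, y). x - y) -` W"
    by (rule open_prod_elim)
  then show ?thesis by (intro that[of "A \<inter> B"]) auto
qed

locale compact_abelian_group =
  fixes haar :: "'a::{topological_ab_group_add, t2_space} measure"
  assumes compact_group: "compact (UNIV :: 'a set)"
    and haar: "normalized_haar haar"
begin

lemma finite_cover:
  fixes U :: "'a set"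
  assumes "open U" "0 \<in> U"
  obtains X where "finite X" "\<And>y. \<exists>x\<in>X. y - x \<in> U"
proof -
  have "open ((\<lambda>y. y - x) -` U)" for x by (intro open_vimage assms continuous_intros)
  moreover have "UNIV \<subseteq> (\<Union>x\<in>UNIV. (\<lambda>y. y - x) -` U)" using assms by auto
  ultimately obtain X where "finite X" "UNIV \<subseteq> (\<Union>x\<in>X. (\<lambda>y. y - x) -` U)"
    using compactE_image[OF compact_group, of UNIV "\<lambda>x. (\<lambda>y. y - x) -` U"] by auto
  then show ?thesis using that by blast
qed

lemma uniform_continuity:
  fixes f :: "'a \<Rightarrow> 'b::real_normed_vector"
  assumes f: "cont f" and \<epsilon>: "\<epsilon> > 0"
  obtains U where "open U" "0 \<in> U" "\<And>x t. t \<in> U \<Longrightarrow> norm (f (x + t) - f x) < \<epsilon>"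
proof -
  have "\<exists>V. open V \<and> 0 \<in> V \<and> (\<forall>s\<in>V. \<forall>t\<in>V. norm (f (x + (s + t)) - f x) < \<epsilon> / 2)" for x
  proof -
    define W where "W = {s. norm (f (x + s) - f x) < \<epsilon> / 2}"
    have W1: "open W" unfolding W_def using \<epsilon>
      by (intro open_Collect_less continuous_intros cont_shift(2)[OF f])
    have W2: "0 \<in> W" using \<epsilon> by (simp add: W_def)
    obtain V where V: "open V" "0 \<in> V" "\<And>x y. x \<in> V \<Longrightarrow> y \<in> V \<Longrightarrow> x + y \<in> W"
      using open_neighbourhood_sum[OF W1 W2] by metis
    then show ?thesis unfolding W_def by (intro exI[of _ V]) auto
  qed
  then obtain V where V: "\<And>x. open (V x)" "\<And>x. 0 \<in> V x"
    "\<And>x s t. s \<in> V x \<Longrightarrow> t \<in> V x \<Longrightarrow> norm (f (x + (s + t)) - f x) < \<epsilon> / 2" by metis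
  have "open ((\<lambda>y. y - x) -` V x)" for x by (intro open_vimage V continuous_intros)
  moreover have "UNIV \<subseteq> (\<Union>x\<in>UNIV. (\<lambda>y. y - x) -` V x)" using V by auto
  ultimately obtain X where X: "finite X" "UNIV \<subseteq> (\<Union>x\<in>X. (\<lambda>y. y - x) -` V x)"
    using compactE_image[OF compact_group, of UNIV "\<lambda>x. (\<lambda>y. y - x) -` V x"] by auto
  define U where "U = (\<Inter>x\<in>X. V x)"
  have "open U" "0 \<in> U" using X V by (auto simp: U_def)
  moreover have "norm (f (y + t) - f y) < \<epsilon>" if t: "t \<in> U" for y t
  proof -
    obtain x where x: "x \<in> X" "y - x \<in> V x" using X by blast
    have "norm (f (x + ((y - x) + t)) - f x) < \<epsilon> / 2"
      using x t by (intro V(3)) (auto simp: U_def)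
    moreover have "norm (f (x + ((y - x) + 0)) - f x) < \<epsilon> / 2"
      using x V(2) by (intro V(3)) auto
    moreover have "norm (f (y + t) - f y) \<le> norm (f (y + t) - f x) + norm (f y - f x)"
      using norm_triangle_ineq4[of "f (y + t) - f x" "f y - f x"] by simp
    moreover have "x + (y - x + t) = y + t" "x + (y - x + 0) = y" by auto
    ultimately show ?thesis by simp
  qed
  ultimately show ?thesis by (rule that)
qed

lemma cont_bounded:
  fixes f :: "'a \<Rightarrow> 'b::real_normed_vector"
  assumes "cont f"
  obtains C where "C > 0" "\<And>x. norm (f x) \<le> C"
proof -
  have "compact (range f)" using assms compact_group by (rule compact_continuous_image)
  then have "bounded (range f)" by (rule compact_imp_bounded)
  then show ?thesis using that by (auto simp: bounded_pos)
qed

lemma finite_borel_haar: "finite_borel haar"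
  using haar by (auto simp: finite_borel_def normalized_haar_def regular_borel_measure_def
      dest: sets_eq_imp_space_eq intro!: finite_measureI)

sublocale haar: finite_measure haar
  using finite_borel_haar by (rule finite_borelD)

lemma sets_haar [simp]: "sets haar = sets borel"
  and space_haar [simp]: "space haar = UNIV"
  using finite_borelD[OF finite_borel_haar] by auto

lemma measure_haar_UNIV [simp]: "measure haar UNIV = 1"
  using haar by (simp add: normalized_haar_def measure_def)

lemma approximable_haar: "approximable haar"
  using finite_borel_haar haar by (intro approximable_if_regular) (auto simp: normalized_haar_def)

lemma cont_measurable: "cont f \<Longrightarrow> f \<in> borel_measurable borel"
  by (rule borel_measurable_continuous_onI)

lemma cont_integrable:
  fixes f :: "'a \<Rightarrow> 'b::{banach, second_countable_topology}"
  assumes "finite_borel M" "cont f"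
  shows "integrable M f"
  using cont_bounded[OF assms(2)] finite_borel_integrable[OF assms(1) cont_measurable[OF assms(2)]]
  by metis

lemma haar_integrable [simp]:
  fixes f :: "'a \<Rightarrow> 'b::{banach, second_countable_topology}"
  shows "cont f \<Longrightarrow> integrable haar f"
  by (rule cont_integrable[OF finite_borel_haar])

lemma haar_integral_bound:
  fixes f :: "'a \<Rightarrow> 'b::{banach, second_countable_topology}"
  assumes "cont f" "\<And>x. norm (f x) \<le> C"
  shows "norm (LINT x|haar. f x) \<le> C"
  using finite_borel_integral_bound[OF finite_borel_haar cont_measurable[OF assms(1)] assms(2)] by simp

lemma haar_translate: "distr haar borel (\<lambda>x. x + a) = haar"
proof (rule measure_eqI)
  show "sets (distr haar borel (\<lambda>x. x + a)) = sets haar" by simp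
  have meas: "(\<lambda>x. x + a) \<in> measurable haar borel"
    using borel_measurable_continuous_onI[of "\<lambda>x::'a. x + a"]
    by (simp add: continuous_intros cong: measurable_cong_sets)
  fix B assume "B \<in> sets (distr haar borel (\<lambda>x. x + a))"
  then have B: "B \<in> sets borel" by simp
  have "(\<lambda>x. x + a) -` B = (+) (- a) ` B"
    by (auto simp: image_iff intro!: bexI[where x="_ + a"])
  then have "emeasure (distr haar borel (\<lambda>x. x + a)) B = emeasure haar ((+) (- a) ` B)"
    using B meas by (simp add: emeasure_distr)
  also have "\<dots> = emeasure haar B" using haar B unfolding normalized_haar_def by blast
  finally show "emeasure (distr haar borel (\<lambda>x. x + a)) B = emeasure haar B" .
qed

lemma haar_shift:
  fixes f :: "'a \<Rightarrow> 'b::{banach, second_countable_topology}"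
  assumes "cont f"
  shows "(LINT x|haar. f (x + a)) = (LINT x|haar. f x)"
proof -
  have meas: "(\<lambda>x. x + a) \<in> measurable haar borel"
    using borel_measurable_continuous_onI[of "\<lambda>x::'a. x + a"]
    by (simp add: continuous_intros cong: measurable_cong_sets)
  have "(LINT x|haar. f x) = (LINT x|distr haar borel (\<lambda>x. x + a). f x)" by (simp add: haar_translate)
  also have "\<dots> = (LINT x|haar. f (x + a))"
    using meas cont_measurable[OF assms] by (rule integral_distr)
  finally show ?thesis by simp
qed

text \<open>
  Finitely many translates of a nonempty open set cover the group, and all of them have the same
  measure.
\<close>

lemma haar_open_pos:
  assumes "open U" "x \<in> U"
  shows "measure haar U > 0"
proof (rule ccontr)
  assume "\<not> ?thesis"
  then have U0: "measure haar U = 0" using measure_nonneg[of haar U] by linarith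
  define V where "V = (\<lambda>t. x + t) -` U"
  have V: "open V" "0 \<in> V" using assms by (auto simp: V_def intro!: open_vimage continuous_intros)
  obtain X where X: "finite X" "\<And>y. \<exists>z\<in>X. y - z \<in> V" using finite_cover[OF V] by blast
  define W where "W z = (+) (z - x) ` U" for z
  have W: "emeasure haar (W z) = 0" "open (W z)" for z
  proof -
    have "emeasure haar (W z) = emeasure haar U"
      using haar assms unfolding normalized_haar_def W_def by (metis borel_open)
    then show "emeasure haar (W z) = 0" using U0 by (simp add: haar.emeasure_eq_measure)
    have "W z = (\<lambda>y. y - (z - x)) -` U" by (auto simp: W_def image_iff intro!: bexI[where x="_ - (z - x)"])
    then show "open (W z)" using assms by (auto intro!: open_vimage continuous_intros)
  qed
  have "UNIV \<subseteq> (\<Union>z\<in>X. W z)"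
  proof
    fix y
    obtain z where z: "z \<in> X" "y - z \<in> V" using X by blast
    then have "x + (y - z) \<in> U" by (simp add: V_def)
    moreover have "y = (z - x) + (x + (y - z))" by simp
    ultimately show "y \<in> (\<Union>z\<in>X. W z)" using z unfolding W_def by blast
  qed
  moreover have "emeasure haar (\<Union>z\<in>X. W z) \<le> (\<Sum>z\<in>X. emeasure haar (W z))"
    using X W by (intro emeasure_subadditive_finite) auto
  ultimately have "emeasure haar UNIV \<le> 0"
    using W by (metis (no_types, lifting) emeasure_mono order_trans sets_haar sum.neutral borel_open open_UN)
  then show False using haar by (simp add: normalized_haar_def)
qed

lemma haar_integral_pos:
  fixes f :: "'a \<Rightarrow> real"
  assumes f: "cont f" and nn: "\<And>x. 0 \<le> f x" and pos: "f a > 0"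
  shows "(LINT x|haar. f x) > 0"
proof -
  define U where "U = {x. f a / 2 < f x}"
  have U: "open U" "a \<in> U" unfolding U_def using pos
    by (auto intro!: open_Collect_less continuous_intros f)
  have "0 < f a / 2 * measure haar U" using haar_open_pos[OF U] pos by simp
  also have "\<dots> = (LINT x|haar. f a / 2 * indicator U x)" by simp
  also have "\<dots> \<le> (LINT x|haar. f x)"
  proof (rule integral_mono)
    show "integrable haar (\<lambda>x. f a / 2 * indicator U x)"
      using U(1) by (intro integrable_mult_right) (auto simp: less_top[symmetric])
  qed (use f nn in \<open>auto simp: indicator_def U_def\<close>)
  finally show ?thesis .
qed

definition energy :: "('a \<Rightarrow> complex) \<Rightarrow> real" where
  "energy f = (LINT x|haar. (cmod (f x))\<^sup>2)"

lemma energy_nonneg: "0 \<le> energy f"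
  unfolding energy_def by (rule integral_nonneg_AE) simp

lemma energy_pos: "cont f \<Longrightarrow> f a \<noteq> 0 \<Longrightarrow> energy f > 0"
  unfolding energy_def by (intro haar_integral_pos[of _ a] continuous_intros) auto

lemma energy_eq_0: "cont f \<Longrightarrow> energy f \<le> 0 \<Longrightarrow> f = (\<lambda>_. 0)"
  using energy_pos by (metis ext not_less)

lemma energy_combination:
  assumes f: "cont f" and g: "cont g"
  shows "energy (\<lambda>x. of_real a * f x + of_real b * g x) =
    a\<^sup>2 * energy f + 2 * a * b * (LINT x|haar. Re (f x * cnj (g x))) + b\<^sup>2 * energy g"
proof -
  have "(cmod (of_real a * f x + of_real b * g x))\<^sup>2 =
      a\<^sup>2 * (cmod (f x))\<^sup>2 + 2 * a * b * Re (f x * cnj (g x)) + b\<^sup>2 * (cmod (g x))\<^sup>2" for x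
    by (simp add: cmod_power2) algebra
  moreover have "integrable haar (\<lambda>x. Re (f x * cnj (g x)))" "integrable haar (\<lambda>x. (cmod (f x))\<^sup>2)"
    "integrable haar (\<lambda>x. (cmod (g x))\<^sup>2)"
    by (intro haar_integrable continuous_intros f g)+
  ultimately show ?thesis by (simp add: energy_def)
qed

lemma integral_uniform_limit:
  fixes f :: "nat \<Rightarrow> 'a \<Rightarrow> 'b::{banach, second_countable_topology}"
  assumes f: "\<And>n. cont (f n)" and g: "cont g" and lim: "uniform_limit UNIV f g sequentially"
  shows "(\<lambda>n. LINT x|haar. f n x) \<longlonglongrightarrow> (LINT x|haar. g x)"
proof (rule tendstoI)
  fix e :: real assume e: "e > 0"
  then have "\<forall>\<^sub>F n in sequentially. \<forall>x\<in>UNIV. dist (f n x) (g x) < e / 2"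
    using lim by (intro uniform_limitD) auto
  then show "\<forall>\<^sub>F n in sequentially. dist (LINT x|haar. f n x) (LINT x|haar. g x) < e"
  proof eventually_elim
    case (elim n)
    have "norm (LINT x|haar. f n x - g x) \<le> e / 2"
      using elim by (intro haar_integral_bound continuous_intros f g) (auto simp: dist_norm less_imp_le)
    then show ?case using e f g by (simp add: dist_norm)
  qed
qed

lemma energy_uniform_limit:
  assumes f: "\<And>n. cont (f n)" and g: "cont g" and lim: "uniform_limit UNIV f g sequentially"
  shows "(\<lambda>n. energy (f n)) \<longlonglongrightarrow> energy g"
  unfolding energy_def
proof (rule integral_uniform_limit)
  obtain C where C: "\<And>x. norm (g x) \<le> C" using cont_bounded[OF g] by metis
  have n: "uniform_limit UNIV (\<lambda>n x. cmod (f n x)) (\<lambda>x. cmod (g x)) sequentially"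
    by (intro uniform_limit_intros lim)
  have "bounded ((\<lambda>x. cmod (g x)) ` UNIV)" using C by (auto simp: bounded_iff)
  then show "uniform_limit UNIV (\<lambda>n x. (cmod (f n x))\<^sup>2) (\<lambda>x. (cmod (g x))\<^sup>2) sequentially"
    unfolding power2_eq_square by (intro uniform_lim_mult n)
qed (intro continuous_intros f g)+

section \<open>Autocorrelations\<close>

text \<open>
  This is \<open>u \<star> u~\<close> with the reflections removed by a change of variables, see
  \<open>convolve_eq_autocorr\<close>.
\<close>

definition autocorr :: "('a \<Rightarrow> complex) \<Rightarrow> 'a \<Rightarrow> complex" where
  "autocorr u x = (LINT y|haar. u (x + y) * cnj (u y))"

lemma convolve_eq_autocorr:
  assumes u: "cont u"
  shows "convolve haar u (\<lambda>g. cnj (u (- g))) = autocorr u"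
proof
  fix x
  have "(LINT y|haar. u y * cnj (u (- (x - y)))) = (LINT y|haar. u y * cnj (u (y - x)))" by simp
  also have "\<dots> = (LINT y|haar. u (y + x) * cnj (u (y + x - x)))"
    by (rule haar_shift[symmetric]) (intro continuous_intros u cont_shift)
  also have "\<dots> = autocorr u x" by (simp add: autocorr_def add.commute)
  finally show "convolve haar u (\<lambda>g. cnj (u (- g))) x = autocorr u x" by (simp add: convolve_def)
qed

lemma cont_autocorr:
  assumes u: "cont u"
  shows "cont (autocorr u)"
proof (rule contI_uniform)
  fix \<epsilon> :: real assume \<epsilon>: "\<epsilon> > 0"
  obtain C where C: "C > 0" "\<And>x. norm (u x) \<le> C" using cont_bounded[OF u] by metis
  obtain U where U: "open U" "0 \<in> U" "\<And>x t. t \<in> U \<Longrightarrow> norm (u (x + t) - u x) < \<epsilon> / C"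
    using uniform_continuity[OF u, of "\<epsilon> / C"] C \<epsilon> by auto
  have "norm (autocorr u (x + t) - autocorr u x) \<le> \<epsilon>" if t: "t \<in> U" for x t
  proof -
    have "autocorr u (x + t) - autocorr u x = (LINT y|haar. u (x + t + y) * cnj (u y) - u (x + y) * cnj (u y))"
      unfolding autocorr_def
      by (intro Bochner_Integration.integral_diff[symmetric] haar_integrable continuous_intros u cont_shift)
    also have "norm \<dots> \<le> \<epsilon>"
    proof (rule haar_integral_bound)
      show "cont (\<lambda>y. u (x + t + y) * cnj (u y) - u (x + y) * cnj (u y))"
        by (intro continuous_intros u cont_shift)
      fix y
      have "norm (u (x + t + y) * cnj (u y) - u (x + y) * cnj (u y)) = norm (u (x + y + t) - u (x + y)) * norm (u y)"
      proof -
        have "u (x + t + y) * cnj (u y) - u (x + y) * cnj (u y) = (u (x + y + t) - u (x + y)) * cnj (u y)"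
          by (simp add: algebra_simps)
        then show ?thesis by (simp only: norm_mult complex_mod_cnj)
      qed
      also have "\<dots> \<le> \<epsilon> / C * C" using U(3)[OF t, of "x + y"] C \<epsilon> by (intro mult_mono) auto
      finally show "norm (u (x + t + y) * cnj (u y) - u (x + y) * cnj (u y)) \<le> \<epsilon>" using C by simp
    qed
    finally show ?thesis .
  qed
  then show "\<exists>U. open U \<and> 0 \<in> U \<and> (\<forall>x. \<forall>t\<in>U. norm (autocorr u (x + t) - autocorr u x) \<le> \<epsilon>)"
    using U by blast
qed

lemma autocorr_0: "autocorr u 0 = of_real (energy u)"
proof -
  have "u y * cnj (u y) = complex_of_real ((cmod (u y))\<^sup>2)" for y
    by (metis complex_norm_square)
  then show ?thesis by (simp add: autocorr_def energy_def del: of_real_power)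
qed

lemma autocorr_minus:
  assumes u: "cont u"
  shows "autocorr u (- x) = cnj (autocorr u x)"
proof -
  have "autocorr u (- x) = (LINT y|haar. u (- x + (y + x)) * cnj (u (y + x)))"
    unfolding autocorr_def by (rule haar_shift[symmetric]) (intro continuous_intros u cont_shift)
  also have "\<dots> = (LINT y|haar. cnj (u (x + y) * cnj (u y)))"
    by (simp add: mult.commute add.commute)
  also have "\<dots> = cnj (LINT y|haar. u (x + y) * cnj (u y))"
    by (rule integral_bounded_linear[OF bounded_linear_cnj])
      (intro haar_integrable continuous_intros u cont_shift)
  finally show ?thesis by (simp add: autocorr_def)
qed

lemma autocorr_shift_sum:
  assumes u: "cont u"
  shows "autocorr (\<lambda>x. u x + c * u (x + a)) x =
    (1 + of_real ((cmod c)\<^sup>2)) * autocorr u x + c * autocorr u (x + a) + cnj c * autocorr u (x - a)"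
proof -
  define I where "I f = (LINT y|haar. f y)" for f :: "'a \<Rightarrow> complex"
  have e: "(u (x + y) + c * u (x + y + a)) * cnj (u y + c * u (y + a))
     = u (x + y) * cnj (u y) + c * (u (x + a + y) * cnj (u y)) + cnj c * (u (x + y) * cnj (u (y + a)))
       + c * cnj c * (u (x + y + a) * cnj (u (y + a)))" for y
    by (simp add: algebra_simps)
  have i1: "cont (\<lambda>y. u (x + y) * cnj (u y))" and i2: "cont (\<lambda>y. u (x + a + y) * cnj (u y))"
    and i3: "cont (\<lambda>y. u (x + y) * cnj (u (y + a)))"
    by (intro continuous_intros u cont_shift)+
  have "cont (\<lambda>y. u (x + y + a))" using cont_shift(2)[OF u, of "x + a"] by (simp add: ac_simps)
  then have i4: "cont (\<lambda>y. u (x + y + a) * cnj (u (y + a)))"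
    by (intro continuous_intros cont_shift u)
  have s3: "(LINT y|haar. u (x + y) * cnj (u (y + a))) = autocorr u (x - a)"
  proof -
    have "cont (\<lambda>y. u (x - a + y) * cnj (u y))" by (intro continuous_intros u cont_shift)
    from haar_shift[OF this, of a] show ?thesis by (simp add: autocorr_def algebra_simps)
  qed
  have s4: "(LINT y|haar. u (x + y + a) * cnj (u (y + a))) = autocorr u x"
    using haar_shift[OF i1, of a] by (simp add: autocorr_def add.assoc)
  have "autocorr (\<lambda>x. u x + c * u (x + a)) x = (LINT y|haar. (u (x + y) + c * u (x + y + a)) * cnj (u y + c * u (y + a)))"
    by (simp add: autocorr_def)
  also have "\<dots> = autocorr u x + c * autocorr u (x + a) + cnj c * autocorr u (x - a) + c * cnj c * autocorr u x"
    unfolding e using i1 i2 i3 i4 by (simp add: s3 s4 autocorr_def[symmetric])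
  also have "c * cnj c = of_real ((cmod c)\<^sup>2)" by (metis complex_norm_square)
  finally show ?thesis by (simp add: algebra_simps)
qed

lemma energy_scale: "energy (\<lambda>x. of_real s * u x) = s\<^sup>2 * energy u"
  by (simp add: energy_def norm_mult power_mult_distrib)

lemma energy_shift_sum:
  assumes u: "cont u" and c: "cmod c = 1"
  shows "energy (\<lambda>x. u x + c * u (x + a)) = 2 * energy u + 2 * Re (c * autocorr u a)"
proof -
  have "complex_of_real (energy (\<lambda>x. u x + c * u (x + a))) = 2 * of_real (energy u) + (c * autocorr u a + cnj (c * autocorr u a))"
    unfolding autocorr_0[symmetric] autocorr_shift_sum[OF u] using autocorr_minus[OF u, of a] by (simp add: c)
  also have "\<dots> = of_real (2 * energy u + 2 * Re (c * autocorr u a))"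
    by (simp only: complex_add_cnj of_real_add of_real_mult of_real_numeral)
  finally show ?thesis by (simp only: of_real_eq_iff)
qed

text \<open>
  The energy of \<open>u + c u(\<cdot> + x)\<close> is nonnegative for every \<open>c\<close> of absolute value \<open>1\<close>; the worst \<open>c\<close>
  turns \<open>Re (c A)\<close>, where \<open>A = autocorr u x\<close>, into \<open>- \<bar>A\<bar>\<close>.
\<close>

lemma autocorr_le:
  assumes u: "cont u"
  shows "cmod (autocorr u x) \<le> energy u"
proof (cases "autocorr u x = 0")
  case False
  define c where "c = - cnj (autocorr u x) / cmod (autocorr u x)"
  have c: "cmod c = 1" using False by (simp add: c_def norm_divide)
  have ca: "c * autocorr u x = - of_real (cmod (autocorr u x))"
  proof -
    have "cnj (autocorr u x) * autocorr u x = of_real ((cmod (autocorr u x))\<^sup>2)"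
      by (metis complex_norm_square mult.commute)
    then show ?thesis using False by (simp add: c_def power2_eq_square)
  qed
  have "0 \<le> energy (\<lambda>y. u y + c * u (y + x))" by (rule energy_nonneg)
  also have "\<dots> = 2 * energy u - 2 * cmod (autocorr u x)" unfolding energy_shift_sum[OF u c] by (simp add: ca)
  finally show ?thesis by simp
qed (simp add: energy_nonneg)

lemma autocorr_scale: "autocorr (\<lambda>x. of_real s * u x) = (\<lambda>x. of_real (s\<^sup>2) * autocorr u x)"
  by (auto simp: autocorr_def fun_eq_iff power2_eq_square algebra_simps integral_mult_right_zero[symmetric]
      simp del: integral_mult_right_zero)

section \<open>Characters separate points\<close>

text \<open>
  A form of the Arzela-Ascoli theorem. The first components are only bounded, so Tychonoff's theorem
  gives a cluster point in the topology of pointwise convergence; the second components are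
  equicontinuous, so near the cluster point they are even uniformly close.
\<close>

lemma equicontinuous_cluster_point:
  fixes q :: "nat \<Rightarrow> 'a \<Rightarrow> complex \<times> complex"
  assumes b1: "\<And>n x. cmod (fst (q n x)) \<le> B" and b2: "\<And>n x. cmod (snd (q n x)) \<le> B"
    and equi: "\<And>\<epsilon>. \<epsilon> > 0 \<Longrightarrow> \<exists>U. open U \<and> 0 \<in> U \<and>
      (\<forall>n x. \<forall>t\<in>U. cmod (snd (q n (x + t)) - snd (q n x)) \<le> \<epsilon>)"
  obtains \<phi> \<psi> where "cont \<psi>"
    "\<And>X. finite X \<Longrightarrow> \<exists>r. (\<forall>x\<in>X. (\<lambda>n. fst (q (r n) x)) \<longlonglongrightarrow> \<phi> x) \<and>
       uniform_limit UNIV (\<lambda>n x. snd (q (r n) x)) \<psi> sequentially \<and> filterlim r at_top sequentially"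
proof -
  define D where "D = cball (0::complex) B \<times> cball (0::complex) B"
  have "compact D" unfolding D_def by (intro compact_Times compact_cball)
  then have "compactin (product_topology (\<lambda>_. euclidean) UNIV) (PiE (UNIV :: 'a set) (\<lambda>_. D))"
    unfolding compactin_PiE by simp
  then have box: "compact (PiE (UNIV :: 'a set) (\<lambda>_. D))"
    by (simp add: euclidean_product_topology)
  have q: "q n \<in> PiE UNIV (\<lambda>_. D)" for n
    using b1 b2 by (auto simp: D_def mem_Times_iff)
  have "PiE UNIV (\<lambda>_. D) \<inter> (\<Inter>N\<in>UNIV. closure (q ` {N..})) \<noteq> {}"
  proof (rule compact_imp_fip_image[OF box])
    fix N assume N: "finite N" "N \<subseteq> (UNIV :: nat set)"
    have "q (Max (insert 0 N)) \<in> closure (q ` {n..})" if "n \<in> N" for n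
      using that N(1) by (intro subsetD[OF closure_subset] imageI) auto
    then show "PiE UNIV (\<lambda>_. D) \<inter> (\<Inter>n\<in>N. closure (q ` {n..})) \<noteq> {}"
      using q by blast
  qed auto
  then obtain p where p: "\<And>N. p \<in> closure (q ` {N..})" by blast
  have near: "\<exists>n\<ge>N. \<forall>x\<in>X. dist (q n x) (p x) < \<epsilon>" if X: "finite X" and \<epsilon>: "\<epsilon> > 0" for X \<epsilon> N
  proof -
    define W where "W = (\<Inter>x\<in>X. (\<lambda>f. f x) -` ball (p x) \<epsilon>)"
    have "open W" unfolding W_def
      using X by (intro open_INT ballI open_vimage open_ball) auto
    moreover have "p \<in> W" using \<epsilon> by (simp add: W_def)
    ultimately have "W \<inter> q ` {N..} \<noteq> {}"
      using p[of N] open_Int_closure_eq_empty[of W "q ` {N..}"] by blast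
    then show ?thesis by (auto simp: W_def dist_commute)
  qed
  define \<phi> where "\<phi> x = fst (p x)" for x
  define \<psi> where "\<psi> x = snd (p x)" for x
  have d: "cmod (fst (q n x) - \<phi> x) \<le> dist (q n x) (p x)" "cmod (snd (q n x) - \<psi> x) \<le> dist (q n x) (p x)" for n x
    using dist_fst_le[of "q n x" "p x"] dist_snd_le[of "q n x" "p x"] by (auto simp: \<phi>_def \<psi>_def dist_norm)
  have \<psi>equi: "cmod (\<psi> (x + t) - \<psi> x) \<le> \<epsilon>"
    if U: "\<And>n x t. t \<in> U \<Longrightarrow> cmod (snd (q n (x + t)) - snd (q n x)) \<le> \<epsilon>" and t: "t \<in> U" for U \<epsilon> x t
  proof (rule field_le_epsilon)
    fix e :: real assume e: "e > 0"
    obtain n where n: "dist (q n (x + t)) (p (x + t)) < e / 2" "dist (q n x) (p x) < e / 2"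
      using near[of "{x + t, x}" "e / 2" 0] e by auto
    have "\<psi> (x + t) - \<psi> x = (snd (q n (x + t)) - snd (q n x)) - (snd (q n (x + t)) - \<psi> (x + t)) + (snd (q n x) - \<psi> x)"
      by simp
    also have "cmod \<dots> \<le> cmod (snd (q n (x + t)) - snd (q n x)) + cmod (snd (q n (x + t)) - \<psi> (x + t)) + cmod (snd (q n x) - \<psi> x)"
      by (intro norm_triangle_le add_right_mono norm_triangle_ineq4)
    also have "\<dots> \<le> \<epsilon> + e / 2 + e / 2"
      using U[OF t, of n x] n d[of n "x + t"] d[of n x] by linarith
    finally show "cmod (\<psi> (x + t) - \<psi> x) \<le> \<epsilon> + e" by simp
  qed
  have "cont \<psi>"
    by (rule contI_uniform) (use equi \<psi>equi in meson)
  moreover have "\<exists>r. (\<forall>x\<in>X. (\<lambda>n. fst (q (r n) x)) \<longlonglongrightarrow> \<phi> x) \<and>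
       uniform_limit UNIV (\<lambda>n x. snd (q (r n) x)) \<psi> sequentially \<and> filterlim r at_top sequentially"
    if X: "finite X" for X
  proof -
    have "\<exists>m\<ge>n. (\<forall>x\<in>X. cmod (fst (q m x) - \<phi> x) \<le> 1 / real (Suc n)) \<and>
        (\<forall>x. cmod (snd (q m x) - \<psi> x) \<le> 1 / real (Suc n))" for n
    proof -
      define e where "e = 1 / real (Suc n) / 3"
      have e: "e > 0" "3 * e = 1 / real (Suc n)" by (simp_all add: e_def del: of_nat_Suc)
      obtain U where U: "open U" "0 \<in> U" "\<And>n x t. t \<in> U \<Longrightarrow> cmod (snd (q n (x + t)) - snd (q n x)) \<le> e"
        using equi[OF e(1)] by metis
      obtain Y where Y: "finite Y" "\<And>y. \<exists>x\<in>Y. y - x \<in> U" using finite_cover[OF U(1,2)] by blast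
      obtain m where m: "m \<ge> n" "\<And>x. x \<in> X \<union> Y \<Longrightarrow> dist (q m x) (p x) < e"
        using near[of "X \<union> Y" e n] X Y e by auto
      have "cmod (snd (q m y) - \<psi> y) \<le> 3 * e" for y
      proof -
        obtain x where x: "x \<in> Y" "y - x \<in> U" using Y by blast
        have 1: "cmod (snd (q m y) - snd (q m x)) \<le> e" using U(3)[OF x(2), of m x] by simp
        have 2: "cmod (\<psi> y - \<psi> x) \<le> e" using \<psi>equi[OF U(3) x(2), of x] by simp
        have 3: "cmod (snd (q m x) - \<psi> x) \<le> e" using d(2)[of m x] m(2)[of x] x by simp
        \<comment> \<open>Closeness on the finite net \<open>Y\<close> spreads to all points by equicontinuity.\<close>
        have "snd (q m y) - \<psi> y = (snd (q m y) - snd (q m x)) - (\<psi> y - \<psi> x) + (snd (q m x) - \<psi> x)" by simp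
        also have "cmod \<dots> \<le> cmod (snd (q m y) - snd (q m x)) + cmod (\<psi> y - \<psi> x) + cmod (snd (q m x) - \<psi> x)"
          by (intro norm_triangle_le add_right_mono norm_triangle_ineq4)
        finally show ?thesis using 1 2 3 by linarith
      qed
      moreover have "cmod (fst (q m x) - \<phi> x) \<le> 3 * e" if "x \<in> X" for x
        using d(1)[of m x] m(2)[of x] that e(1) by simp
      ultimately show ?thesis using m(1) e(2) by auto
    qed
    then obtain r where r: "\<And>n. r n \<ge> n" "\<And>n x. x \<in> X \<Longrightarrow> cmod (fst (q (r n) x) - \<phi> x) \<le> 1 / real (Suc n)"
      "\<And>n x. cmod (snd (q (r n) x) - \<psi> x) \<le> 1 / real (Suc n)" by metis
    have lim0: "(\<lambda>n. 1 / real (Suc n)) \<longlonglongrightarrow> 0" by (rule LIMSEQ_Suc[OF lim_const_over_n])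
    have "(\<lambda>n. fst (q (r n) x)) \<longlonglongrightarrow> \<phi> x" if "x \<in> X" for x
    proof -
      have "(\<lambda>n. fst (q (r n) x) - \<phi> x) \<longlonglongrightarrow> 0"
        using r(2)[OF that] by (intro Lim_null_comparison[OF _ lim0]) auto
      then show ?thesis by (simp add: LIM_zero_iff)
    qed
    moreover have "uniform_limit UNIV (\<lambda>n x. snd (q (r n) x)) \<psi> sequentially"
    proof (rule uniform_limitI)
      fix e :: real assume "e > 0"
      then have "\<forall>\<^sub>F n in sequentially. 1 / real (Suc n) < e" using lim0 by (simp add: order_tendstoD)
      then show "\<forall>\<^sub>F n in sequentially. \<forall>x\<in>UNIV. dist (snd (q (r n) x)) (\<psi> x) < e"
        by eventually_elim (use r(3) in \<open>auto simp: dist_norm intro: le_less_trans\<close>)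
    qed
    moreover have "filterlim r at_top sequentially"
      using r(1) by (intro filterlim_at_top_mono[OF filterlim_ident]) auto
    ultimately show ?thesis by blast
  qed
  ultimately show ?thesis by (rule that)
qed

text \<open>
  Averaging against a continuous kernel makes a bounded family of functions equicontinuous, which
  restores compactness in the uniform norm.
\<close>

definition smear :: "('a \<Rightarrow> complex) \<Rightarrow> ('a \<Rightarrow> complex) \<Rightarrow> 'a \<Rightarrow> complex" where
  "smear k \<phi> x = (LINT y|haar. k y * \<phi> (x + y))"

lemma smear_shift: "smear k (\<lambda>x. \<phi> (x + a)) x = smear k \<phi> (x + a)"
  by (simp add: smear_def ac_simps)

lemma smear_add:
  assumes "cont k" "cont \<phi>" "cont \<psi>"
  shows "smear k (\<lambda>x. \<phi> x + \<psi> x) x = smear k \<phi> x + smear k \<psi> x"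
proof -
  have "cont (\<lambda>y. k y * \<phi> (x + y))" "cont (\<lambda>y. k y * \<psi> (x + y))"
    by (intro continuous_intros assms cont_shift)+
  then show ?thesis by (simp add: smear_def distrib_left)
qed

lemma smear_cmult: "smear k (\<lambda>x. c * \<phi> x) x = c * smear k \<phi> x"
proof -
  have "(LINT y|haar. k y * (c * \<phi> (x + y))) = (LINT y|haar. c * (k y * \<phi> (x + y)))"
    by (simp add: ac_simps)
  then show ?thesis by (simp add: smear_def)
qed

lemma smear_bound:
  assumes k: "cont k" and \<phi>: "cont \<phi>" and b: "\<And>x. cmod (k x) \<le> B" "\<And>x. cmod (\<phi> x) \<le> C"
  shows "cmod (smear k \<phi> x) \<le> B * C"
  unfolding smear_def
proof (rule haar_integral_bound)
  show "cont (\<lambda>y. k y * \<phi> (x + y))" by (intro continuous_intros k \<phi> cont_shift)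
  show "cmod (k y * \<phi> (x + y)) \<le> B * C" for y
    unfolding norm_mult using b by (intro mult_mono) (auto intro: order_trans[OF norm_ge_zero])
qed

lemma smear_equicontinuous:
  assumes k: "cont k" and \<epsilon>: "\<epsilon> > 0"
  obtains U where "open U" "0 \<in> U"
    "\<And>\<phi> x t. cont \<phi> \<Longrightarrow> (\<And>x. cmod (\<phi> x) \<le> 1) \<Longrightarrow> t \<in> U \<Longrightarrow> cmod (smear k \<phi> (x + t) - smear k \<phi> x) \<le> \<epsilon>"
proof -
  obtain V where V: "open V" "0 \<in> V" "\<And>x t. t \<in> V \<Longrightarrow> cmod (k (x + t) - k x) < \<epsilon>"
    using uniform_continuity[OF k \<epsilon>] by metis
  define U where "U = uminus -` V"
  have "open U" "0 \<in> U" using V by (auto simp: U_def intro!: open_vimage continuous_intros)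
  moreover have "cmod (smear k \<phi> (x + t) - smear k \<phi> x) \<le> \<epsilon>"
    if \<phi>: "cont \<phi>" and b: "\<And>x. cmod (\<phi> x) \<le> 1" and t: "t \<in> U" for \<phi> x t
  proof -
    have c1: "cont (\<lambda>y. k (y - t) * \<phi> (x + y))" "cont (\<lambda>y. k y * \<phi> (x + y))"
      by (intro continuous_intros k \<phi> cont_shift)+
    have "smear k \<phi> (x + t) = (LINT y|haar. k (y - t) * \<phi> (x + y))"
      using haar_shift[OF c1(1), of t] by (simp add: smear_def ac_simps)
    then have "smear k \<phi> (x + t) - smear k \<phi> x = (LINT y|haar. k (y - t) * \<phi> (x + y) - k y * \<phi> (x + y))"
      using c1 by (simp add: smear_def)
    also have "cmod \<dots> \<le> \<epsilon>"
    proof (rule haar_integral_bound)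
      show "cont (\<lambda>y. k (y - t) * \<phi> (x + y) - k y * \<phi> (x + y))" by (intro continuous_on_diff c1)
      fix y
      have "cmod (k (y - t) * \<phi> (x + y) - k y * \<phi> (x + y)) = cmod (k (y + - t) - k y) * cmod (\<phi> (x + y))"
        by (simp add: left_diff_distrib[symmetric] norm_mult)
      also have "\<dots> \<le> \<epsilon> * 1"
        using V(3)[of "- t" y] t b \<epsilon> by (intro mult_mono) (auto simp: U_def)
      finally show "cmod (k (y - t) * \<phi> (x + y) - k y * \<phi> (x + y)) \<le> \<epsilon>" by simp
    qed
    finally show ?thesis .
  qed
  ultimately show ?thesis by (rule that)
qed

lemma cont_smear:
  assumes k: "cont k" and \<phi>: "cont \<phi>"
  shows "cont (smear k \<phi>)"
proof -
  obtain C where C: "C > 0" "\<And>x. cmod (\<phi> x) \<le> C" using cont_bounded[OF \<phi>] by metis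
  define \<psi> where "\<psi> x = of_real (1 / C) * \<phi> x" for x
  have \<psi>: "cont \<psi>" unfolding \<psi>_def by (intro continuous_on_mult continuous_on_const \<phi>)
  have \<psi>1: "cmod (\<psi> x) \<le> 1" for x using C(1) C(2)[of x] by (simp add: \<psi>_def norm_mult norm_divide)
  have "cont (smear k \<psi>)"
  proof (rule contI_uniform)
    fix \<epsilon> :: real assume "\<epsilon> > 0"
    from smear_equicontinuous[OF k this] obtain U where "open U" "0 \<in> U"
      "\<And>\<phi> x t. cont \<phi> \<Longrightarrow> (\<And>x. cmod (\<phi> x) \<le> 1) \<Longrightarrow> t \<in> U \<Longrightarrow> cmod (smear k \<phi> (x + t) - smear k \<phi> x) \<le> \<epsilon>"
      by metis
    then show "\<exists>U. open U \<and> 0 \<in> U \<and> (\<forall>x. \<forall>t\<in>U. cmod (smear k \<psi> (x + t) - smear k \<psi> x) \<le> \<epsilon>)"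
      using \<psi> \<psi>1 by (intro exI[of _ U]) auto
  qed
  then have "cont (\<lambda>x. of_real C * smear k \<psi> x)" by (intro continuous_intros)
  moreover have "of_real C * smear k \<psi> x = smear k \<phi> x" for x
    unfolding \<psi>_def smear_cmult using C(1) by simp
  ultimately show ?thesis by simp
qed

lemma dual_groupD:
  assumes "\<gamma> \<in> dual_group"
  shows "cont \<gamma>" "cmod (\<gamma> x) = 1" "\<gamma> (x + y) = \<gamma> x * \<gamma> y" "\<gamma> 0 = 1" "\<gamma> (- x) = cnj (\<gamma> x)"
    "\<gamma> (x - y) = \<gamma> x * cnj (\<gamma> y)" "\<gamma> x * cnj (\<gamma> x) = 1"
proof -
  have \<gamma>: "cont \<gamma>" "\<And>x. cmod (\<gamma> x) = 1" "\<And>x y. \<gamma> (x + y) = \<gamma> x * \<gamma> y"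
    using assms by (auto simp: dual_group_def)
  have "\<gamma> 0 * \<gamma> 0 = \<gamma> 0" using \<gamma>(3)[of 0 0] by simp
  moreover have "\<gamma> 0 \<noteq> 0" using \<gamma>(2)[of 0] by auto
  ultimately have 0: "\<gamma> 0 = 1" by simp
  have n: "\<gamma> x * cnj (\<gamma> x) = 1" for x
    using complex_norm_square[of "\<gamma> x"] \<gamma>(2)[of x] by simp
  have m: "\<gamma> (- x) = cnj (\<gamma> x)" for x
  proof -
    have "\<gamma> x * \<gamma> (- x) = \<gamma> x * cnj (\<gamma> x)" using \<gamma>(3)[of x "- x"] 0 n by simp
    moreover have "\<gamma> x \<noteq> 0" using \<gamma>(2)[of x] by auto
    ultimately show ?thesis by simp
  qed
  show "cont \<gamma>" "cmod (\<gamma> x) = 1" "\<gamma> (x + y) = \<gamma> x * \<gamma> y" "\<gamma> 0 = 1" "\<gamma> (- x) = cnj (\<gamma> x)"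
    "\<gamma> (x - y) = \<gamma> x * cnj (\<gamma> y)" "\<gamma> x * cnj (\<gamma> x) = 1"
    using \<gamma> 0 n m \<gamma>(3)[of x "- y"] by auto
qed

lemma smear_autocorr_shift_sum:
  assumes k: "cont k" and u: "cont u"
  shows "smear k (autocorr (\<lambda>x. u x + c * u (x + a))) x = (1 + of_real ((cmod c)\<^sup>2)) * smear k (autocorr u) x
    + (c * smear k (autocorr u) (x + a) + cnj c * smear k (autocorr u) (x - a))"
proof -
  have A: "cont (autocorr u)" by (rule cont_autocorr[OF u])
  have eq: "autocorr (\<lambda>x. u x + c * u (x + a)) = (\<lambda>x. (1 + of_real ((cmod c)\<^sup>2)) * autocorr u x
      + (c * autocorr u (x + a) + cnj c * autocorr u (x + (- a))))"
    using autocorr_shift_sum[OF u, of c a] by (auto simp: add.assoc)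
  have cc: "cont (\<lambda>x. (1 + of_real ((cmod c)\<^sup>2)) * autocorr u x)" "cont (\<lambda>x. c * autocorr u (x + a))"
    "cont (\<lambda>x. cnj c * autocorr u (x + (- a)))"
    by (intro continuous_intros A cont_shift)+
  show ?thesis
    unfolding eq
    by (subst smear_add[OF k cc(1) continuous_on_add[OF cc(2,3)]], subst smear_add[OF k cc(2,3)])
       (simp only: smear_cmult smear_shift diff_conv_add_uminus)
qed

text \<open>
  With \<open>\<parallel>\<cdot>\<parallel>\<close> the square root of the energy, the two hypotheses read \<open>\<parallel>2 \<psi> + D\<parallel> \<le> (2 + d) \<parallel>\<psi>\<parallel>\<close> and
  \<open>\<parallel>2 \<psi> - D\<parallel> \<le> (2 - d) \<parallel>\<psi>\<parallel>\<close>. Their sum is the reverse of the triangle inequality for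
  \<open>4 \<psi> = (2 \<psi> + D) + (2 \<psi> - D)\<close>, so strict convexity makes \<open>D\<close> proportional to \<open>\<psi>\<close>.
\<close>

lemma energy_equality_case:
  assumes \<psi>: "cont \<psi>" and D: "cont D" and d: "\<bar>d\<bar> \<le> 2"
    and plus: "energy (\<lambda>x. 2 * \<psi> x + D x) \<le> energy \<psi> * (2 + d)\<^sup>2"
    and minus: "energy (\<lambda>x. 2 * \<psi> x - D x) \<le> energy \<psi> * (2 - d)\<^sup>2"
  shows "D x = of_real d * \<psi> x"
proof -
  define s where "s = (LINT x|haar. Re (\<psi> x * cnj (D x)))"
  define t where "t = s - d * energy \<psi>"
  have "energy (\<lambda>x. of_real 2 * \<psi> x + of_real 1 * D x) \<le> energy \<psi> * (2 + d)\<^sup>2" using plus by simp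
  then have p1: "4 * energy \<psi> + 4 * s + energy D \<le> energy \<psi> * (2 + d)\<^sup>2"
    unfolding energy_combination[OF \<psi> D] by (simp add: s_def)
  have "energy (\<lambda>x. of_real 2 * \<psi> x + of_real (- 1) * D x) \<le> energy \<psi> * (2 - d)\<^sup>2" using minus by simp
  then have p2: "4 * energy \<psi> - 4 * s + energy D \<le> energy \<psi> * (2 - d)\<^sup>2"
    unfolding energy_combination[OF \<psi> D] by (simp add: s_def)
  have "energy D - d\<^sup>2 * energy \<psi> \<le> - 4 * t" "energy D - d\<^sup>2 * energy \<psi> \<le> 4 * t"
    using p1 p2 by (auto simp: t_def power2_eq_square algebra_simps)
  then have "energy D - d\<^sup>2 * energy \<psi> \<le> - 4 * \<bar>t\<bar>" by (simp add: abs_if)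
  moreover have "- 2 * d * t \<le> 4 * \<bar>t\<bar>"
  proof -
    have "- 2 * d * t \<le> \<bar>- 2 * d * t\<bar>" by simp
    also have "\<dots> = 2 * \<bar>d\<bar> * \<bar>t\<bar>" by (simp add: abs_mult)
    also have "\<dots> \<le> 2 * 2 * \<bar>t\<bar>" using d by (intro mult_right_mono) auto
    finally show ?thesis by simp
  qed
  moreover have "energy (\<lambda>x. of_real (- d) * \<psi> x + of_real 1 * D x) = (energy D - d\<^sup>2 * energy \<psi>) - 2 * d * t"
    unfolding energy_combination[OF \<psi> D] s_def[symmetric] by (simp add: t_def power2_eq_square algebra_simps)
  ultimately have "energy (\<lambda>x. of_real (- d) * \<psi> x + of_real 1 * D x) \<le> 0" by linarith
  moreover have "cont (\<lambda>x. of_real (- d) * \<psi> x + of_real 1 * D x)" by (intro continuous_intros \<psi> D)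
  ultimately have "(\<lambda>x. of_real (- d) * \<psi> x + of_real 1 * D x) = (\<lambda>_. 0)" by (intro energy_eq_0)
  then have "of_real (- d) * \<psi> x + of_real 1 * D x = 0" by (rule fun_cong)
  then show ?thesis by (simp add: add_eq_0_iff)
qed

text \<open>
  The hypothesis for \<open>c = 1\<close> and \<open>c = \<i>\<close> determines \<open>\<psi> (x + a) + \<psi> (x - a)\<close> and
  \<open>\<psi> (x + a) - \<psi> (x - a)\<close>; together they say \<open>\<psi> (x + a) = \<phi> a \<psi> x\<close>. Multiplicativity of \<open>\<phi>\<close>
  follows, and \<open>\<bar>\<phi>\<bar> = 1\<close> from \<open>\<bar>\<phi>\<bar> \<le> 1\<close> at \<open>a\<close> and \<open>- a\<close>.
\<close>

lemma translation_eigenfunction: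
  assumes \<psi>: "cont \<psi>" "energy \<psi> > 0" and \<phi>le: "\<And>a. cmod (\<phi> a) \<le> 1"
    and eq: "\<And>c a x. cmod c = 1 \<Longrightarrow> c * \<psi> (x + a) + cnj c * \<psi> (x - a) = of_real (2 * Re (c * \<phi> a)) * \<psi> x"
  shows "\<phi> \<in> dual_group" and "\<psi> x = \<psi> 0 * \<phi> x" and "\<psi> 0 \<noteq> 0"
proof -
  have mult: "\<psi> (x + a) = \<phi> a * \<psi> x" for x a
  proof -
    have 1: "\<psi> (x + a) + \<psi> (x - a) = 2 * of_real (Re (\<phi> a)) * \<psi> x" using eq[of 1 x a] by simp
    have i: "\<i> * (\<psi> (x + a) - \<psi> (x - a)) = - (2 * of_real (Im (\<phi> a)) * \<psi> x)"
      using eq[of \<i> x a] by (simp add: algebra_simps)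
    have "\<psi> (x + a) - \<psi> (x - a) = - \<i> * (\<i> * (\<psi> (x + a) - \<psi> (x - a)))"
      by (simp flip: mult.assoc)
    then have 2: "\<psi> (x + a) - \<psi> (x - a) = 2 * \<i> * of_real (Im (\<phi> a)) * \<psi> x"
      unfolding i by (simp add: algebra_simps)
    have "2 * \<psi> (x + a) = 2 * ((of_real (Re (\<phi> a)) + \<i> * of_real (Im (\<phi> a))) * \<psi> x)"
      using arg_cong2[OF 1 2, of "(+)"] by (simp add: algebra_simps)
    then show ?thesis using complex_eq[of "\<phi> a"] by simp
  qed
  show \<psi>0: "\<psi> 0 \<noteq> 0"
  proof
    assume "\<psi> 0 = 0"
    then have "\<psi> = (\<lambda>_. 0)" using mult[of 0] by auto
    then show False using \<psi>(2) by (simp add: energy_def)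
  qed
  show "\<psi> x = \<psi> 0 * \<phi> x" using mult[of 0 x] by simp
  have \<phi>eq: "\<phi> a = \<psi> a / \<psi> 0" for a using mult[of 0 a] \<psi>0 by simp
  have hom: "\<phi> (a + b) = \<phi> a * \<phi> b" for a b
  proof -
    have "\<phi> (a + b) * \<psi> 0 = \<psi> (b + a)" using mult[of 0 "a + b"] by (simp add: ac_simps)
    also have "\<dots> = \<phi> a * (\<phi> b * \<psi> 0)" using mult[of b a] mult[of 0 b] by simp
    finally show ?thesis using \<psi>0 by simp
  qed
  have "\<phi> 0 = 1" using \<phi>eq[of 0] \<psi>0 by simp
  then have "1 = cmod (\<phi> a) * cmod (\<phi> (- a))" for a using hom[of a "- a"] by (simp add: norm_mult[symmetric])
  also have "\<dots> a \<le> cmod (\<phi> a) * 1" for a by (intro mult_left_mono \<phi>le) simp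
  finally have "cmod (\<phi> a) = 1" for a by (intro antisym \<phi>le) simp
  moreover have "cont \<phi>" unfolding \<phi>eq[abs_def] using \<psi>0 by (intro continuous_intros \<psi>) auto
  ultimately show "\<phi> \<in> dual_group" using hom by (simp add: dual_group_def)
qed

text \<open>
  The main step towards the existence of characters. Let \<open>M\<close> be the supremum of the energy of
  \<open>smear k (autocorr u)\<close> over the \<open>u \<in> L\<close> of energy \<open>1\<close>, and let \<open>\<psi>\<close> be a uniform cluster point of
  these smeared autocorrelations along a maximising sequence, with \<open>\<phi>\<close> the corresponding pointwise
  cluster point of the autocorrelations themselves. Testing the bound \<open>M\<close> with \<open>u + c u(\<cdot> + a)\<close>
  and passing to the limit gives the hypotheses of \<open>energy_equality_case\<close> for
  \<open>D = c \<psi>(\<cdot> + a) + cnj c \<psi>(\<cdot> - a)\<close> and \<open>d = 2 Re (c \<phi> a)\<close>. Hence \<open>\<psi>\<close> is an eigenfunction of all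
  translations.

  Only \<open>\<psi>\<close> is known to be continuous at first: \<open>\<phi>\<close>, a mere cluster point of bounded functions, is
  used pointwise, which is why the two limits are taken jointly.
\<close>

lemma extremal_character:
  assumes k: "cont k" and Lc: "\<And>u. u \<in> L \<Longrightarrow> cont u"
    and Lscale: "\<And>u s. u \<in> L \<Longrightarrow> (\<lambda>x. of_real s * u x) \<in> L"
    and Lshift: "\<And>u c a. u \<in> L \<Longrightarrow> (\<lambda>x. u x + c * u (x + a)) \<in> L"
    and u0: "u0 \<in> L" "smear k (autocorr u0) 0 \<noteq> 0"
  obtains \<gamma> z U where "\<gamma> \<in> dual_group" "z \<noteq> 0" "\<And>n::nat. U n \<in> L"
    "uniform_limit UNIV (\<lambda>n. smear k (autocorr (U n))) (\<lambda>x. z * \<gamma> x) sequentially"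
proof -
  obtain B0 where B0: "B0 > 0" "\<And>x. cmod (k x) \<le> B0" using cont_bounded[OF k] by metis
  define B where "B = max B0 1"
  have B: "B \<ge> 1" "\<And>x. cmod (k x) \<le> B" using B0 by (auto simp: B_def le_max_iff_disj)
  define Adm where "Adm = {u \<in> L. energy u = 1}"
  define \<Psi> where "\<Psi> u = smear k (autocorr u)" for u
  define J where "J u = energy (\<Psi> u)" for u
  have Adm: "u \<in> L" "cont u" "energy u = 1" "cont (autocorr u)" "cmod (autocorr u x) \<le> 1"
    "cont (\<Psi> u)" "cmod (\<Psi> u x) \<le> B" if "u \<in> Adm" for u x
  proof -
    show u: "u \<in> L" "cont u" "energy u = 1" using that Lc by (auto simp: Adm_def)
    show c: "cont (autocorr u)" "\<And>x. cmod (autocorr u x) \<le> 1"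
      using u cont_autocorr autocorr_le[OF u(2)] by auto
    show "cont (\<Psi> u)" unfolding \<Psi>_def by (intro cont_smear k c)
    show "cmod (\<Psi> u x) \<le> B" unfolding \<Psi>_def
      using smear_bound[OF k c(1) B(2) c(2)] by simp
  qed
  have normalise: "(\<lambda>x. of_real (1 / sqrt (energy u)) * u x) \<in> Adm" if u: "u \<in> L" "energy u > 0" for u
  proof -
    have "energy (\<lambda>x. of_real (1 / sqrt (energy u)) * u x) = 1"
      unfolding energy_scale using u by (simp add: power_divide)
    then show ?thesis using Lscale[OF u(1), of "1 / sqrt (energy u)"] by (simp only: Adm_def mem_Collect_eq simp_thms)
  qed
  have \<Psi>scale: "\<Psi> (\<lambda>x. of_real s * u x) = (\<lambda>x. of_real (s\<^sup>2) * \<Psi> u x)" for s u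
    unfolding \<Psi>_def autocorr_scale by (rule ext) (rule smear_cmult)
  have JB: "J u \<le> B\<^sup>2" if "u \<in> Adm" for u
  proof -
    have "norm (LINT x|haar. (cmod (\<Psi> u x))\<^sup>2) \<le> B\<^sup>2"
      using Adm[OF that] B by (intro haar_integral_bound continuous_intros) (auto intro!: power_mono)
    then show ?thesis by (simp add: J_def energy_def)
  qed
  define M where "M = (SUP u\<in>Adm. J u)"
  have bdd: "bdd_above (J ` Adm)" using JB by (intro bdd_aboveI2) auto
  have JM: "J u \<le> M" if "u \<in> Adm" for u unfolding M_def by (rule cSUP_upper[OF that bdd])
  have "energy u0 > 0"
  proof (rule ccontr)
    assume "\<not> energy u0 > 0"
    then have "u0 = (\<lambda>_. 0)" by (intro energy_eq_0 Lc u0) simp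
    then show False using u0(2) by (simp add: autocorr_def smear_def)
  qed
  note u1 = normalise[OF u0(1) this] and e0 = this
  have Mpos: "M > 0"
  proof -
    have "\<Psi> (\<lambda>x. of_real (1 / sqrt (energy u0)) * u0 x) 0 \<noteq> 0"
      unfolding \<Psi>scale using u0(2) e0 by (simp add: \<Psi>_def)
    then have "J (\<lambda>x. of_real (1 / sqrt (energy u0)) * u0 x) > 0"
      unfolding J_def by (intro energy_pos Adm(6)[OF u1])
    with JM[OF u1] show ?thesis by simp
  qed
  \<comment> \<open>The bound by the supremum in homogeneous form, valid without normalisation.\<close>
  have JL: "J u \<le> M * (energy u)\<^sup>2" if u: "u \<in> L" for u
  proof (cases "energy u > 0")
    case True
    have "(((1 / sqrt (energy u))\<^sup>2)\<^sup>2) * J u \<le> M"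
      using JM[OF normalise[OF u True]] by (simp only: J_def \<Psi>scale energy_scale)
    then show ?thesis using True by (simp add: power_divide field_simps)
  next
    case False
    then have "energy u = 0" using energy_nonneg[of u] by simp
    then have "u = (\<lambda>_. 0)" using energy_eq_0[OF Lc[OF u]] by simp
    then show ?thesis using Mpos by (simp add: J_def \<Psi>_def autocorr_def smear_def energy_def)
  qed
  have "\<exists>u\<in>Adm. M - 1 / real (Suc n) < J u" for n
  proof -
    have "Adm \<noteq> {}" using u1 by blast
    moreover have "M - 1 / real (Suc n) < M" by simp
    ultimately show ?thesis unfolding M_def using less_cSUP_iff[OF _ bdd] by blast
  qed
  then obtain U where U: "\<And>n. U n \<in> Adm" "\<And>n. M - 1 / real (Suc n) < J (U n)" by metis
  have Ulim: "(\<lambda>n. J (U n)) \<longlonglongrightarrow> M"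
  proof (rule tendsto_sandwich[OF _ _ _ tendsto_const])
    have "(\<lambda>n. M - 1 / real (Suc n)) \<longlonglongrightarrow> M - 0"
      by (intro tendsto_diff tendsto_const LIMSEQ_Suc[OF lim_const_over_n])
    then show "(\<lambda>n. M - 1 / real (Suc n)) \<longlonglongrightarrow> M" by simp
    show "\<forall>\<^sub>F n in sequentially. M - 1 / real (Suc n) \<le> J (U n)"
      by (intro always_eventually allI less_imp_le U(2))
    show "\<forall>\<^sub>F n in sequentially. J (U n) \<le> M" using JM[OF U(1)] by simp
  qed
  define q where "q n x = (autocorr (U n) x, \<Psi> (U n) x)" for n x
  obtain \<phi> \<psi> where \<psi>: "cont \<psi>" and cluster:
    "\<And>X. finite X \<Longrightarrow> \<exists>r. (\<forall>x\<in>X. (\<lambda>n. fst (q (r n) x)) \<longlonglongrightarrow> \<phi> x) \<and>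
       uniform_limit UNIV (\<lambda>n x. snd (q (r n) x)) \<psi> sequentially \<and> filterlim r at_top sequentially"
  proof (rule equicontinuous_cluster_point[of q B])
    show "cmod (fst (q n x)) \<le> B" "cmod (snd (q n x)) \<le> B" for n x
      using Adm(5)[OF U(1), of n x] Adm(7)[OF U(1), of n x] B by (auto simp: q_def)
    fix \<epsilon> :: real assume "\<epsilon> > 0"
    from smear_equicontinuous[OF k this] obtain V where "open V" "0 \<in> V"
      "\<And>\<phi> x t. cont \<phi> \<Longrightarrow> (\<And>x. cmod (\<phi> x) \<le> 1) \<Longrightarrow> t \<in> V \<Longrightarrow> cmod (smear k \<phi> (x + t) - smear k \<phi> x) \<le> \<epsilon>"
      by metis
    then show "\<exists>V. open V \<and> 0 \<in> V \<and> (\<forall>n x. \<forall>t\<in>V. cmod (snd (q n (x + t)) - snd (q n x)) \<le> \<epsilon>)"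
      using Adm(4,5)[OF U(1)] by (intro exI[of _ V]) (auto simp: q_def \<Psi>_def)
  qed blast
  have cluster': "\<exists>r. (\<forall>x\<in>X. (\<lambda>n. autocorr (U (r n)) x) \<longlonglongrightarrow> \<phi> x) \<and>
       uniform_limit UNIV (\<lambda>n. \<Psi> (U (r n))) \<psi> sequentially \<and> filterlim r at_top sequentially"
    if "finite X" for X
    using cluster[OF that] by (simp add: q_def)
  obtain r0 where r0: "uniform_limit UNIV (\<lambda>n. \<Psi> (U (r0 n))) \<psi> sequentially" "filterlim r0 at_top sequentially"
    using cluster'[of "{}"] by auto
  have E\<psi>: "energy \<psi> = M"
  proof (rule LIMSEQ_unique)
    show "(\<lambda>n. J (U (r0 n))) \<longlonglongrightarrow> energy \<psi>"
      unfolding J_def by (intro energy_uniform_limit \<psi> r0 Adm(6) U)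
    show "(\<lambda>n. J (U (r0 n))) \<longlonglongrightarrow> M" by (rule filterlim_compose[OF Ulim r0(2)])
  qed
  have \<phi>le: "cmod (\<phi> a) \<le> 1" for a
  proof -
    obtain r where r: "(\<lambda>n. autocorr (U (r n)) a) \<longlonglongrightarrow> \<phi> a" using cluster'[of "{a}"] by auto
    show ?thesis
      using tendsto_norm[OF r] Adm(5)[OF U(1)] by (intro LIMSEQ_le_const2) auto
  qed
  \<comment> \<open>The test function \<open>u + c u(\<cdot> + a)\<close> has energy \<open>2 + 2 Re (c \<phi> a)\<close> in the limit, and its smeared
      autocorrelation tends to the function on the left.\<close>
  have ineq: "energy (\<lambda>x. 2 * \<psi> x + (c * \<psi> (x + a) + cnj c * \<psi> (x - a))) \<le> M * (2 + 2 * Re (c * \<phi> a))\<^sup>2"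
    if c: "cmod c = 1" for c a
  proof -
    obtain r where r: "(\<lambda>n. autocorr (U (r n)) a) \<longlonglongrightarrow> \<phi> a"
      "uniform_limit UNIV (\<lambda>n. \<Psi> (U (r n))) \<psi> sequentially"
      using cluster'[of "{a}"] by auto
    define u where "u n = (\<lambda>x. U (r n) x + c * U (r n) (x + a))" for n
    have uL: "u n \<in> L" for n unfolding u_def by (intro Lshift Adm U)
    have \<Psi>u: "\<Psi> (u n) = (\<lambda>x. 2 * \<Psi> (U (r n)) x + (c * \<Psi> (U (r n)) (x + a) + cnj c * \<Psi> (U (r n)) (x - a)))" for n
      unfolding u_def \<Psi>_def by (rule ext) (simp add: smear_autocorr_shift_sum[OF k Adm(2)[OF U(1)]] c)
    have en: "energy (u n) = 2 + 2 * Re (c * autocorr (U (r n)) a)" for n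
      unfolding u_def energy_shift_sum[OF Adm(2)[OF U(1)] c] by (simp add: Adm(3)[OF U(1)])
    have "(\<lambda>n. energy (\<Psi> (u n))) \<longlonglongrightarrow> energy (\<lambda>x. 2 * \<psi> x + (c * \<psi> (x + a) + cnj c * \<psi> (x - a)))"
    proof (rule energy_uniform_limit)
      have C: "cont (\<Psi> (U (r n)))" for n by (intro Adm U)
      show "cont (\<Psi> (u n))" for n unfolding \<Psi>u by (intro continuous_intros C cont_shift)
      show "cont (\<lambda>x. 2 * \<psi> x + (c * \<psi> (x + a) + cnj c * \<psi> (x - a)))" by (intro continuous_intros \<psi> cont_shift)
      have sh: "uniform_limit UNIV (\<lambda>n x. \<Psi> (U (r n)) (x + b)) (\<lambda>x. \<psi> (x + b)) sequentially" for b
      proof (rule uniform_limitI)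
        fix e :: real assume "e > 0"
        from uniform_limitD[OF r(2) this]
        show "\<forall>\<^sub>F n in sequentially. \<forall>x\<in>UNIV. dist (\<Psi> (U (r n)) (x + b)) (\<psi> (x + b)) < e"
          by (rule eventually_mono) auto
      qed
      show "uniform_limit UNIV (\<lambda>n. \<Psi> (u n)) (\<lambda>x. 2 * \<psi> x + (c * \<psi> (x + a) + cnj c * \<psi> (x - a))) sequentially"
        unfolding \<Psi>u using sh[of a] sh[of "- a"] r(2)
        by (intro uniform_limit_add bounded_linear.uniform_limit[OF bounded_linear_mult_right]) simp_all
    qed
    moreover have "(\<lambda>n. M * (energy (u n))\<^sup>2) \<longlonglongrightarrow> M * (2 + 2 * Re (c * \<phi> a))\<^sup>2"
      unfolding en by (intro tendsto_intros r)
    ultimately show ?thesis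
      using JL[OF uL] by (intro LIMSEQ_le) (auto simp: J_def)
  qed
  have eq: "c * \<psi> (x + a) + cnj c * \<psi> (x - a) = of_real (2 * Re (c * \<phi> a)) * \<psi> x"
    if c: "cmod c = 1" for c a x
  proof (rule energy_equality_case[where D="\<lambda>x. c * \<psi> (x + a) + cnj c * \<psi> (x - a)", OF \<psi>])
    show "cont (\<lambda>x. c * \<psi> (x + a) + cnj c * \<psi> (x - a))" by (intro continuous_intros \<psi> cont_shift)
    have "cmod (c * \<phi> a) \<le> 1" using \<phi>le[of a] c by (simp add: norm_mult)
    then show "\<bar>2 * Re (c * \<phi> a)\<bar> \<le> 2" using abs_Re_le_cmod[of "c * \<phi> a"] by linarith
    show "energy (\<lambda>x. 2 * \<psi> x + (c * \<psi> (x + a) + cnj c * \<psi> (x - a))) \<le> energy \<psi> * (2 + 2 * Re (c * \<phi> a))\<^sup>2"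
      unfolding E\<psi> by (rule ineq[OF c])
    show "energy (\<lambda>x. 2 * \<psi> x - (c * \<psi> (x + a) + cnj c * \<psi> (x - a))) \<le> energy \<psi> * (2 - 2 * Re (c * \<phi> a))\<^sup>2"
      using ineq[of "- c" a] c unfolding E\<psi> by (simp add: algebra_simps)
  qed
  have "energy \<psi> > 0" unfolding E\<psi> by (rule Mpos)
  note ch = translation_eigenfunction[OF \<psi> this \<phi>le eq]
  have "(\<lambda>x. \<psi> 0 * \<phi> x) = \<psi>" using ch(2) by (intro ext) (rule sym)
  then have "uniform_limit UNIV (\<lambda>n. smear k (autocorr (U (r0 n)))) (\<lambda>x. \<psi> 0 * \<phi> x) sequentially"
    using r0(1) by (simp only: \<Psi>_def)
  then show ?thesis using that[OF ch(1) ch(3), of "\<lambda>n. U (r0 n)"] Adm(1)[OF U(1)] by blast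
qed

text \<open>
  The autocorrelation of \<open>v - v(\<cdot> + g)\<close> is \<open>2 A - A(\<cdot> + g) - A(\<cdot> - g)\<close> for \<open>A = autocorr v\<close>. At a
  character that is \<open>1\<close> at \<open>g\<close>, translation by \<open>g\<close> does not change coefficients, so these cancel.
\<close>

lemma smear_difference_orthogonal:
  assumes k: "cont k" and v: "cont v" and \<gamma>: "\<gamma> \<in> dual_group" "\<gamma> g = 1"
  shows "(LINT x|haar. smear k (autocorr (\<lambda>x. v x - v (x + g))) x * cnj (\<gamma> x)) = 0"
proof -
  define S where "S = smear k (autocorr v)"
  have S: "cont S" unfolding S_def by (intro cont_smear k cont_autocorr v)
  define I where "I = (LINT x|haar. S x * cnj (\<gamma> x))"
  have \<gamma>c: "cont \<gamma>" by (rule dual_groupD[OF \<gamma>(1)])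
  have sh: "(LINT x|haar. S (x + b) * cnj (\<gamma> x)) = I" if b: "\<gamma> b = 1" for b
  proof -
    have "cnj (\<gamma> (x + b)) = cnj (\<gamma> x)" for x using dual_groupD(3)[OF \<gamma>(1), of x b] b by simp
    then have "(LINT x|haar. S (x + b) * cnj (\<gamma> x)) = (LINT x|haar. S (x + b) * cnj (\<gamma> (x + b)))" by simp
    also have "\<dots> = I" unfolding I_def by (rule haar_shift) (intro continuous_intros S \<gamma>c)
    finally show ?thesis .
  qed
  have gm: "\<gamma> (- g) = 1" using dual_groupD(5)[OF \<gamma>(1), of g] \<gamma>(2) by simp
  have i: "integrable haar (\<lambda>x. S (x + b) * cnj (\<gamma> x))" "integrable haar (\<lambda>x. S x * cnj (\<gamma> x))" for b
    by (intro haar_integrable continuous_intros S \<gamma>c cont_shift)+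
  have pt: "smear k (autocorr (\<lambda>x. v x - v (x + g))) x = 2 * S x - S (x + g) - S (x + (- g))" for x
    using smear_autocorr_shift_sum[OF k v, of "- 1" g x] by (simp add: S_def)
  have "(LINT x|haar. smear k (autocorr (\<lambda>x. v x - v (x + g))) x * cnj (\<gamma> x)) = (LINT x|haar. 2 * (S x * cnj (\<gamma> x))
      - S (x + g) * cnj (\<gamma> x) - S (x + (- g)) * cnj (\<gamma> x))"
    unfolding pt by (simp add: left_diff_distrib mult.assoc)
  also have "\<dots> = 2 * I - I - I"
    using i(1)[of g] i(2) i(1)[of "- g"] sh[OF \<gamma>(2)] sh[OF gm]
    by (simp del: add_uminus_conv_diff) (simp add: I_def)
  finally show ?thesis by simp
qed

text \<open>
  The extremal argument is run inside the space of differences \<open>v - v(\<cdot> + g)\<close>, which is not \<open>{0}\<close>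
  since \<open>g \<noteq> 0\<close>. The character that it finds is a limit of smeared autocorrelations of such
  differences, up to a factor. If it were \<open>1\<close> at \<open>g\<close>, it would be orthogonal to all of them, hence
  to itself.
\<close>

theorem characters_separate_0:
  fixes g :: "'a"
  assumes g: "g \<noteq> 0"
  shows "\<exists>\<gamma>\<in>dual_group. \<gamma> g \<noteq> 1"
proof -
  define L where "L = {u :: 'a \<Rightarrow> complex. \<exists>v. cont v \<and> u = (\<lambda>x. v x - v (x + g))}"
  have Lc: "cont u" if "u \<in> L" for u
  proof -
    obtain v where v: "cont v" "u = (\<lambda>x. v x - v (x + g))" using \<open>u \<in> L\<close> by (auto simp: L_def)
    show ?thesis unfolding v(2) by (intro continuous_on_diff v cont_shift)
  qed
  have Lscale: "(\<lambda>x. of_real s * u x) \<in> L" if u: "u \<in> L" for u s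
  proof -
    obtain v where "cont v" "u = (\<lambda>x. v x - v (x + g))" using u by (auto simp: L_def)
    then show ?thesis unfolding L_def
      by (intro CollectI exI[of _ "\<lambda>x. of_real s * v x"] conjI) (auto intro!: continuous_intros simp: algebra_simps)
  qed
  have Lshift: "(\<lambda>x. u x + c * u (x + a)) \<in> L" if u: "u \<in> L" for u c a
  proof -
    obtain v where v: "cont v" "u = (\<lambda>x. v x - v (x + g))" using u by (auto simp: L_def)
    have "cont (\<lambda>x. v x + c * v (x + a))" by (intro continuous_intros v cont_shift)
    then show ?thesis unfolding L_def
      by (intro CollectI exI[of _ "\<lambda>x. v x + c * v (x + a)"] conjI) (auto simp: v(2) algebra_simps)
  qed
  have "closed {0::'a}" "closed {g}" "{0} \<inter> {g} = {}" using g by auto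
  then obtain w :: "'a \<Rightarrow> real" where w: "cont w" "w 0 = 1" "w g = 0"
    using compact_Urysohn[OF compact_group, of "{0}" "{g}"] by (metis insertI1)
  define u0 where "u0 x = complex_of_real (w x) - of_real (w (x + g))" for x
  have u0L: "u0 \<in> L" unfolding L_def u0_def
    using w by (intro CollectI exI[of _ "\<lambda>x. complex_of_real (w x)"] conjI) (auto intro!: continuous_intros)
  have A0: "cont (autocorr u0)" by (intro cont_autocorr Lc u0L)
  have u0: "energy u0 > 0" using w by (intro energy_pos[OF Lc[OF u0L], of 0]) (simp add: u0_def)
  \<comment> \<open>This kernel makes the smeared autocorrelation of \<open>u0\<close> at \<open>0\<close> a square integral, hence nonzero.\<close>
  define k where "k y = cnj (autocorr u0 y)" for y
  have k: "cont k" unfolding k_def by (intro continuous_intros A0)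
  have "smear k (autocorr u0) 0 = of_real (energy (autocorr u0))"
  proof -
    have "k y * autocorr u0 y = complex_of_real ((cmod (autocorr u0 y))\<^sup>2)" for y
      unfolding k_def by (metis complex_norm_square mult.commute)
    then show ?thesis by (simp add: smear_def energy_def del: of_real_power)
  qed
  moreover have "energy (autocorr u0) > 0"
    using u0 by (intro energy_pos[of _ 0] A0) (simp add: autocorr_0)
  ultimately have ne: "smear k (autocorr u0) 0 \<noteq> 0" by simp
  obtain \<gamma> z U where \<gamma>: "\<gamma> \<in> dual_group" and z: "z \<noteq> 0" and U: "\<And>n::nat. U n \<in> L"
    and lim: "uniform_limit UNIV (\<lambda>n. smear k (autocorr (U n))) (\<lambda>x. z * \<gamma> x) sequentially"
    using extremal_character[OF k Lc Lscale Lshift u0L ne] by metis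
  have \<gamma>c: "cont \<gamma>" by (rule dual_groupD[OF \<gamma>])
  have "\<gamma> g \<noteq> 1"
  proof
    assume g1: "\<gamma> g = 1"
    have zero: "(LINT x|haar. smear k (autocorr (U n)) x * cnj (\<gamma> x)) = 0" for n
    proof -
      obtain v where v: "cont v" "U n = (\<lambda>x. v x - v (x + g))" using U[of n] by (auto simp: L_def)
      show ?thesis unfolding v(2) by (rule smear_difference_orthogonal[OF k v(1) \<gamma> g1])
    qed
    have "bounded (range (\<lambda>x. z * \<gamma> x))" "bounded (range (\<lambda>x. cnj (\<gamma> x)))"
      using dual_groupD(2)[OF \<gamma>] by (auto simp: bounded_iff norm_mult)
    then have "uniform_limit UNIV (\<lambda>n x. smear k (autocorr (U n)) x * cnj (\<gamma> x)) (\<lambda>x. z * \<gamma> x * cnj (\<gamma> x)) sequentially"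
      by (intro uniform_lim_mult lim uniform_limit_const)
    then have "(\<lambda>n. LINT x|haar. smear k (autocorr (U n)) x * cnj (\<gamma> x)) \<longlonglongrightarrow> (LINT x|haar. z * \<gamma> x * cnj (\<gamma> x))"
      using cont_smear[OF k cont_autocorr[OF Lc[OF U]]]
      by (intro integral_uniform_limit continuous_intros \<gamma>c)
    then have "(LINT x|haar. z * \<gamma> x * cnj (\<gamma> x)) = 0"
      using LIMSEQ_unique[OF _ tendsto_const[of 0]] by (simp add: zero)
    moreover have "z * \<gamma> x * cnj (\<gamma> x) = z" for x
      using dual_groupD(7)[OF \<gamma>, of x] by (simp add: mult.assoc)
    ultimately show False using z by simp
  qed
  then show ?thesis using \<gamma> by blast
qed

section \<open>Trigonometric polynomials\<close>

abbreviation coeff :: "('a \<Rightarrow> complex) \<Rightarrow> ('a \<Rightarrow> complex) \<Rightarrow> complex" where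
  "coeff \<phi> \<gamma> \<equiv> LINT x|haar. \<phi> x * cnj (\<gamma> x)"

lemma one_dual_group: "(\<lambda>_. 1) \<in> dual_group"
  by (simp add: dual_group_def)

lemma mult_dual_group: "\<gamma> \<in> dual_group \<Longrightarrow> \<delta> \<in> dual_group \<Longrightarrow> (\<lambda>x. \<gamma> x * \<delta> x) \<in> dual_group"
  by (auto simp: dual_group_def norm_mult intro!: continuous_intros)

lemma cnj_dual_group: "\<gamma> \<in> dual_group \<Longrightarrow> (\<lambda>x. cnj (\<gamma> x)) \<in> dual_group"
  by (auto simp: dual_group_def intro!: continuous_intros)

lemma integral_character:
  assumes \<gamma>: "\<gamma> \<in> dual_group" and ne: "\<gamma> \<noteq> (\<lambda>_. 1)"
  shows "(LINT x|haar. \<gamma> x) = 0"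
proof -
  obtain a where a: "\<gamma> a \<noteq> 1" using ne by auto
  have "(LINT x|haar. \<gamma> x) = (LINT x|haar. \<gamma> (x + a))"
    using haar_shift[OF dual_groupD(1)[OF \<gamma>]] by simp
  also have "\<dots> = (LINT x|haar. \<gamma> x) * \<gamma> a" by (simp add: dual_groupD(3)[OF \<gamma>])
  finally have "(LINT x|haar. \<gamma> x) * (1 - \<gamma> a) = 0" by (simp add: algebra_simps)
  then show ?thesis using a by simp
qed

lemma character_orthogonality:
  assumes \<gamma>: "\<gamma> \<in> dual_group" and \<delta>: "\<delta> \<in> dual_group"
  shows "coeff \<gamma> \<delta> = (if \<gamma> = \<delta> then 1 else 0)"
proof (cases "\<gamma> = \<delta>")
  case True
  then show ?thesis using dual_groupD(7)[OF \<delta>] by simp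
next
  case False
  have "(\<lambda>x. \<gamma> x * cnj (\<delta> x)) \<noteq> (\<lambda>_. 1)"
  proof
    assume "(\<lambda>x. \<gamma> x * cnj (\<delta> x)) = (\<lambda>_. 1)"
    then have "\<gamma> x * cnj (\<delta> x) * \<delta> x = \<delta> x" for x by (metis mult_1)
    then have "\<gamma> x = \<delta> x" for x using dual_groupD(7)[OF \<delta>, of x] by (metis mult.assoc mult.commute mult_1)
    then show False using False by auto
  qed
  then show ?thesis
    using False integral_character[OF mult_dual_group[OF \<gamma> cnj_dual_group[OF \<delta>]]] by simp
qed

inductive_set trig :: "('a \<Rightarrow> complex) set" where
  zero: "(\<lambda>_. 0) \<in> trig"
| add_char: "p \<in> trig \<Longrightarrow> \<gamma> \<in> dual_group \<Longrightarrow> (\<lambda>x. p x + c * \<gamma> x) \<in> trig"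

lemma trig_char: "\<gamma> \<in> dual_group \<Longrightarrow> (\<lambda>x. c * \<gamma> x) \<in> trig"
  using trig.add_char[OF trig.zero, of \<gamma> c] by simp

lemma trig_add:
  assumes "p \<in> trig" "q \<in> trig"
  shows "(\<lambda>x. p x + q x) \<in> trig"
  using assms(2)
proof (induction rule: trig.induct)
  case (add_char q \<gamma> c)
  then show ?case using trig.add_char[of "\<lambda>x. p x + q x" \<gamma> c] by (simp add: add.assoc)
qed (simp add: assms(1))

lemma trig_mult_char: "p \<in> trig \<Longrightarrow> \<delta> \<in> dual_group \<Longrightarrow> (\<lambda>x. p x * (d * \<delta> x)) \<in> trig"
proof (induction p rule: trig.induct)
  case (add_char p \<gamma> c)
  have "(\<lambda>x. p x * (d * \<delta> x) + (c * d) * (\<gamma> x * \<delta> x)) \<in> trig"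
    using add_char by (intro trig.add_char mult_dual_group)
  then show ?case by (simp add: algebra_simps)
qed (simp add: trig.zero)

lemma trig_mult:
  assumes "p \<in> trig" "q \<in> trig"
  shows "(\<lambda>x. p x * q x) \<in> trig"
  using assms(2)
proof (induction rule: trig.induct)
  case (add_char q \<gamma> c)
  have "(\<lambda>x. p x * q x + p x * (c * \<gamma> x)) \<in> trig"
    using add_char assms(1) by (intro trig_add trig_mult_char)
  then show ?case by (simp add: distrib_left)
qed (simp add: trig.zero)

lemma trig_const: "(\<lambda>_. c) \<in> trig"
  using trig_char[OF one_dual_group, of c] by simp

lemma trig_cmult: "p \<in> trig \<Longrightarrow> (\<lambda>x. c * p x) \<in> trig"
  by (rule trig_mult[OF trig_const])

lemma trig_representation:
  assumes "p \<in> trig"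
  obtains F c where "finite F" "F \<subseteq> dual_group" "p = (\<lambda>x. \<Sum>\<gamma>\<in>F. c \<gamma> * \<gamma> x)"
proof -
  have "\<exists>F c. finite F \<and> F \<subseteq> dual_group \<and> p = (\<lambda>x. \<Sum>\<gamma>\<in>F. c \<gamma> * \<gamma> x)"
    using assms
  proof (induction rule: trig.induct)
    case zero
    show ?case by (intro exI[of _ "{}"]) auto
  next
    case (add_char p \<delta> d)
    then obtain F c where F: "finite F" "F \<subseteq> dual_group" "p = (\<lambda>x. \<Sum>\<gamma>\<in>F. c \<gamma> * \<gamma> x)" by blast
    define c' where "c' \<gamma> = (if \<gamma> \<in> F then c \<gamma> else 0) + (if \<gamma> = \<delta> then d else 0)" for \<gamma>
    have "p x + d * \<delta> x = (\<Sum>\<gamma>\<in>insert \<delta> F. c' \<gamma> * \<gamma> x)" for x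
    proof -
      have "(\<Sum>\<gamma>\<in>insert \<delta> F. c' \<gamma> * \<gamma> x) = (\<Sum>\<gamma>\<in>insert \<delta> F. (if \<gamma> \<in> F then c \<gamma> else 0) * \<gamma> x) + (\<Sum>\<gamma>\<in>insert \<delta> F. (if \<gamma> = \<delta> then d else 0) * \<gamma> x)"
        unfolding c'_def by (simp only: distrib_right sum.distrib)
      also have "(\<Sum>\<gamma>\<in>insert \<delta> F. (if \<gamma> = \<delta> then d else 0) * \<gamma> x) = d * \<delta> x"
        using F(1) by (simp add: if_distrib[of "\<lambda>z. z * _"] sum.delta cong: if_cong)
      also have "(\<Sum>\<gamma>\<in>insert \<delta> F. (if \<gamma> \<in> F then c \<gamma> else 0) * \<gamma> x) = (\<Sum>\<gamma>\<in>F. c \<gamma> * \<gamma> x)"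
        using F(1) by (intro sum.mono_neutral_cong_right) auto
      finally show ?thesis using F(3) by simp
    qed
    then show ?case using F add_char by (intro exI[of _ "insert \<delta> F"] exI[of _ c']) auto
  qed
  then show ?thesis using that by blast
qed

lemma cont_trig: "p \<in> trig \<Longrightarrow> cont p"
proof (induction rule: trig.induct)
  case zero
  show ?case by (rule continuous_on_const)
next
  case (add_char p \<gamma> c)
  then show ?case using dual_groupD(1)[of \<gamma>]
    by (auto intro!: continuous_on_add continuous_on_mult)
qed

text \<open>
  The real functions among the trigonometric polynomials form a ring that contains the real and
  imaginary parts of characters, so it separates points and Stone-Weierstrass applies.
\<close>

lemma trig_dense_real:
  fixes f :: "'a \<Rightarrow> real"
  assumes f: "cont f" and \<epsilon>: "\<epsilon> > 0"
  obtains g where "(\<lambda>x. complex_of_real (g x)) \<in> trig" "\<And>x. \<bar>f x - g x\<bar> < \<epsilon>"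
proof -
  define R where "R = {g :: 'a \<Rightarrow> real. (\<lambda>x. complex_of_real (g x)) \<in> trig}"
  have char: "(\<lambda>x. Re (\<gamma> x)) \<in> R \<and> (\<lambda>x. Im (\<gamma> x)) \<in> R" if \<gamma>: "\<gamma> \<in> dual_group" for \<gamma>
  proof -
    have "(\<lambda>x. (1/2) * \<gamma> x + (1/2) * cnj (\<gamma> x)) \<in> trig" "(\<lambda>x. (- \<i>/2) * \<gamma> x + (\<i>/2) * cnj (\<gamma> x)) \<in> trig"
      by (intro trig_add trig_char \<gamma> cnj_dual_group)+
    moreover have "(1/2) * z + (1/2) * cnj z = complex_of_real (Re z)"
      "(- \<i>/2) * z + (\<i>/2) * cnj z = complex_of_real (Im z)" for z
      by (simp_all add: complex_eq_iff)
    ultimately show ?thesis by (simp add: R_def)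
  qed
  interpret function_ring_on R UNIV
  proof
    show "compact (UNIV :: 'a set)" by (rule compact_group)
    show "cont g" if "g \<in> R" for g
    proof -
      have "cont (\<lambda>x. complex_of_real (g x))"
        using that cont_trig[of "\<lambda>x. complex_of_real (g x)"] by (simp add: R_def)
      then show ?thesis by simp
    qed
    show "(\<lambda>x. g x + h x) \<in> R" if "g \<in> R" "h \<in> R" for g h
      using trig_add that by (simp add: R_def)
    show "(\<lambda>x. g x * h x) \<in> R" if "g \<in> R" "h \<in> R" for g h
      using trig_mult that by (simp add: R_def)
    show "(\<lambda>_. c) \<in> R" for c using trig_const by (simp add: R_def)
    show "\<exists>g\<in>R. g x \<noteq> g y" if "x \<noteq> y" for x y :: 'a
    proof -
      have "x - y \<noteq> 0" using that by simp
      then obtain \<gamma> where \<gamma>: "\<gamma> \<in> dual_group" "\<gamma> (x - y) \<noteq> 1"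
        using characters_separate_0 by blast
      have "\<gamma> x \<noteq> \<gamma> y"
      proof
        assume "\<gamma> x = \<gamma> y"
        then have "\<gamma> (x - y) = \<gamma> y * cnj (\<gamma> y)" by (simp only: dual_groupD(6)[OF \<gamma>(1)])
        then show False using \<gamma>(2) dual_groupD(7)[OF \<gamma>(1)] by simp
      qed
      then have "Re (\<gamma> x) \<noteq> Re (\<gamma> y) \<or> Im (\<gamma> x) \<noteq> Im (\<gamma> y)" by (simp add: complex_eq_iff)
      then show ?thesis
      proof
        assume "Re (\<gamma> x) \<noteq> Re (\<gamma> y)"
        then show ?thesis using char[OF \<gamma>(1)] by (intro bexI[of _ "\<lambda>x. Re (\<gamma> x)"]) auto
      next
        assume "Im (\<gamma> x) \<noteq> Im (\<gamma> y)"
        then show ?thesis using char[OF \<gamma>(1)] by (intro bexI[of _ "\<lambda>x. Im (\<gamma> x)"]) auto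
      qed
    qed
  qed
  show ?thesis using Stone_Weierstrass_basic[OF f \<epsilon>] that unfolding R_def by auto
qed

theorem trig_dense:
  assumes u: "cont u" and \<epsilon>: "\<epsilon> > 0"
  obtains p where "p \<in> trig" "\<And>x. cmod (u x - p x) < \<epsilon>"
proof -
  obtain g where g: "(\<lambda>x. complex_of_real (g x)) \<in> trig" "\<And>x. \<bar>Re (u x) - g x\<bar> < \<epsilon> / 2"
    using trig_dense_real[of "\<lambda>x. Re (u x)" "\<epsilon> / 2"] u \<epsilon> by (auto intro!: continuous_intros)
  obtain h where h: "(\<lambda>x. complex_of_real (h x)) \<in> trig" "\<And>x. \<bar>Im (u x) - h x\<bar> < \<epsilon> / 2"
    using trig_dense_real[of "\<lambda>x. Im (u x)" "\<epsilon> / 2"] u \<epsilon> by (auto intro!: continuous_intros)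
  have "(\<lambda>x. complex_of_real (g x) + \<i> * complex_of_real (h x)) \<in> trig"
    by (intro trig_add trig_cmult g h)
  moreover have "cmod (u x - (complex_of_real (g x) + \<i> * complex_of_real (h x))) < \<epsilon>" for x
    using cmod_le[of "u x - (complex_of_real (g x) + \<i> * complex_of_real (h x))"] g(2)[of x] h(2)[of x]
    by simp
  ultimately show ?thesis by (rule that)
qed

section \<open>Bounded functionals and Fourier series\<close>

text \<open>
  Covers integrals against signed measures as well as integrals with a continuous weight, such as
  single Fourier coefficients; the density of trigonometric polynomials is applied to both.
\<close>

definition bounded_functional :: "(('a \<Rightarrow> complex) \<Rightarrow> complex) \<Rightarrow> bool" where
  "bounded_functional L \<longleftrightarrow>
     (\<forall>f g. cont f \<longrightarrow> cont g \<longrightarrow> L (\<lambda>x. f x + g x) = L f + L g) \<and>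
     (\<forall>c f. cont f \<longrightarrow> L (\<lambda>x. c * f x) = c * L f) \<and>
     (\<exists>C. \<forall>f B. cont f \<longrightarrow> (\<forall>x. cmod (f x) \<le> B) \<longrightarrow> cmod (L f) \<le> C * B)"

lemma bounded_functionalD:
  assumes "bounded_functional L"
  shows "cont f \<Longrightarrow> cont g \<Longrightarrow> L (\<lambda>x. f x + g x) = L f + L g"
    and "cont f \<Longrightarrow> L (\<lambda>x. c * f x) = c * L f"
    and "cont f \<Longrightarrow> cont g \<Longrightarrow> L (\<lambda>x. f x - g x) = L f - L g"
proof -
  show add: "L (\<lambda>x. f x + g x) = L f + L g" if "cont f" "cont g" for f g
    using assms that by (auto simp: bounded_functional_def)
  show cm: "L (\<lambda>x. c * f x) = c * L f" if "cont f" for c f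
    using assms that by (auto simp: bounded_functional_def)
  show "L (\<lambda>x. f x - g x) = L f - L g" if "cont f" "cont g" for f g
    using add[of f "\<lambda>x. (-1) * g x"] cm[of g "-1"] that by (simp add: continuous_intros)
qed

lemma bounded_functional_bound:
  assumes "bounded_functional L"
  obtains C where "C > 0" "\<And>f B. cont f \<Longrightarrow> (\<And>x. cmod (f x) \<le> B) \<Longrightarrow> cmod (L f) \<le> C * B"
proof -
  obtain C where C': "\<forall>f B. cont f \<longrightarrow> (\<forall>x. cmod (f x) \<le> B) \<longrightarrow> cmod (L f) \<le> C * B"
    using assms unfolding bounded_functional_def by blast
  have C: "cmod (L f) \<le> C * B" if "cont f" "\<And>x. cmod (f x) \<le> B" for f B
    using C' that by blast
  have "cmod (L f) \<le> (\<bar>C\<bar> + 1) * B" if "cont f" "\<And>x. cmod (f x) \<le> B" for f B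
  proof -
    have "0 \<le> B" using that(2)[of 0] norm_ge_zero order_trans by blast
    then have "C * B \<le> (\<bar>C\<bar> + 1) * B" by (intro mult_right_mono) auto
    then show ?thesis using C[OF that] by linarith
  qed
  then show ?thesis by (intro that[of "\<bar>C\<bar> + 1"]) auto
qed

lemma bounded_functional_sum:
  assumes L: "bounded_functional L" and fin: "finite F" and c: "\<And>\<gamma>. \<gamma> \<in> F \<Longrightarrow> cont \<gamma>"
  shows "L (\<lambda>x. \<Sum>\<gamma>\<in>F. c \<gamma> * \<gamma> x) = (\<Sum>\<gamma>\<in>F. c \<gamma> * L \<gamma>)"
  using fin c
proof (induction F rule: finite_induct)
  case empty
  show ?case using bounded_functionalD(2)[OF L, of "\<lambda>_. 0" 0] by simp
next
  case (insert \<gamma> F)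
  have "L (\<lambda>x. c \<gamma> * \<gamma> x + (\<Sum>\<gamma>\<in>F. c \<gamma> * \<gamma> x)) = L (\<lambda>x. c \<gamma> * \<gamma> x) + L (\<lambda>x. \<Sum>\<gamma>\<in>F. c \<gamma> * \<gamma> x)"
    using insert by (intro bounded_functionalD[OF L]) (auto intro!: continuous_intros)
  then show ?case using insert bounded_functionalD(2)[OF L, of \<gamma>] by simp
qed

lemma bounded_functional_integral:
  assumes M: "finite_borel M"
  shows "bounded_functional (\<lambda>f. LINT x|M. f x)"
  unfolding bounded_functional_def
proof (intro conjI allI impI exI)
  fix f g :: "'a \<Rightarrow> complex" assume "cont f" "cont g"
  then show "(LINT x|M. f x + g x) = (LINT x|M. f x) + (LINT x|M. g x)"
    by (intro Bochner_Integration.integral_add cont_integrable M)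
next
  fix f :: "'a \<Rightarrow> complex" and B assume "cont f" "\<forall>x. cmod (f x) \<le> B"
  then show "cmod (LINT x|M. f x) \<le> measure M UNIV * B"
    using finite_borel_integral_bound[OF M cont_measurable[of f], of B] by (simp add: mult.commute)
qed simp

lemma bounded_functional_signed:
  assumes \<mu>: "signed_borel_measure \<mu>"
  shows "bounded_functional (signed_integral \<mu>)"
proof -
  note p = bounded_functional_integral[OF finite_borel_positive_part[OF \<mu>]]
  note n = bounded_functional_integral[OF finite_borel_negative_part[OF \<mu>]]
  obtain C where C: "\<And>f B. cont f \<Longrightarrow> (\<And>x. cmod (f x) \<le> B) \<Longrightarrow> cmod (LINT x|positive_part \<mu>. f x) \<le> C * B"
    using bounded_functional_bound[OF p] by metis
  obtain D where D: "\<And>f B. cont f \<Longrightarrow> (\<And>x. cmod (f x) \<le> B) \<Longrightarrow> cmod (LINT x|negative_part \<mu>. f x) \<le> D * B"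
    using bounded_functional_bound[OF n] by metis
  show ?thesis
    unfolding bounded_functional_def signed_integral_def
  proof (intro conjI allI impI exI)
    fix f g :: "'a \<Rightarrow> complex" assume "cont f" "cont g"
    then show "(LINT x|positive_part \<mu>. f x + g x) - (LINT x|negative_part \<mu>. f x + g x) =
      (LINT x|positive_part \<mu>. f x) - (LINT x|negative_part \<mu>. f x) +
      ((LINT x|positive_part \<mu>. g x) - (LINT x|negative_part \<mu>. g x))"
      using bounded_functionalD(1)[OF p] bounded_functionalD(1)[OF n] by simp
  next
    fix f :: "'a \<Rightarrow> complex" and B assume f: "cont f" "\<forall>x. cmod (f x) \<le> B"
    have "cmod ((LINT x|positive_part \<mu>. f x) - (LINT x|negative_part \<mu>. f x))
      \<le> cmod (LINT x|positive_part \<mu>. f x) + cmod (LINT x|negative_part \<mu>. f x)" by (rule norm_triangle_ineq4)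
    also have "\<dots> \<le> C * B + D * B" using f C D by (intro add_mono) auto
    finally show "cmod ((LINT x|positive_part \<mu>. f x) - (LINT x|negative_part \<mu>. f x)) \<le> (C + D) * B"
      by (simp add: distrib_right)
  qed (simp add: right_diff_distrib)
qed

lemma bounded_functional_weight:
  assumes h: "cont h"
  shows "bounded_functional (\<lambda>f. LINT x|haar. f x * h x)"
proof -
  obtain C where C: "C > 0" "\<And>x. cmod (h x) \<le> C" using cont_bounded[OF h] by metis
  show ?thesis
    unfolding bounded_functional_def
  proof (intro conjI allI impI exI)
    fix f g :: "'a \<Rightarrow> complex" assume "cont f" "cont g"
    then have "cont (\<lambda>x. f x * h x)" "cont (\<lambda>x. g x * h x)" using h by (auto intro!: continuous_on_mult)
    then show "(LINT x|haar. (f x + g x) * h x) = (LINT x|haar. f x * h x) + (LINT x|haar. g x * h x)"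
      by (simp add: distrib_right)
  next
    fix f :: "'a \<Rightarrow> complex" and c
    have "(LINT x|haar. c * f x * h x) = (LINT x|haar. c * (f x * h x))" by (simp add: mult.assoc)
    then show "(LINT x|haar. c * f x * h x) = c * (LINT x|haar. f x * h x)" by simp
  next
    fix f :: "'a \<Rightarrow> complex" and B assume f: "cont f" "\<forall>x. cmod (f x) \<le> B"
    show "cmod (LINT x|haar. f x * h x) \<le> C * B"
    proof (rule haar_integral_bound)
      show "cont (\<lambda>x. f x * h x)" using f h by (intro continuous_intros)
      show "cmod (f x * h x) \<le> C * B" for x
        using f(2) C mult_mono[of "cmod (h x)" C "cmod (f x)" B] by (simp add: norm_mult mult.commute)
    qed
  qed
qed

lemma autocorr_trig:
  assumes F: "finite F" "F \<subseteq> dual_group"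
  shows "autocorr (\<lambda>x. \<Sum>\<gamma>\<in>F. c \<gamma> * \<gamma> x) = (\<lambda>x. \<Sum>\<gamma>\<in>F. of_real ((cmod (c \<gamma>))\<^sup>2) * \<gamma> x)"
proof
  fix x
  have "autocorr (\<lambda>x. \<Sum>\<gamma>\<in>F. c \<gamma> * \<gamma> x) x
      = (LINT y|haar. (\<Sum>\<gamma>\<in>F. \<Sum>\<delta>\<in>F. (c \<gamma> * cnj (c \<delta>) * \<gamma> x) * (\<gamma> y * cnj (\<delta> y))))"
    unfolding autocorr_def
  proof (intro Bochner_Integration.integral_cong refl)
    fix y
    have "(\<Sum>\<gamma>\<in>F. c \<gamma> * \<gamma> (x + y)) * cnj (\<Sum>\<gamma>\<in>F. c \<gamma> * \<gamma> y)
      = (\<Sum>\<gamma>\<in>F. \<Sum>\<delta>\<in>F. (c \<gamma> * \<gamma> (x + y)) * (cnj (c \<delta>) * cnj (\<delta> y)))"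
      by (simp add: sum_product)
    also have "\<dots> = (\<Sum>\<gamma>\<in>F. \<Sum>\<delta>\<in>F. (c \<gamma> * cnj (c \<delta>) * \<gamma> x) * (\<gamma> y * cnj (\<delta> y)))"
      using F(2) by (intro sum.cong refl) (auto simp: dual_groupD(3) subset_iff)
    finally show "(\<Sum>\<gamma>\<in>F. c \<gamma> * \<gamma> (x + y)) * cnj (\<Sum>\<gamma>\<in>F. c \<gamma> * \<gamma> y) =
      (\<Sum>\<gamma>\<in>F. \<Sum>\<delta>\<in>F. (c \<gamma> * cnj (c \<delta>) * \<gamma> x) * (\<gamma> y * cnj (\<delta> y)))" .
  qed
  also have "\<dots> = (\<Sum>\<gamma>\<in>F. \<Sum>\<delta>\<in>F. (c \<gamma> * cnj (c \<delta>) * \<gamma> x) * (LINT y|haar. \<gamma> y * cnj (\<delta> y)))"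
  proof -
    have i: "integrable haar (\<lambda>y. \<gamma> y * cnj (\<delta> y))" if "\<gamma> \<in> F" "\<delta> \<in> F" for \<gamma> \<delta>
      using that F(2) by (intro haar_integrable continuous_intros dual_groupD(1)) auto
    have "(LINT y|haar. (\<Sum>\<gamma>\<in>F. \<Sum>\<delta>\<in>F. (c \<gamma> * cnj (c \<delta>) * \<gamma> x) * (\<gamma> y * cnj (\<delta> y))))
      = (\<Sum>\<gamma>\<in>F. LINT y|haar. (\<Sum>\<delta>\<in>F. (c \<gamma> * cnj (c \<delta>) * \<gamma> x) * (\<gamma> y * cnj (\<delta> y))))"
      using i by (intro Bochner_Integration.integral_sum Bochner_Integration.integrable_sum integrable_mult_right) auto
    also have "\<dots> = (\<Sum>\<gamma>\<in>F. \<Sum>\<delta>\<in>F. LINT y|haar. (c \<gamma> * cnj (c \<delta>) * \<gamma> x) * (\<gamma> y * cnj (\<delta> y)))"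
      using i by (intro sum.cong refl Bochner_Integration.integral_sum integrable_mult_right) auto
    finally show ?thesis by simp
  qed
  also have "\<dots> = (\<Sum>\<gamma>\<in>F. \<Sum>\<delta>\<in>F. if \<gamma> = \<delta> then c \<gamma> * cnj (c \<delta>) * \<gamma> x else 0)"
    using F(2) by (intro sum.cong refl) (auto simp: character_orthogonality subset_iff)
  also have "\<dots> = (\<Sum>\<gamma>\<in>F. c \<gamma> * cnj (c \<gamma>) * \<gamma> x)"
    using F(1) by (intro sum.cong refl) (simp add: sum.delta')
  also have "\<dots> = (\<Sum>\<gamma>\<in>F. of_real ((cmod (c \<gamma>))\<^sup>2) * \<gamma> x)"
    by (simp only: complex_norm_square)
  finally show "autocorr (\<lambda>x. \<Sum>\<gamma>\<in>F. c \<gamma> * \<gamma> x) x = (\<Sum>\<gamma>\<in>F. of_real ((cmod (c \<gamma>))\<^sup>2) * \<gamma> x)" .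
qed

lemma autocorr_diff_bound:
  assumes u: "cont u" and p: "cont p" and C: "\<And>x. cmod (u x) \<le> C" "\<And>x. cmod (p x) \<le> C"
    and e: "\<And>x. cmod (u x - p x) \<le> e"
  shows "cmod (autocorr u x - autocorr p x) \<le> 2 * C * e"
proof -
  have c: "cont (\<lambda>y. u (x + y) * cnj (u y))" "cont (\<lambda>y. p (x + y) * cnj (p y))"
    by (intro continuous_intros u p cont_shift)+
  then have "autocorr u x - autocorr p x = (LINT y|haar. u (x + y) * cnj (u y) - p (x + y) * cnj (p y))"
    by (simp add: autocorr_def)
  also have "cmod \<dots> \<le> 2 * C * e"
  proof (rule haar_integral_bound)
    show "cont (\<lambda>y. u (x + y) * cnj (u y) - p (x + y) * cnj (p y))" by (intro continuous_intros c)
    fix y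
    have "u (x + y) * cnj (u y) - p (x + y) * cnj (p y)
       = (u (x + y) - p (x + y)) * cnj (u y) + p (x + y) * cnj (u y - p y)" by (simp add: algebra_simps)
    also have "cmod \<dots> \<le> cmod (u (x + y) - p (x + y)) * cmod (u y) + cmod (p (x + y)) * cmod (u y - p y)"
      by (rule norm_triangle_le) (simp add: norm_mult del: complex_cnj_diff)
    also have "\<dots> \<le> e * C + C * e"
      using C e by (intro add_mono mult_mono) (auto intro: order_trans[OF norm_ge_zero])
    finally show "cmod (u (x + y) * cnj (u y) - p (x + y) * cnj (p y)) \<le> 2 * C * e" by simp
  qed
  finally show ?thesis .
qed

text \<open>
  Positivity on characters is positivity on autocorrelations: for a trigonometric polynomial
  \<open>\<Sum> c\<^sub>\<gamma> \<gamma>\<close> the autocorrelation is \<open>\<Sum> \<bar>c\<^sub>\<gamma>\<bar>\<^sup>2 \<gamma>\<close>, and trigonometric polynomials are dense.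
\<close>

lemma functional_autocorr_nonneg:
  assumes L: "bounded_functional L" and pos: "\<And>\<gamma>. \<gamma> \<in> dual_group \<Longrightarrow> 0 \<le> L \<gamma>" and u: "cont u"
  shows "0 \<le> L (autocorr u)"
proof -
  obtain C where C: "C > 0" "\<And>x. cmod (u x) \<le> C" using cont_bounded[OF u] by metis
  obtain D where D: "D > 0" "\<And>f B. cont f \<Longrightarrow> (\<And>x. cmod (f x) \<le> B) \<Longrightarrow> cmod (L f) \<le> D * B"
    using bounded_functional_bound[OF L] by metis
  have "\<exists>p\<in>trig. \<forall>x. cmod (u x - p x) < 1 / real (Suc n)" for n
  proof -
    have "0 < 1 / real (Suc n)" by simp
    then show ?thesis using trig_dense[OF u] by blast
  qed
  then obtain p where p: "\<And>n. p n \<in> trig" "\<And>n x. cmod (u x - p n x) < 1 / real (Suc n)" by metis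
  have pos': "0 \<le> L (autocorr (p n))" for n
  proof -
    obtain F c where F: "finite F" "F \<subseteq> dual_group" "p n = (\<lambda>x. \<Sum>\<gamma>\<in>F. c \<gamma> * \<gamma> x)"
      by (rule trig_representation[OF p(1)[of n]])
    have "L (autocorr (p n)) = (\<Sum>\<gamma>\<in>F. of_real ((cmod (c \<gamma>))\<^sup>2) * L \<gamma>)"
      unfolding F(3) autocorr_trig[OF F(1,2)]
      using F(2) dual_groupD(1) by (intro bounded_functional_sum[OF L F(1)]) auto
    also have "0 \<le> \<dots>"
    proof (rule sum_nonneg)
      fix \<gamma> assume "\<gamma> \<in> F"
      then have "0 \<le> L \<gamma>" using pos F(2) by auto
      then show "0 \<le> of_real ((cmod (c \<gamma>))\<^sup>2) * L \<gamma>"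
        unfolding less_eq_complex_def by (simp del: of_real_power)
    qed
    finally show ?thesis .
  qed
  have lim: "(\<lambda>n. L (autocorr (p n))) \<longlonglongrightarrow> L (autocorr u)"
  proof -
    have bnd: "cmod (L (autocorr (p n)) - L (autocorr u)) \<le> (D * (2 * (C + 1))) * (1 / real (Suc n))" for n
    proof -
      have b: "cmod (p n x) \<le> C + 1" for x
      proof -
        have "cmod (p n x) \<le> cmod (u x) + cmod (u x - p n x)"
          by (metis norm_minus_commute norm_triangle_sub)
        also have "\<dots> \<le> C + 1 / real (Suc n)" using C(2)[of x] p(2)[of x n] by linarith
        also have "\<dots> \<le> C + 1" by simp
        finally show ?thesis .
      qed
      have "cmod (L (\<lambda>x. autocorr (p n) x - autocorr u x)) \<le> D * (2 * (C + 1) * (1 / real (Suc n)))"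
      proof (rule D(2))
        show "cont (\<lambda>x. autocorr (p n) x - autocorr u x)"
          by (intro continuous_intros cont_autocorr u cont_trig p)
        show "cmod (autocorr (p n) x - autocorr u x) \<le> 2 * (C + 1) * (1 / real (Suc n))" for x
        proof (rule autocorr_diff_bound[OF cont_trig[OF p(1)] u b])
          show "cmod (u y) \<le> C + 1" for y using C(2)[of y] by simp
          show "cmod (p n y - u y) \<le> 1 / real (Suc n)" for y
            using p(2)[of y n] by (simp add: norm_minus_commute)
        qed
      qed
      also have "L (\<lambda>x. autocorr (p n) x - autocorr u x) = L (autocorr (p n)) - L (autocorr u)"
        by (intro bounded_functionalD[OF L] cont_autocorr u cont_trig p)
      finally show ?thesis by simp
    qed
    have limz: "(\<lambda>n. (D * (2 * (C + 1))) * (1 / real (Suc n))) \<longlonglongrightarrow> (D * (2 * (C + 1))) * 0"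
      by (intro tendsto_mult tendsto_const LIMSEQ_Suc[OF lim_const_over_n])
    have "(\<lambda>n. L (autocorr (p n)) - L (autocorr u)) \<longlonglongrightarrow> 0"
      by (rule Lim_null_comparison[OF always_eventually[OF allI[OF bnd]] limz[unfolded mult_zero_right]])
    then show ?thesis by (simp add: LIM_zero_iff)
  qed
  have "0 \<le> Re (L (autocorr u))"
    using pos' by (intro LIMSEQ_le_const[OF tendsto_Re[OF lim]]) (auto simp: less_eq_complex_def)
  moreover have "Im (L (autocorr u)) = 0"
  proof -
    have "(\<lambda>n. Im (L (autocorr (p n)))) \<longlonglongrightarrow> Im (L (autocorr u))" by (rule tendsto_Im[OF lim])
    moreover have "Im (L (autocorr (p n))) = 0" for n using pos'[of n] by (simp add: less_eq_complex_def)
    ultimately show ?thesis by (simp add: LIMSEQ_const_iff)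
  qed
  ultimately show ?thesis by (simp add: less_eq_complex_def)
qed

text \<open>
  The series converges uniformly, by the Weierstrass test, and bounded functionals respect uniform
  limits.
\<close>

lemma fourier_series:
  assumes f: "f summable_on A" "\<And>\<gamma>. \<gamma> \<in> A \<Longrightarrow> 0 \<le> f \<gamma>" and A: "A \<subseteq> dual_group"
  defines "\<Phi> \<equiv> \<lambda>x. \<Sum>\<^sub>\<infinity>\<gamma>\<in>A. complex_of_real (f \<gamma>) * \<gamma> x"
  shows "cont \<Phi>"
    and "bounded_functional L \<Longrightarrow> ((\<lambda>\<gamma>. complex_of_real (f \<gamma>) * L \<gamma>) has_sum L \<Phi>) A"
proof -
  have ul: "uniform_limit UNIV (\<lambda>F x. \<Sum>\<gamma>\<in>F. complex_of_real (f \<gamma>) * \<gamma> x) \<Phi> (finite_subsets_at_top A)"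
    unfolding \<Phi>_def
  proof (rule Weierstrass_m_test_general[OF _ f(1)])
    fix \<gamma> x assume "\<gamma> \<in> A"
    then show "cmod (complex_of_real (f \<gamma>) * \<gamma> x) \<le> f \<gamma>"
      using f(2) A dual_groupD(2)[of \<gamma> x] by (auto simp: norm_mult)
  qed
  have partial: "cont (\<lambda>x. \<Sum>\<gamma>\<in>F. complex_of_real (f \<gamma>) * \<gamma> x)" if "F \<subseteq> A" for F
    using that A by (intro continuous_intros dual_groupD(1)) auto
  show c: "cont \<Phi>"
  proof (rule uniform_limit_theorem[OF _ ul])
    show "\<forall>\<^sub>F F in finite_subsets_at_top A. cont (\<lambda>x. \<Sum>\<gamma>\<in>F. complex_of_real (f \<gamma>) * \<gamma> x)"
      by (intro eventually_finite_subsets_at_top_weakI partial)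
  qed simp
  assume L: "bounded_functional L"
  obtain D where D: "D > 0" "\<And>f B. cont f \<Longrightarrow> (\<And>x. cmod (f x) \<le> B) \<Longrightarrow> cmod (L f) \<le> D * B"
    using bounded_functional_bound[OF L] by metis
  show "((\<lambda>\<gamma>. complex_of_real (f \<gamma>) * L \<gamma>) has_sum L \<Phi>) A"
    unfolding has_sum_def
  proof (rule tendstoI)
    fix e :: real assume e: "e > 0"
    have ev: "\<forall>\<^sub>F F in finite_subsets_at_top A. finite F \<and> F \<subseteq> A"
      by (intro eventually_finite_subsets_at_top_weakI) auto
    have "\<forall>\<^sub>F F in finite_subsets_at_top A. \<forall>x\<in>UNIV. dist (\<Sum>\<gamma>\<in>F. complex_of_real (f \<gamma>) * \<gamma> x) (\<Phi> x) < e / (2 * D)"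
      using e D by (intro uniform_limitD[OF ul]) auto
    then show "\<forall>\<^sub>F F in finite_subsets_at_top A. dist (\<Sum>\<gamma>\<in>F. complex_of_real (f \<gamma>) * L \<gamma>) (L \<Phi>) < e"
      using ev
    proof eventually_elim
      case (elim F)
      have "cmod (L (\<lambda>x. (\<Sum>\<gamma>\<in>F. complex_of_real (f \<gamma>) * \<gamma> x) - \<Phi> x)) \<le> D * (e / (2 * D))"
        using elim c by (intro D continuous_intros partial) (auto simp: dist_norm less_imp_le)
      also have "L (\<lambda>x. (\<Sum>\<gamma>\<in>F. complex_of_real (f \<gamma>) * \<gamma> x) - \<Phi> x)
         = L (\<lambda>x. \<Sum>\<gamma>\<in>F. complex_of_real (f \<gamma>) * \<gamma> x) - L \<Phi>"
        using elim by (intro bounded_functionalD[OF L] c partial) auto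
      also have "L (\<lambda>x. \<Sum>\<gamma>\<in>F. complex_of_real (f \<gamma>) * \<gamma> x) = (\<Sum>\<gamma>\<in>F. complex_of_real (f \<gamma>) * L \<gamma>)"
      proof (rule bounded_functional_sum[OF L])
        show "finite F" using elim by blast
        show "cont \<gamma>" if "\<gamma> \<in> F" for \<gamma> using elim A that dual_groupD(1) by blast
      qed
      finally show ?case using e D by (simp add: dist_norm)
    qed
  qed
qed

section \<open>Continuous positive definite functions\<close>

lemma autocorr_bump:
  assumes N: "open N" "0 \<in> N"
  obtains w k :: "'a \<Rightarrow> real" where "cont w" "cont k" "\<And>x. autocorr (\<lambda>x. of_real (w x)) x = of_real (k x)"
    "\<And>x. 0 \<le> k x" "k 0 > 0" "\<And>x. x \<notin> N \<Longrightarrow> k x = 0"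
proof -
  obtain V where V: "open V" "0 \<in> V" "\<And>x y. x \<in> V \<Longrightarrow> y \<in> V \<Longrightarrow> x - y \<in> N"
    using open_neighbourhood_diff[OF N] by metis
  have "closed {0::'a}" "closed (- V)" "{0} \<inter> - V = {}" using V by auto
  then obtain w :: "'a \<Rightarrow> real" where w: "cont w" "\<And>x. 0 \<le> w x" "w 0 = 1" "\<And>x. x \<in> - V \<Longrightarrow> w x = 0"
    using compact_Urysohn[OF compact_group, of "{0}" "- V"] by (metis insertI1)
  define k where "k x = (LINT y|haar. w (x + y) * w y)" for x
  have a: "autocorr (\<lambda>x. of_real (w x)) x = of_real (k x)" for x
    by (simp add: autocorr_def k_def flip: of_real_mult)
  have "cont (\<lambda>x. Re (autocorr (\<lambda>x. of_real (w x)) x))"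
    by (intro continuous_intros cont_autocorr w)
  then have "cont k" by (simp add: a)
  moreover have "0 \<le> k x" for x unfolding k_def using w(2) by (intro integral_nonneg_AE) auto
  moreover have "k 0 > 0" unfolding k_def
    using w by (intro haar_integral_pos[of _ 0]) (auto intro!: continuous_intros)
  moreover have "k x = 0" if "x \<notin> N" for x
  proof -
    have "w (x + y) * w y = 0" for y using V(3)[of "x + y" y] w(4) that by auto
    then have "(\<lambda>y. w (x + y) * w y) = (\<lambda>_. 0)" by (rule ext)
    then show ?thesis unfolding k_def by (simp only: integral_zero)
  qed
  ultimately show ?thesis using a w(1) that by blast
qed

text \<open>
  If \<open>Re (\<psi> 0)\<close> were negative, it would be so on a neighbourhood of \<open>0\<close>, and the integral of \<open>\<psi>\<close>
  against an autocorrelation supported there would have negative real part, although integration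
  against \<open>\<psi>\<close> is nonnegative on characters.
\<close>

lemma positive_definite_at_0:
  assumes \<psi>: "cont \<psi>" and pos: "\<And>\<gamma>. \<gamma> \<in> dual_group \<Longrightarrow> 0 \<le> coeff \<psi> \<gamma>"
  shows "0 \<le> Re (\<psi> 0)"
proof (rule ccontr)
  assume neg: "\<not> 0 \<le> Re (\<psi> 0)"
  define N where "N = {x. Re (\<psi> x) < 0}"
  have N: "open N" "0 \<in> N" unfolding N_def using neg by (auto intro!: open_Collect_less continuous_intros \<psi>)
  obtain w k :: "'a \<Rightarrow> real" where w: "cont w" "cont k" "\<And>x. autocorr (\<lambda>x. of_real (w x)) x = of_real (k x)"
    "\<And>x. 0 \<le> k x" "k 0 > 0" "\<And>x. x \<notin> N \<Longrightarrow> k x = 0"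
    using autocorr_bump[OF N] by metis
  have "0 \<le> (LINT x|haar. autocorr (\<lambda>x. of_real (w x)) x * \<psi> x)"
  proof (rule functional_autocorr_nonneg[OF bounded_functional_weight[OF \<psi>]])
    show "0 \<le> (LINT x|haar. \<gamma> x * \<psi> x)" if "\<gamma> \<in> dual_group" for \<gamma>
      using pos[OF cnj_dual_group[OF that]] by (simp add: mult.commute)
    show "cont (\<lambda>x. complex_of_real (w x))" using w by (intro continuous_intros)
  qed
  then have "0 \<le> Re (LINT x|haar. of_real (k x) * \<psi> x)" by (simp add: w(3) less_eq_complex_def)
  also have "\<dots> = (LINT x|haar. k x * Re (\<psi> x))"
  proof -
    have "integrable haar (\<lambda>x. of_real (k x) * \<psi> x)" by (intro haar_integrable continuous_intros w \<psi>)
    then have "Re (LINT x|haar. of_real (k x) * \<psi> x) = (LINT x|haar. Re (of_real (k x) * \<psi> x))"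
      by (rule integral_Re[symmetric])
    then show ?thesis by simp
  qed
  finally have ge: "0 \<le> (LINT x|haar. k x * Re (\<psi> x))" .
  have "0 < (LINT x|haar. - (k x * Re (\<psi> x)))"
  proof (rule haar_integral_pos[of _ 0])
    show "cont (\<lambda>x. - (k x * Re (\<psi> x)))" by (intro continuous_intros w \<psi>)
    show "0 \<le> - (k x * Re (\<psi> x))" for x
      using w(4)[of x] w(6)[of x] by (cases "x \<in> N") (auto simp: N_def mult_nonneg_nonpos)
    show "0 < - (k 0 * Re (\<psi> 0))" using w(5) neg by (simp add: mult_pos_neg)
  qed
  with ge show False by simp
qed

text \<open>
  All coefficients of the functions \<open>c \<psi>(\<cdot> + a)\<close> vanish as well, so their real parts at \<open>0\<close> are
  nonnegative for \<open>c = 1, - 1, \<i>, - \<i>\<close>.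
\<close>

lemma fourier_uniqueness:
  assumes \<psi>: "cont \<psi>" and zero: "\<And>\<gamma>. \<gamma> \<in> dual_group \<Longrightarrow> coeff \<psi> \<gamma> = 0"
  shows "\<psi> a = 0"
proof -
  have sh: "(LINT x|haar. \<psi> (x + a) * cnj (\<gamma> x)) = 0" if \<gamma>: "\<gamma> \<in> dual_group" for \<gamma>
  proof -
    have "\<psi> (x + a) * cnj (\<gamma> x) = \<gamma> a * (\<psi> (x + a) * cnj (\<gamma> (x + a)))" for x
    proof -
      have "\<gamma> a * (\<psi> (x + a) * cnj (\<gamma> (x + a))) = \<psi> (x + a) * cnj (\<gamma> x) * (\<gamma> a * cnj (\<gamma> a))"
        by (simp add: dual_groupD(3)[OF \<gamma>])
      then show ?thesis by (simp only: dual_groupD(7)[OF \<gamma>] mult_1_right)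
    qed
    then have "(LINT x|haar. \<psi> (x + a) * cnj (\<gamma> x)) = (LINT x|haar. \<gamma> a * (\<psi> (x + a) * cnj (\<gamma> (x + a))))"
      by (intro Bochner_Integration.integral_cong refl)
    also have "\<dots> = \<gamma> a * (LINT x|haar. \<psi> (x + a) * cnj (\<gamma> (x + a)))" by simp
    also have "(LINT x|haar. \<psi> (x + a) * cnj (\<gamma> (x + a))) = coeff \<psi> \<gamma>"
      by (rule haar_shift) (intro continuous_intros \<psi> dual_groupD(1)[OF \<gamma>])
    finally show ?thesis using zero[OF \<gamma>] by simp
  qed
  have nn: "0 \<le> Re (c * \<psi> (0 + a))" for c
  proof (rule positive_definite_at_0)
    show "cont (\<lambda>x. c * \<psi> (x + a))" by (intro continuous_intros \<psi> cont_shift)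
    show "0 \<le> (LINT x|haar. c * \<psi> (x + a) * cnj (\<gamma> x))" if "\<gamma> \<in> dual_group" for \<gamma>
      using sh[OF that] by (simp add: mult.assoc)
  qed
  have "Re (\<psi> a) = 0" using nn[of 1] nn[of "-1"] by simp
  moreover have "Im (\<psi> a) = 0" using nn[of \<i>] nn[of "-\<i>"] by simp
  ultimately show ?thesis by (simp add: complex_eq_iff)
qed

text \<open>
  Subtracting a finite part of the Fourier series leaves a function with nonnegative coefficients,
  so its value at \<open>0\<close> is nonnegative: the partial sums of the coefficients are bounded by
  \<open>Re (\<phi> 0)\<close>. The sum of the series then has the coefficients of \<open>\<phi>\<close>.
\<close>

lemma fourier_inversion:
  assumes \<phi>: "cont \<phi>" and pos: "\<And>\<gamma>. \<gamma> \<in> dual_group \<Longrightarrow> 0 \<le> coeff \<phi> \<gamma>"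
  defines "f \<equiv> \<lambda>\<gamma>. Re (coeff \<phi> \<gamma>)"
  shows "f summable_on dual_group" and "\<phi> x = (\<Sum>\<^sub>\<infinity>\<gamma>\<in>dual_group. complex_of_real (f \<gamma>) * \<gamma> x)"
proof -
  have f: "0 \<le> f \<gamma>" "coeff \<phi> \<gamma> = of_real (f \<gamma>)" if "\<gamma> \<in> dual_group" for \<gamma>
    using pos[OF that] by (auto simp: f_def less_eq_complex_def complex_eq_iff)
  have coeff: "bounded_functional (\<lambda>g. coeff g \<gamma>)" if "\<gamma> \<in> dual_group" for \<gamma>
    by (intro bounded_functional_weight continuous_intros dual_groupD(1) that)
  have "sum f F \<le> Re (\<phi> 0)" if F: "finite F" "F \<subseteq> dual_group" for F
  proof -
    define p where "p x = (\<Sum>\<gamma>\<in>F. complex_of_real (f \<gamma>) * \<gamma> x)" for x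
    have p: "cont p" unfolding p_def using F dual_groupD(1) by (intro continuous_intros) auto
    have "0 \<le> Re (\<phi> 0 - p 0)"
    proof (rule positive_definite_at_0)
      show "cont (\<lambda>x. \<phi> x - p x)" by (intro continuous_intros \<phi> p)
      fix \<delta> :: "'a \<Rightarrow> complex" assume \<delta>: "\<delta> \<in> dual_group"
      have "(LINT x|haar. (\<phi> x - p x) * cnj (\<delta> x)) = coeff \<phi> \<delta> - coeff p \<delta>"
        by (rule bounded_functionalD(3)[OF coeff[OF \<delta>] \<phi> p])
      also have "coeff p \<delta> = (\<Sum>\<gamma>\<in>F. of_real (f \<gamma>) * coeff \<gamma> \<delta>)"
        unfolding p_def using F dual_groupD(1) by (intro bounded_functional_sum[OF coeff[OF \<delta>]]) auto
      also have "\<dots> = (\<Sum>\<gamma>\<in>F. if \<gamma> = \<delta> then of_real (f \<gamma>) else 0)"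
        using F(2) \<delta> by (intro sum.cong refl) (auto simp: character_orthogonality subset_iff)
      also have "\<dots> = (if \<delta> \<in> F then of_real (f \<delta>) else 0)" using F(1) by (simp add: sum.delta')
      finally show "0 \<le> (LINT x|haar. (\<phi> x - p x) * cnj (\<delta> x))"
        using f[OF \<delta>] pos[OF \<delta>] by auto
    qed
    moreover have "Re (p 0) = sum f F"
      using F(2) by (auto simp: p_def dual_groupD(4) subset_iff intro!: sum.cong)
    ultimately show ?thesis by simp
  qed
  then have "bdd_above (sum f ` {F. F \<subseteq> dual_group \<and> finite F})" by (intro bdd_aboveI2) auto
  then show sm: "f summable_on dual_group" by (intro nonneg_bdd_above_summable_on f)
  define \<Phi> where "\<Phi> x = (\<Sum>\<^sub>\<infinity>\<gamma>\<in>dual_group. complex_of_real (f \<gamma>) * \<gamma> x)" for x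
  have \<Phi>: "cont \<Phi>" unfolding \<Phi>_def by (rule fourier_series(1)[OF sm f(1) order_refl])
  have "(LINT x|haar. (\<phi> x - \<Phi> x) * cnj (\<delta> x)) = 0" if \<delta>: "\<delta> \<in> dual_group" for \<delta>
  proof -
    have "((\<lambda>\<gamma>. complex_of_real (f \<gamma>) * coeff \<gamma> \<delta>) has_sum coeff \<Phi> \<delta>) dual_group"
      unfolding \<Phi>_def by (rule fourier_series(2)[OF sm f(1) order_refl coeff[OF \<delta>]])
    moreover have "((\<lambda>\<gamma>. complex_of_real (f \<gamma>) * coeff \<gamma> \<delta>) has_sum of_real (f \<delta>)) dual_group"
    proof -
      have "((\<lambda>\<gamma>. complex_of_real (f \<gamma>) * coeff \<gamma> \<delta>) has_sum of_real (f \<delta>)) {\<delta>}"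
        using \<delta> by (intro has_sum_finiteI) (auto simp: character_orthogonality)
      then show ?thesis
        using \<delta> by (subst has_sum_cong_neutral[where T="{\<delta>}"]) (auto simp: character_orthogonality)
    qed
    ultimately have "coeff \<Phi> \<delta> = of_real (f \<delta>)" by (rule has_sum_unique)
    then show ?thesis
      using bounded_functionalD(3)[OF coeff[OF \<delta>] \<phi> \<Phi>] f(2)[OF \<delta>] by simp
  qed
  then have "\<phi> x - \<Phi> x = 0"
    using fourier_uniqueness[of "\<lambda>x. \<phi> x - \<Phi> x" x] \<phi> \<Phi> by (simp add: continuous_intros)
  then show "\<phi> x = (\<Sum>\<^sub>\<infinity>\<gamma>\<in>dual_group. complex_of_real (f \<gamma>) * \<gamma> x)" by (simp add: \<Phi>_def)
qed

end

section \<open>Reciprocals of extrema\<close>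

lemma ereal_reciprocal: "0 \<le> s \<Longrightarrow> 1 / (1 + ereal s) = ereal (1 / (1 + s))"
  by (simp add: one_ereal_def)

text \<open>
  The decreasing bijection \<open>s \<mapsto> 1 / (1 + s)\<close> of \<open>[0, \<infinity>)\<close> onto \<open>(0, 1]\<close> exchanges suprema and
  infima.
\<close>

lemma SUP_reciprocal:
  fixes S :: "real set"
  assumes ne: "S \<noteq> {}" and nn: "\<And>s. s \<in> S \<Longrightarrow> 0 \<le> s"
  shows "(SUP s\<in>S. ereal (1 / (1 + s))) = 1 / (1 + (INF s\<in>S. ereal s))"
proof -
  obtain s0 where s0: "s0 \<in> S" using ne by blast
  have "(INF s\<in>S. ereal s) \<ge> 0" using nn by (intro INF_greatest) simp
  moreover have "(INF s\<in>S. ereal s) \<le> ereal s0" using s0 by (rule INF_lower)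
  ultimately obtain r where r: "(INF s\<in>S. ereal s) = ereal r" "0 \<le> r"
    by (cases "INF s\<in>S. ereal s") auto
  define D where "D = (SUP s\<in>S. ereal (1 / (1 + s)))"
  have le: "r \<le> s" if "s \<in> S" for s
    using INF_lower[OF that, of ereal] r by simp
  have "1 / (1 + s) \<le> 1 / (1 + r)" if "s \<in> S" for s
    using le[OF that] r(2) by (intro divide_left_mono mult_pos_pos) auto
  then have D1: "D \<le> ereal (1 / (1 + r))"
    unfolding D_def by (intro SUP_least) (simp only: ereal_less_eq)
  have D2: "ereal (1 / (1 + s)) \<le> D" if "s \<in> S" for s
    unfolding D_def using that by (rule SUP_upper)
  obtain d where d: "D = ereal d" using D1 D2[OF s0] by (cases D) auto
  have "0 < 1 / (1 + s0)" using nn[OF s0] by simp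
  also have "\<dots> \<le> d" using D2[OF s0] d by simp
  finally have dpos: "d > 0" .
  have "1 / d - 1 \<le> s" if "s \<in> S" for s
  proof -
    have "1 / (1 + s) \<le> d" using D2[OF that] d by simp
    then show ?thesis using nn[OF that] dpos by (simp add: field_simps)
  qed
  then have "ereal (1 / d - 1) \<le> (INF s\<in>S. ereal s)" by (intro INF_greatest) simp
  then have "1 / d - 1 \<le> r" using r by simp
  then have "1 / (1 + r) \<le> d" using dpos r(2) by (simp add: field_simps)
  then have "D = ereal (1 / (1 + r))" using D1 d by simp
  then show ?thesis unfolding r(1) ereal_reciprocal[OF r(2)] by (simp only: D_def)
qed

text \<open>
  The supremum may be infinite; it then corresponds to the infimum \<open>0\<close>.
\<close>

lemma INF_reciprocal:
  fixes S :: "real set"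
  assumes ne: "S \<noteq> {}" and nn: "\<And>s. s \<in> S \<Longrightarrow> 0 \<le> s"
  shows "(INF s\<in>S. ereal (1 / (1 + s))) = 1 / (1 + (SUP s\<in>S. ereal s))"
proof -
  obtain s0 where s0: "s0 \<in> S" using ne by blast
  define D where "D = (INF s\<in>S. ereal (1 / (1 + s)))"
  have D0: "0 \<le> D" unfolding D_def using nn by (intro INF_greatest) simp
  have D2: "D \<le> ereal (1 / (1 + s))" if "s \<in> S" for s
    unfolding D_def using that by (rule INF_lower)
  obtain d where d: "D = ereal d" "0 \<le> d" using D0 D2[OF s0] by (cases D) auto
  have up: "s \<le> 1 / d - 1" if "s \<in> S" "d > 0" for s
  proof -
    have "d \<le> 1 / (1 + s)" using D2[OF that(1)] d by simp
    then show ?thesis using nn[OF that(1)] that(2) by (simp add: field_simps)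
  qed
  have ge: "ereal s0 \<le> (SUP s\<in>S. ereal s)" using s0 by (rule SUP_upper)
  show ?thesis
  proof (cases "SUP s\<in>S. ereal s")
    case (real r)
    have r: "0 \<le> r" using ge nn[OF s0] real by simp
    have le: "s \<le> r" if "s \<in> S" for s using SUP_upper[OF that, of ereal] real by simp
    have "1 / (1 + r) \<le> 1 / (1 + s)" if "s \<in> S" for s
      using le[OF that] nn[OF that] by (intro divide_left_mono mult_pos_pos) auto
    then have "ereal (1 / (1 + r)) \<le> D"
      unfolding D_def by (intro INF_greatest) (simp only: ereal_less_eq)
    then have 1: "1 / (1 + r) \<le> d" using d by simp
    have "0 < 1 / (1 + r)" using r by simp
    then have dpos: "d > 0" using 1 by linarith
    have "(SUP s\<in>S. ereal s) \<le> ereal (1 / d - 1)" using up dpos by (intro SUP_least) simp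
    then have "r \<le> 1 / d - 1" using real by simp
    then have "d \<le> 1 / (1 + r)" using dpos r by (simp add: field_simps)
    then have "D = ereal (1 / (1 + r))" using 1 d by simp
    then show ?thesis unfolding real ereal_reciprocal[OF r] by (simp only: D_def)
  next
    case PInf
    have "d = 0"
    proof (rule ccontr)
      assume "d \<noteq> 0"
      then have "(SUP s\<in>S. ereal s) \<le> ereal (1 / d - 1)" using up d(2) by (intro SUP_least) simp
      then show False using PInf by simp
    qed
    then show ?thesis using PInf d by (simp add: D_def zero_ereal_def)
  next
    case MInf
    then show ?thesis using ge by simp
  qed
qed

section \<open>Measures carried by the closure of the complement\<close>

context compact_abelian_group
begin

text \<open>
  For regular measures this amounts to the support condition of \<^const>\<open>Mstar\<close>, in a form that is
  directly usable under integrals.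
\<close>

definition carried :: "'a set \<Rightarrow> 'a measure \<Rightarrow> bool" where
  "carried \<Omega> P \<longleftrightarrow> finite_borel P \<and> approximable P \<and> measure P (- closure (- \<Omega>)) = 0"

lemma carried_nonpos:
  assumes P: "carried \<Omega> P" and \<phi>: "\<phi> \<in> Qcone \<Omega>"
  shows "(LINT x|P. \<phi> x) \<le> 0"
proof -
  have fb: "finite_borel P" using P by (simp add: carried_def)
  interpret finite_measure P using fb by (rule finite_borelD)
  have c: "cont \<phi>" "\<And>x. x \<in> - \<Omega> \<Longrightarrow> \<phi> x \<le> 0" using \<phi> by (auto simp: Qcone_def)
  have "AE x in P. \<not> x \<in> - closure (- \<Omega>)"
    using P finite_borelD(2)[OF fb]
    by (intro AE_not_in) (auto simp: carried_def null_sets_def emeasure_eq_measure)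
  moreover have "\<phi> x \<le> 0" if "x \<in> closure (- \<Omega>)" for x
    using c that by (intro continuous_le_on_closure[of "- \<Omega>" \<phi> x 0]) (auto intro: continuous_on_subset)
  ultimately have "AE x in P. \<phi> x \<le> 0" by (auto elim: eventually_mono)
  then have "0 \<le> (LINT x|P. - \<phi> x)" by (intro integral_nonneg_AE) (auto elim: eventually_mono)
  then show ?thesis by simp
qed

lemma carried_regular:
  assumes P: "carried \<Omega> P" and eq: "\<And>B. B \<in> sets borel \<Longrightarrow> \<mu> B = c * measure P B"
  shows "\<mu> \<in> regular_signed_measures"
  using P eq by (intro regular_combination[of "{()}" "\<lambda>_. P" \<mu> "\<lambda>_. c"]) (auto simp: carried_def)

lemma carried_signed_integral:
  fixes f :: "'a \<Rightarrow> complex"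
  assumes P: "carried \<Omega> P" and eq: "\<And>B. B \<in> sets borel \<Longrightarrow> \<mu> B = c * measure P B" and f: "cont f"
  shows "signed_integral \<mu> f = of_real c * (LINT x|P. f x)"
proof -
  obtain C where C: "\<And>x. cmod (f x) \<le> C" using cont_bounded[OF f] by metis
  have "signed_borel_measure \<mu>" using carried_regular[OF P eq] by (simp add: regular_signed_measures_def)
  then show ?thesis
    using signed_integral_combination[of \<mu> "{()}" "\<lambda>_. P" "\<lambda>_. c" f C] P eq C cont_measurable[OF f]
    by (simp add: carried_def)
qed

lemma carried_signed_integral_real:
  fixes f :: "'a \<Rightarrow> real"
  assumes P: "carried \<Omega> P" and eq: "\<And>B. B \<in> sets borel \<Longrightarrow> \<mu> B = c * measure P B" and f: "cont f"
  shows "signed_integral \<mu> f = c * (LINT x|P. f x)"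
proof -
  obtain C where C: "\<And>x. \<bar>f x\<bar> \<le> C" using cont_bounded[OF f] by (metis real_norm_def)
  have "signed_borel_measure \<mu>" using carried_regular[OF P eq] by (simp add: regular_signed_measures_def)
  then show ?thesis
    using signed_integral_combination_real[of \<mu> "{()}" "\<lambda>_. P" "\<lambda>_. c" f C] P eq C cont_measurable[OF f]
    by (simp add: carried_def)
qed

lemma Mstar_if_carried:
  assumes P: "carried \<Omega> P" and c: "0 \<le> c" and eq: "\<And>B. B \<in> sets borel \<Longrightarrow> \<nu> B = c * measure P B"
  shows "\<nu> \<in> Mstar \<Omega>"
proof -
  have reg: "\<nu> \<in> regular_signed_measures" by (rule carried_regular[OF P eq])
  have nn: "0 \<le> \<nu> B" if "B \<in> sets borel" for B using eq[OF that] c by simp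
  have s: "signed_borel_measure \<nu>" using reg by (rule regular_signed_measuresD)
  interpret tv: finite_measure "total_variation \<nu>"
    using finite_borel_total_variation[OF s] by (rule finite_borelD)
  have "signed_support \<nu> \<subseteq> closure (- \<Omega>)"
  proof
    fix x assume x: "x \<in> signed_support \<nu>"
    show "x \<in> closure (- \<Omega>)"
    proof (rule ccontr)
      assume "x \<notin> closure (- \<Omega>)"
      then have "open (- closure (- \<Omega>)) \<and> x \<in> - closure (- \<Omega>)" by auto
      then have "emeasure (total_variation \<nu>) (- closure (- \<Omega>)) > 0"
        using x unfolding signed_support_def by blast
      moreover have "measure (total_variation \<nu>) (- closure (- \<Omega>)) = 0"
        using nonneg_signed_measure(3)[OF s nn, of "- closure (- \<Omega>)"] eq[of "- closure (- \<Omega>)"] P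
        by (simp add: carried_def)
      ultimately show False by (simp add: tv.emeasure_eq_measure)
    qed
  qed
  then show ?thesis using reg nn by (simp add: Mstar_def)
qed

text \<open>
  The support need not be described by countably many open sets, so its complement is not null by
  countable additivity alone. Every compact subset of the complement, however, is covered by
  finitely many open null sets, and regularity does the rest.
\<close>

lemma carried_if_Mstar:
  assumes \<nu>: "\<nu> \<in> Mstar \<Omega>"
  obtains P where "carried \<Omega> P" "\<And>B. B \<in> sets borel \<Longrightarrow> \<nu> B = measure P B"
proof -
  define K where "K = closure (- \<Omega>)"
  have reg: "\<nu> \<in> regular_signed_measures" and nn: "\<And>B. B \<in> sets borel \<Longrightarrow> 0 \<le> \<nu> B"
    and supp: "signed_support \<nu> \<subseteq> K" using \<nu> by (auto simp: Mstar_def K_def)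
  define T where "T = total_variation \<nu>"
  have s: "signed_borel_measure \<nu>" and app: "approximable T"
    using regular_signed_measuresD[OF reg] by (auto simp: T_def)
  have T: "measure T B = \<nu> B" if "B \<in> sets borel" for B
    unfolding T_def by (rule nonneg_signed_measure[OF s nn that])
  have fb: "finite_borel T" unfolding T_def by (rule finite_borel_total_variation[OF s])
  interpret T: finite_measure T using fb by (rule finite_borelD)
  note [simp] = finite_borelD(2)[OF fb]
  have "measure T (- K) \<le> 0"
  proof (rule field_le_epsilon)
    fix e :: real assume e: "e > 0"
    have K: "- K \<in> sets borel" by (simp add: K_def)
    obtain C U where C: "compact C" "C \<subseteq> - K" "open U" "- K \<subseteq> U" "measure T (U - C) < e"
      using approximableE[OF app K e] by metis
    have Cb: "C \<in> sets borel" using compact_imp_closed[OF C(1)] by simp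
    have "\<exists>V. open V \<and> x \<in> V \<and> emeasure T V = 0" if "x \<in> C" for x
    proof -
      have "x \<notin> signed_support \<nu>" using supp C(2) that by blast
      then show ?thesis by (auto simp: signed_support_def T_def zero_less_iff_neq_zero)
    qed
    then obtain V where V: "\<And>x. x \<in> C \<Longrightarrow> open (V x) \<and> x \<in> V x \<and> emeasure T (V x) = 0" by metis
    then obtain X where X: "X \<subseteq> C" "finite X" "C \<subseteq> (\<Union>x\<in>X. V x)"
      using compactE_image[OF C(1), of C V] by (metis UN_iff subsetI)
    have "open (\<Union>x\<in>X. V x)" using X V by blast
    then have "emeasure T C \<le> emeasure T (\<Union>x\<in>X. V x)" using X(3) by (intro emeasure_mono) simp_all
    also have "\<dots> \<le> (\<Sum>x\<in>X. emeasure T (V x))"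
    proof (rule emeasure_subadditive_finite[OF X(2)])
      have "open (V x)" if "x \<in> X" for x using V X(1) that by blast
      then show "V ` X \<subseteq> sets T" by auto
    qed
    also have "\<dots> = 0" using X V by (intro sum.neutral) auto
    finally have "measure T C = 0" by (simp add: T.emeasure_eq_measure)
    moreover have "measure T (- K) \<le> measure T C + measure T (- K - C)"
      using C K Cb T.finite_measure_Diff[of "- K" C] by simp
    moreover have "measure T (- K - C) \<le> measure T (U - C)"
      using C K Cb by (intro T.finite_measure_mono) auto
    ultimately show "measure T (- K) \<le> 0 + e" using C(5) by linarith
  qed
  then have "measure T (- K) = 0" by (simp add: measure_le_0_iff)
  then have "carried \<Omega> T" using fb app by (simp add: carried_def K_def)
  then show ?thesis using T that by auto
qed

lemma Qcone_dual_if_carried: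
  assumes P: "carried \<Omega> P" and c: "0 \<le> c" and eq: "\<And>B. B \<in> sets borel \<Longrightarrow> \<mu> B = - c * measure P B"
  shows "\<mu> \<in> Qcone_dual \<Omega>"
proof -
  have "0 \<le> signed_integral \<mu> \<phi>" if "\<phi> \<in> Qcone \<Omega>" for \<phi>
    using carried_signed_integral_real[OF P eq, of \<phi>] carried_nonpos[OF P that] that c
    by (simp add: Qcone_def mult_nonneg_nonpos)
  then show ?thesis using carried_regular[OF P eq] by (simp add: Qcone_dual_def)
qed

text \<open>
  Nonpositive continuous functions belong to \<open>Qcone \<Omega>\<close>. Testing with \<open>- f\<close>, where \<open>f\<close> is an
  Urysohn function between a compact subset \<open>C\<close> and an open superset \<open>U\<close> of \<open>B\<close>, bounds the
  positive part of \<open>B\<close> by its negative part up to the total variation of \<open>U - C\<close>.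
\<close>

lemma Qcone_dual_nonpos:
  fixes \<Omega> B :: "'a set"
  assumes \<mu>: "\<mu> \<in> Qcone_dual \<Omega>" and B: "B \<in> sets borel"
  shows "\<mu> B \<le> 0"
proof -
  have reg: "\<mu> \<in> regular_signed_measures" and pos: "\<And>\<phi>. \<phi> \<in> Qcone \<Omega> \<Longrightarrow> 0 \<le> signed_integral \<mu> \<phi>"
    using \<mu> by (auto simp: Qcone_dual_def)
  have s: "signed_borel_measure \<mu>" and app: "approximable (total_variation \<mu>)"
    using regular_signed_measuresD[OF reg] by auto
  define p where "p = positive_part \<mu>"
  define n where "n = negative_part \<mu>"
  have fp: "finite_borel p" and fn: "finite_borel n"
    unfolding p_def n_def using finite_borel_positive_part[OF s] finite_borel_negative_part[OF s] by auto
  interpret p: finite_measure p using fp by (rule finite_borelD)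
  interpret n: finite_measure n using fn by (rule finite_borelD)
  interpret T: finite_measure "total_variation \<mu>"
    using finite_borel_total_variation[OF s] by (rule finite_borelD)
  note [simp] = finite_borelD(2)[OF fp] finite_borelD(2)[OF fn]
  have tv: "measure (total_variation \<mu>) B = measure p B + measure n B" if "B \<in> sets borel" for B
    unfolding p_def n_def by (rule measure_total_variation[OF s that])
  have jd: "\<mu> B = measure p B - measure n B" if "B \<in> sets borel" for B
    unfolding p_def n_def by (rule jordan_decomposition[OF s that])
  have "measure p B \<le> measure n B"
  proof (rule field_le_epsilon)
    fix e :: real assume e: "e > 0"
    obtain C U where C: "compact C" "C \<subseteq> B" "open U" "B \<subseteq> U" "measure (total_variation \<mu>) (U - C) < e"
      using approximableE[OF app B e] by metis
    have Cc: "closed C" using compact_imp_closed[OF C(1)] .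
    then have Cb: "C \<in> sets borel" "U \<in> sets borel" using C by auto
    have small: "measure p (U - C) + measure n (U - C) < e" using C tv[of "U - C"] Cb by simp
    have "closed (- U)" "C \<inter> - U = {}" using C by auto
    then obtain f :: "'a \<Rightarrow> real" where f: "cont f" "\<And>x. 0 \<le> f x" "\<And>x. f x \<le> 1"
      "\<And>x. x \<in> C \<Longrightarrow> f x = 1" "\<And>x. x \<in> - U \<Longrightarrow> f x = 0"
      using compact_Urysohn[OF compact_group Cc] by metis
    have "(\<lambda>x. - f x) \<in> Qcone \<Omega>" using f by (auto simp: Qcone_def intro!: continuous_intros)
    then have "0 \<le> signed_integral \<mu> (\<lambda>x. - f x)" by (rule pos)
    then have ineq: "(LINT x|p. f x) \<le> (LINT x|n. f x)" by (simp add: signed_integral_def p_def n_def)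
    have "measure p B \<le> measure p C + measure p (B - C)"
      using C Cb B p.finite_measure_Diff[of B C] by simp
    also have "measure p (B - C) \<le> measure p (U - C)" using C Cb B by (intro p.finite_measure_mono) auto
    also have "measure p C = (LINT x|p. indicator C x)" using Cb finite_borelD(3)[OF fp] by simp
    also have "\<dots> \<le> (LINT x|p. f x)"
    proof (rule integral_mono)
      show "integrable p (indicator C :: 'a \<Rightarrow> real)" using Cb by (auto simp: less_top[symmetric])
      show "integrable p f" by (rule cont_integrable[OF fp f(1)])
    qed (use f in \<open>auto simp: indicator_def\<close>)
    also note ineq
    also have "(LINT x|n. f x) \<le> (LINT x|n. indicator U x)"
    proof (rule integral_mono)
      show "integrable n (indicator U :: 'a \<Rightarrow> real)" using Cb by (auto simp: less_top[symmetric])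
      show "integrable n f" by (rule cont_integrable[OF fn f(1)])
    qed (use f in \<open>auto simp: indicator_def\<close>)
    also have "\<dots> = measure n U" using Cb finite_borelD(3)[OF fn] by simp
    also have "measure n U \<le> measure n B + measure n (U - C)"
    proof -
      have "measure n U \<le> measure n (B \<union> (U - C))"
        using C Cb B by (intro n.finite_measure_mono) auto
      also have "\<dots> \<le> measure n B + measure n (U - C)"
        using Cb B by (intro measure_subadditive) (auto simp: less_top[symmetric])
      finally show ?thesis .
    qed
    finally show "measure p B \<le> measure n B + e" using small by simp
  qed
  then show ?thesis using jd[OF B] by simp
qed

text \<open>
  A continuous function that vanishes on the closure of \<open>- \<Omega>\<close> lies in \<open>Qcone \<Omega>\<close> together with its
  negative, so its integral is \<open>0\<close>. Choosing it nonnegative and equal to \<open>1\<close> at a given point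
  outside the closure shows that this point has a null neighbourhood.
\<close>

lemma carried_if_Qcone_dual:
  assumes \<mu>: "\<mu> \<in> Qcone_dual \<Omega>"
  obtains P where "carried \<Omega> P" "\<And>B. B \<in> sets borel \<Longrightarrow> \<mu> B = - measure P B"
proof -
  define K where "K = closure (- \<Omega>)"
  have reg: "\<mu> \<in> regular_signed_measures" and pos: "\<And>\<phi>. \<phi> \<in> Qcone \<Omega> \<Longrightarrow> 0 \<le> signed_integral \<mu> \<phi>"
    using \<mu> by (auto simp: Qcone_dual_def)
  have s: "signed_borel_measure \<mu>" and app: "approximable (total_variation \<mu>)"
    using regular_signed_measuresD[OF reg] by auto
  define p where "p = positive_part \<mu>"
  define n where "n = negative_part \<mu>"
  have fp: "finite_borel p" and fn: "finite_borel n"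
    unfolding p_def n_def using finite_borel_positive_part[OF s] finite_borel_negative_part[OF s] by auto
  have tv: "measure (total_variation \<mu>) B = measure p B + measure n B" if "B \<in> sets borel" for B
    unfolding p_def n_def by (rule measure_total_variation[OF s that])
  have jd: "\<mu> B = measure p B - measure n B" if "B \<in> sets borel" for B
    unfolding p_def n_def by (rule jordan_decomposition[OF s that])
  have le: "\<mu> B \<le> 0" if "B \<in> sets borel" for B by (rule Qcone_dual_nonpos[OF \<mu> that])
  define \<nu> where "\<nu> B = - \<mu> B" for B
  have s\<nu>: "signed_borel_measure \<nu>" unfolding \<nu>_def by (rule signed_borel_uminus[OF s])
  have tvfb: "finite_borel (total_variation \<mu>)" by (rule finite_borel_total_variation[OF s])
  have appn: "approximable p" "approximable n"
    using tvfb app tv measure_nonneg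
    by (auto intro!: approximable_dominated[of "{()}" "\<lambda>_. total_variation \<mu>" "\<lambda>_. 1"])
  have reg\<nu>: "\<nu> \<in> regular_signed_measures"
    using fp fn appn jd
    by (intro regular_combination[of UNIV "\<lambda>b. if b then p else n" \<nu> "\<lambda>b. if b then -1 else 1"])
       (auto simp: \<nu>_def UNIV_bool)
  have nn: "0 \<le> \<nu> B" if "B \<in> sets borel" for B using le[OF that] by (simp add: \<nu>_def)
  define T where "T = total_variation \<nu>"
  have T: "measure T B = \<nu> B" if "B \<in> sets borel" for B
    unfolding T_def by (rule nonneg_signed_measure[OF s\<nu> nn that])
  have fT: "finite_borel T" unfolding T_def by (rule finite_borel_total_variation[OF s\<nu>])
  interpret T': finite_measure T using fT by (rule finite_borelD)
  note [simp] = finite_borelD(2)[OF fT]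
  have "signed_support \<nu> \<subseteq> K"
  proof
    fix x assume x: "x \<in> signed_support \<nu>"
    show "x \<in> K"
    proof (rule ccontr)
      assume "x \<notin> K"
      then have "closed {x}" "closed K" "{x} \<inter> K = {}" by (auto simp: K_def)
      then obtain f :: "'a \<Rightarrow> real" where f: "cont f" "\<And>x. 0 \<le> f x" "\<And>x. f x \<le> 1" "f x = 1" "\<And>x. x \<in> K \<Longrightarrow> f x = 0"
        using compact_Urysohn[OF compact_group, of "{x}" K] by (metis insertI1)
      have "- \<Omega> \<subseteq> K" unfolding K_def by (rule closure_subset)
      then have "f \<in> Qcone \<Omega>" "(\<lambda>x. - f x) \<in> Qcone \<Omega>"
        using f by (auto simp: Qcone_def intro!: continuous_intros)
      from pos[OF this(1)] pos[OF this(2)] have zero: "signed_integral \<mu> f = 0" by (simp add: signed_integral_def)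
      have "signed_integral \<mu> f = (\<Sum>i\<in>{()}. - 1 * (LINT x|T. f x))"
        using f fT T by (intro signed_integral_combination_real[OF s _ _ _ cont_measurable[OF f(1)], where C=1])
          (auto simp: \<nu>_def)
      then have int: "(LINT x|T. f x) = 0" using zero by simp
      define U where "U = {y. 1/2 < f y}"
      have U: "open U" "x \<in> U" unfolding U_def using f
        by (auto intro!: open_Collect_less continuous_intros)
      have "1/2 * measure T U = (LINT x|T. 1/2 * indicator U x)" using U finite_borelD(3)[OF fT] by simp
      also have "\<dots> \<le> (LINT x|T. f x)"
      proof (rule integral_mono)
        show "integrable T (\<lambda>x. 1/2 * indicator U x :: real)"
          using U(1) by (intro integrable_mult_right) (auto simp: less_top[symmetric])
        show "integrable T f" by (rule cont_integrable[OF fT f(1)])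
      qed (use f in \<open>auto simp: indicator_def U_def\<close>)
      finally have "measure T U = 0" using int measure_nonneg[of T U] by simp
      then have "emeasure T U = 0" by (simp add: T'.emeasure_eq_measure)
      then show False using x U by (auto simp: signed_support_def T_def)
    qed
  qed
  then have "\<nu> \<in> Mstar \<Omega>" using reg\<nu> nn by (simp add: Mstar_def K_def)
  then obtain P where "carried \<Omega> P" "\<And>B. B \<in> sets borel \<Longrightarrow> \<nu> B = measure P B"
    using carried_if_Mstar by metis
  note P = this
  have "\<mu> B = - measure P B" if B: "B \<in> sets borel" for B using P(2)[OF B] by (simp add: \<nu>_def)
  then show ?thesis by (rule that[OF P(1)])
qed

section \<open>The primal problem\<close>

definition positive_definite :: "('a \<Rightarrow> complex) \<Rightarrow> bool" where
  "positive_definite \<phi> \<longleftrightarrow> cont \<phi> \<and> (\<forall>\<gamma>\<in>dual_group. 0 \<le> coeff \<phi> \<gamma>)"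

lemma delsarte_class_iff:
  "\<phi> \<in> delsarte_class haar \<Omega> \<longleftrightarrow>
     positive_definite (\<lambda>x. complex_of_real (\<phi> x)) \<and> \<phi> 0 = 1 \<and> (\<forall>x\<in>- \<Omega>. \<phi> x \<le> 0)"
proof -
  have "cont \<phi> \<longleftrightarrow> cont (\<lambda>x. complex_of_real (\<phi> x))"
  proof
    assume "cont (\<lambda>x. complex_of_real (\<phi> x))"
    then have "cont (\<lambda>x. Re (complex_of_real (\<phi> x)))" by (rule continuous_on_Re)
    then show "cont \<phi>" by simp
  qed (rule continuous_on_of_real)
  then show ?thesis by (auto simp: delsarte_class_def positive_definite_def fourier_transform_def)
qed

lemma delsarte_class_series:
  assumes \<phi>: "\<phi> \<in> delsarte_class haar \<Omega>"
  obtains c where "\<forall>\<gamma>\<in>dual_group. 0 \<le> c \<gamma>" "c summable_on dual_group"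
    "(\<lambda>x. complex_of_real (\<phi> x)) = (\<lambda>x. \<Sum>\<^sub>\<infinity>\<gamma>\<in>dual_group. complex_of_real (c \<gamma>) * \<gamma> x)"
    "c trivial_character = (LINT x|haar. \<phi> x)"
proof
  define c where "c \<gamma> = Re (coeff (\<lambda>x. complex_of_real (\<phi> x)) \<gamma>)" for \<gamma>
  have pd: "cont (\<lambda>x. complex_of_real (\<phi> x))" "\<And>\<gamma>. \<gamma> \<in> dual_group \<Longrightarrow> 0 \<le> coeff (\<lambda>x. complex_of_real (\<phi> x)) \<gamma>"
    using \<phi> by (auto simp: delsarte_class_iff positive_definite_def)
  show "\<forall>\<gamma>\<in>dual_group. 0 \<le> c \<gamma>"
    using pd(2) by (simp add: c_def less_eq_complex_def)
  show "c summable_on dual_group" unfolding c_def by (rule fourier_inversion(1)[OF pd])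
  show "(\<lambda>x. complex_of_real (\<phi> x)) = (\<lambda>x. \<Sum>\<^sub>\<infinity>\<gamma>\<in>dual_group. complex_of_real (c \<gamma>) * \<gamma> x)"
    unfolding c_def by (rule ext) (rule fourier_inversion(2)[OF pd])
  show "c trivial_character = (LINT x|haar. \<phi> x)" by (simp add: c_def)
qed

lemma fourier_series_coefficient:
  assumes f: "f summable_on A" "\<And>\<gamma>. \<gamma> \<in> A \<Longrightarrow> 0 \<le> f \<gamma>" and A: "A \<subseteq> dual_group" and \<delta>: "\<delta> \<in> dual_group"
  shows "(LINT x|haar. (\<Sum>\<^sub>\<infinity>\<gamma>\<in>A. complex_of_real (f \<gamma>) * \<gamma> x) * cnj (\<delta> x)) = (if \<delta> \<in> A then of_real (f \<delta>) else 0)"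
proof -
  have L: "bounded_functional (\<lambda>g. coeff g \<delta>)"
    by (intro bounded_functional_weight continuous_intros dual_groupD(1) \<delta>)
  have "((\<lambda>\<gamma>. complex_of_real (f \<gamma>) * coeff \<gamma> \<delta>) has_sum
      (LINT x|haar. (\<Sum>\<^sub>\<infinity>\<gamma>\<in>A. complex_of_real (f \<gamma>) * \<gamma> x) * cnj (\<delta> x))) A"
    by (rule fourier_series(2)[OF f A L])
  moreover have "((\<lambda>\<gamma>. complex_of_real (f \<gamma>) * coeff \<gamma> \<delta>) has_sum (if \<delta> \<in> A then of_real (f \<delta>) else 0)) (A \<inter> {\<delta>})"
    using \<delta> by (intro has_sum_finiteI) (auto simp: character_orthogonality Int_insert_right)
  then have "((\<lambda>\<gamma>. complex_of_real (f \<gamma>) * coeff \<gamma> \<delta>) has_sum (if \<delta> \<in> A then of_real (f \<delta>) else 0)) A"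
    by (rule has_sum_cong_neutral[THEN iffD1, rotated -1]) (use A \<delta> in \<open>auto simp: character_orthogonality\<close>)
  ultimately show ?thesis by (rule has_sum_unique)
qed

lemma infsum_complex_of_real:
  assumes "f summable_on A"
  shows "(\<Sum>\<^sub>\<infinity>x\<in>A. complex_of_real (f x)) = complex_of_real (infsum f A)"
  using has_sum_of_real[OF has_sum_infsum[OF assms]] by (rule infsumI)

definition primal_values :: "'a set \<Rightarrow> real set" where
  "primal_values \<Omega> = {(\<Sum>\<^sub>\<infinity>\<gamma>\<in>dual_group - {trivial_character}. f \<gamma>) | f :: ('a \<Rightarrow> complex) \<Rightarrow> real.
     (\<lambda>\<gamma>. \<bar>f \<gamma>\<bar>) summable_on dual_group \<and> (\<forall>\<gamma>\<in>dual_group. 0 \<le> f \<gamma>) \<and>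
     (\<exists>\<phi>\<in>Qcone \<Omega>. \<forall>x. complex_of_real (\<phi> x) =
        1 + (\<Sum>\<^sub>\<infinity>\<gamma>\<in>dual_group - {trivial_character}. of_real (f \<gamma>) * \<gamma> x))}"

lemma primal_lp_eq: "primal_lp \<Omega> = (INF s\<in>primal_values \<Omega>. ereal s)"
  unfolding primal_lp_def primal_values_def
  by (rule arg_cong[of _ _ Inf]) blast

lemma primal_values_nonneg: "s \<in> primal_values \<Omega> \<Longrightarrow> 0 \<le> s"
  by (auto simp: primal_values_def intro!: infsum_nonneg)

text \<open>
  In the Fourier series of \<open>\<phi>\<close>, the constant term is the integral \<open>I\<close> and the sum of all
  coefficients is \<open>\<phi> 0 = 1\<close>. After division by \<open>I\<close> the constant term is \<open>1\<close> and the other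
  coefficients sum to \<open>1 / I - 1\<close>.
\<close>

lemma primal_value_if_class:
  assumes \<phi>: "\<phi> \<in> delsarte_class haar \<Omega>" and I: "(LINT x|haar. \<phi> x) > 0"
  obtains s where "s \<in> primal_values \<Omega>" "(LINT x|haar. \<phi> x) = 1 / (1 + s)"
proof -
  define I where "I = (LINT x|haar. \<phi> x)"
  have Ipos: "I > 0" using I by (simp add: I_def)
  have \<phi>0: "\<phi> 0 = 1" and le: "\<And>x. x \<in> - \<Omega> \<Longrightarrow> \<phi> x \<le> 0"
    using \<phi> by (auto simp: delsarte_class_iff)
  have c\<phi>: "cont \<phi>" using \<phi> by (simp add: delsarte_class_def)
  obtain c where cnn: "\<forall>\<gamma>\<in>dual_group. 0 \<le> c \<gamma>" and sm: "c summable_on dual_group"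
    and inv: "(\<lambda>x. complex_of_real (\<phi> x)) = (\<lambda>x. \<Sum>\<^sub>\<infinity>\<gamma>\<in>dual_group. complex_of_real (c \<gamma>) * \<gamma> x)"
    and c1: "c trivial_character = (LINT x|haar. \<phi> x)"
    by (rule delsarte_class_series[OF \<phi>])
  have smx: "(\<lambda>\<gamma>. complex_of_real (c \<gamma>) * \<gamma> x) summable_on (dual_group - {trivial_character})" for x
  proof (rule abs_summable_summable)
    have "c summable_on (dual_group - {trivial_character})" using sm by (rule summable_on_subset_banach) auto
    then show "(\<lambda>\<gamma>. norm (complex_of_real (c \<gamma>) * \<gamma> x)) summable_on (dual_group - {trivial_character})"
      by (rule summable_on_cong[THEN iffD1, rotated]) (auto simp: norm_mult dual_groupD(2) cnn)
  qed
  have split: "complex_of_real (\<phi> x) = of_real I + (\<Sum>\<^sub>\<infinity>\<gamma>\<in>dual_group - {trivial_character}. complex_of_real (c \<gamma>) * \<gamma> x)" for x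
  proof -
    have "complex_of_real (\<phi> x) = (\<Sum>\<^sub>\<infinity>\<gamma>\<in>insert trivial_character (dual_group - {trivial_character}). complex_of_real (c \<gamma>) * \<gamma> x)"
      using fun_cong[OF inv, of x] by (simp only: insert_Diff[OF one_dual_group])
    also have "\<dots> = of_real (c trivial_character) * 1 + (\<Sum>\<^sub>\<infinity>\<gamma>\<in>dual_group - {trivial_character}. complex_of_real (c \<gamma>) * \<gamma> x)"
      using smx by (subst infsum_insert) auto
    finally show ?thesis by (simp add: c1 I_def)
  qed
  define f where "f \<gamma> = (1 / I) * c \<gamma>" for \<gamma>
  define s where "s = (\<Sum>\<^sub>\<infinity>\<gamma>\<in>dual_group - {trivial_character}. f \<gamma>)"
  have s: "s = (1 / I) * (\<Sum>\<^sub>\<infinity>\<gamma>\<in>dual_group - {trivial_character}. c \<gamma>)"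
    unfolding s_def f_def by (rule infsum_cmult_right')
  have "1 = I + (\<Sum>\<^sub>\<infinity>\<gamma>\<in>dual_group - {trivial_character}. c \<gamma>)"
  proof -
    have "(\<Sum>\<^sub>\<infinity>\<gamma>\<in>dual_group - {trivial_character}. complex_of_real (c \<gamma>) * \<gamma> 0)
       = (\<Sum>\<^sub>\<infinity>\<gamma>\<in>dual_group - {trivial_character}. complex_of_real (c \<gamma>))"
      by (rule infsum_cong) (simp add: dual_groupD(4))
    also have "\<dots> = complex_of_real (\<Sum>\<^sub>\<infinity>\<gamma>\<in>dual_group - {trivial_character}. c \<gamma>)"
      using summable_on_subset_banach[OF sm, of "dual_group - {trivial_character}"] by (intro infsum_complex_of_real) auto
    finally have "complex_of_real 1 = complex_of_real (I + (\<Sum>\<^sub>\<infinity>\<gamma>\<in>dual_group - {trivial_character}. c \<gamma>))"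
      using split[of 0] \<phi>0 by simp
    then show ?thesis by (simp only: of_real_eq_iff)
  qed
  then have sI: "1 + s = 1 / I" using Ipos by (simp add: s field_simps)
  have "s \<in> primal_values \<Omega>"
    unfolding primal_values_def
  proof (intro CollectI exI[of _ f] conjI ballI)
    show "s = infsum f (dual_group - {trivial_character})" by (simp add: s_def)
    show "0 \<le> f \<gamma>" if "\<gamma> \<in> dual_group" for \<gamma> using cnn that Ipos by (simp add: f_def)
    have "f summable_on dual_group" unfolding f_def by (intro summable_on_cmult_right sm)
    then show "(\<lambda>\<gamma>. \<bar>f \<gamma>\<bar>) summable_on dual_group"
      by (rule summable_on_cong[THEN iffD1, rotated]) (use cnn Ipos in \<open>auto simp: f_def\<close>)
    show "\<exists>\<phi>\<in>Qcone \<Omega>. \<forall>x. complex_of_real (\<phi> x) = 1 + (\<Sum>\<^sub>\<infinity>\<gamma>\<in>dual_group - {trivial_character}. complex_of_real (f \<gamma>) * \<gamma> x)"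
    proof (intro bexI[of _ "\<lambda>x. \<phi> x / I"] allI)
      show "(\<lambda>x. \<phi> x / I) \<in> Qcone \<Omega>"
        using c\<phi> le Ipos by (auto simp: Qcone_def divide_nonpos_pos intro!: continuous_intros)
      fix x
      have "(\<Sum>\<^sub>\<infinity>\<gamma>\<in>dual_group - {trivial_character}. complex_of_real (f \<gamma>) * \<gamma> x)
        = (\<Sum>\<^sub>\<infinity>\<gamma>\<in>dual_group - {trivial_character}. of_real (1 / I) * (complex_of_real (c \<gamma>) * \<gamma> x))"
        by (simp add: f_def mult.assoc)
      also have "\<dots> = of_real (1 / I) * (\<Sum>\<^sub>\<infinity>\<gamma>\<in>dual_group - {trivial_character}. complex_of_real (c \<gamma>) * \<gamma> x)"
        by (rule infsum_cmult_right')
      also have "\<dots> = of_real (1 / I) * (of_real (\<phi> x) - of_real I)" using split[of x] by simp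
      finally show "complex_of_real (\<phi> x / I) = 1 + (\<Sum>\<^sub>\<infinity>\<gamma>\<in>dual_group - {trivial_character}. complex_of_real (f \<gamma>) * \<gamma> x)"
        using Ipos by (simp add: field_simps)
    qed
  qed
  moreover have "I = 1 / (1 + s)" using sI Ipos by simp
  ultimately show ?thesis using that by (simp add: I_def)
qed

text \<open>
  Division by the value \<open>1 + s\<close> at \<open>0\<close> undoes the normalisation of the linear program.
\<close>

lemma class_if_primal_value:
  assumes "s \<in> primal_values \<Omega>"
  obtains \<phi> where "\<phi> \<in> delsarte_class haar \<Omega>" "(LINT x|haar. \<phi> x) = 1 / (1 + s)"
proof -
  define A where "A = dual_group - {trivial_character :: 'a \<Rightarrow> complex}"
  obtain f \<phi> where s: "s = infsum f A" and sm: "(\<lambda>\<gamma>. \<bar>f \<gamma>\<bar>) summable_on dual_group"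
    and f: "\<And>\<gamma>. \<gamma> \<in> dual_group \<Longrightarrow> 0 \<le> f \<gamma>" and \<phi>Q: "\<phi> \<in> Qcone \<Omega>"
    and \<phi>: "\<And>x. complex_of_real (\<phi> x) = 1 + (\<Sum>\<^sub>\<infinity>\<gamma>\<in>A. of_real (f \<gamma>) * \<gamma> x)"
    using assms unfolding primal_values_def A_def by auto
  have "f summable_on dual_group"
    by (rule summable_on_cong[THEN iffD1, OF _ sm]) (simp add: f)
  then have smA: "f summable_on A" unfolding A_def by (rule summable_on_subset_banach) auto
  have A: "A \<subseteq> dual_group" by (auto simp: A_def)
  have fA: "0 \<le> f \<gamma>" if "\<gamma> \<in> A" for \<gamma> using f that A by auto
  have snn: "0 \<le> s" by (rule primal_values_nonneg[OF assms])
  have c\<phi>: "cont \<phi>" and le: "\<And>x. x \<in> - \<Omega> \<Longrightarrow> \<phi> x \<le> 0" using \<phi>Q by (auto simp: Qcone_def)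
  have c: "coeff (\<lambda>x. complex_of_real (\<phi> x)) \<delta> = (if \<delta> = trivial_character then 1 else of_real (f \<delta>))"
    if \<delta>: "\<delta> \<in> dual_group" for \<delta>
  proof -
    have L: "bounded_functional (\<lambda>g. coeff g \<delta>)"
      by (intro bounded_functional_weight continuous_intros dual_groupD(1) \<delta>)
    have "coeff (\<lambda>x. complex_of_real (\<phi> x)) \<delta>
      = (LINT x|haar. 1 * cnj (\<delta> x)) + (LINT x|haar. (\<Sum>\<^sub>\<infinity>\<gamma>\<in>A. of_real (f \<gamma>) * \<gamma> x) * cnj (\<delta> x))"
      unfolding \<phi> by (rule bounded_functionalD(1)[OF L continuous_on_const fourier_series(1)[OF smA fA A]])
    also have "(LINT x|haar. 1 * cnj (\<delta> x)) = (if trivial_character = \<delta> then 1 else 0)"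
      by (rule character_orthogonality[OF one_dual_group \<delta>])
    also have "(LINT x|haar. (\<Sum>\<^sub>\<infinity>\<gamma>\<in>A. of_real (f \<gamma>) * \<gamma> x) * cnj (\<delta> x)) = (if \<delta> \<in> A then of_real (f \<delta>) else 0)"
      by (rule fourier_series_coefficient[OF smA fA A \<delta>])
    finally show ?thesis using \<delta> by (auto simp: A_def)
  qed
  define \<psi> where "\<psi> x = (1 / (1 + s)) * \<phi> x" for x
  have "(LINT x|haar. complex_of_real (\<phi> x) * cnj 1) = 1"
    using c[OF one_dual_group] by simp
  then have "complex_of_real (LINT x|haar. \<phi> x) = complex_of_real 1" by simp
  then have "(LINT x|haar. \<phi> x) = 1" by (simp only: of_real_eq_iff)
  then have "(LINT x|haar. \<psi> x) = 1 / (1 + s)" by (simp add: \<psi>_def)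
  moreover have "\<psi> \<in> delsarte_class haar \<Omega>"
    unfolding delsarte_class_iff
  proof (intro conjI ballI)
    have "coeff (\<lambda>x. complex_of_real (\<psi> x)) \<gamma> = of_real (1 / (1 + s)) * coeff (\<lambda>x. complex_of_real (\<phi> x)) \<gamma>" for \<gamma>
      by (simp add: \<psi>_def mult.assoc)
    moreover have "0 \<le> of_real (1 / (1 + s)) * z" if "0 \<le> z" for z :: complex
      using that snn by (simp add: less_eq_complex_def)
    moreover have "0 \<le> (if \<delta> = trivial_character then 1 else complex_of_real (f \<delta>))" if "\<delta> \<in> dual_group" for \<delta>
      using f[OF that] by (simp add: less_eq_complex_def)
    moreover have "cont (\<lambda>x. complex_of_real (\<psi> x))"
      unfolding \<psi>_def by (intro continuous_on_of_real continuous_on_mult continuous_on_const c\<phi>)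
    ultimately show "positive_definite (\<lambda>x. complex_of_real (\<psi> x))"
      using c unfolding positive_definite_def by simp
    show "\<psi> x \<le> 0" if "x \<in> - \<Omega>" for x using le[OF that] snn by (simp add: \<psi>_def divide_nonpos_pos)
    have "(\<Sum>\<^sub>\<infinity>\<gamma>\<in>A. of_real (f \<gamma>) * \<gamma> 0) = (\<Sum>\<^sub>\<infinity>\<gamma>\<in>A. complex_of_real (f \<gamma>))"
      using A by (intro infsum_cong) (auto simp: dual_groupD(4))
    also have "\<dots> = of_real s" unfolding s by (rule infsum_complex_of_real[OF smA])
    finally have "complex_of_real (\<phi> 0) = complex_of_real (1 + s)" using \<phi>[of 0] by simp
    then have "\<phi> 0 = 1 + s" by (simp only: of_real_eq_iff)
    then show "\<psi> 0 = 1" using snn by (simp add: \<psi>_def)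
  qed
  ultimately show ?thesis using that by blast
qed

text \<open>
  The normalised autocorrelation of a bump supported near \<open>0\<close>.
\<close>

lemma delsarte_class_positive_integral:
  assumes "0 \<in> interior \<Omega>"
  obtains \<phi> where "\<phi> \<in> delsarte_class haar \<Omega>" "(LINT x|haar. \<phi> x) > 0"
proof -
  obtain w k :: "'a \<Rightarrow> real" where w: "cont w" "cont k" "\<And>x. autocorr (\<lambda>x. of_real (w x)) x = of_real (k x)"
    "\<And>x. 0 \<le> k x" "k 0 > 0" "\<And>x. x \<notin> interior \<Omega> \<Longrightarrow> k x = 0"
    using autocorr_bump[OF open_interior assms] by metis
  define \<phi> where "\<phi> x = (1 / k 0) * k x" for x
  have "\<phi> \<in> delsarte_class haar \<Omega>"
    unfolding delsarte_class_iff positive_definite_def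
  proof (intro conjI ballI)
    show "cont (\<lambda>x. complex_of_real (\<phi> x))" unfolding \<phi>_def by (intro continuous_intros w)
    show "\<phi> 0 = 1" using w(5) by (simp add: \<phi>_def)
    show "\<phi> x \<le> 0" if "x \<in> - \<Omega>" for x
    proof -
      have "x \<notin> interior \<Omega>" using that interior_subset by blast
      then show ?thesis using w(6) by (simp add: \<phi>_def)
    qed
    fix \<gamma> :: "'a \<Rightarrow> complex" assume \<gamma>: "\<gamma> \<in> dual_group"
    have "0 \<le> (LINT x|haar. autocorr (\<lambda>x. of_real (w x)) x * cnj (\<gamma> x))"
    proof (rule functional_autocorr_nonneg[where L="\<lambda>g. coeff g \<gamma>"])
      show "bounded_functional (\<lambda>g. coeff g \<gamma>)"
        by (intro bounded_functional_weight continuous_intros dual_groupD(1) \<gamma>)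
      show "0 \<le> coeff \<delta> \<gamma>" if "\<delta> \<in> dual_group" for \<delta>
        using character_orthogonality[OF that \<gamma>] by (simp add: less_eq_complex_def)
      show "cont (\<lambda>x. complex_of_real (w x))" by (intro continuous_intros w)
    qed
    then have "0 \<le> of_real (1 / k 0) * coeff (\<lambda>x. complex_of_real (k x)) \<gamma>"
      using w(5) by (simp add: w(3) less_eq_complex_def)
    also have "\<dots> = coeff (\<lambda>x. complex_of_real (\<phi> x)) \<gamma>"
      by (simp add: \<phi>_def mult.assoc)
    finally show "0 \<le> coeff (\<lambda>x. complex_of_real (\<phi> x)) \<gamma>" .
  qed
  moreover have "(LINT x|haar. \<phi> x) > 0"
    unfolding \<phi>_def using w by (intro haar_integral_pos[of _ 0] continuous_intros) auto
  ultimately show ?thesis by (rule that)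
qed

lemma delsarte_eq:
  assumes "0 \<in> interior \<Omega>"
  shows "primal_values \<Omega> \<noteq> {}" "delsarte haar \<Omega> = 1 / (1 + primal_lp \<Omega>)"
proof -
  show ne: "primal_values \<Omega> \<noteq> {}"
    using delsarte_class_positive_integral[OF assms] primal_value_if_class by (metis empty_iff)
  have "delsarte haar \<Omega> = (SUP s\<in>primal_values \<Omega>. ereal (1 / (1 + s)))"
    unfolding delsarte_def
  proof (rule antisym)
    show "(SUP s\<in>primal_values \<Omega>. ereal (1 / (1 + s))) \<le> (SUP \<phi>\<in>delsarte_class haar \<Omega>. ereal (LINT x|haar. \<phi> x))"
    proof (rule SUP_least)
      fix s assume "s \<in> primal_values \<Omega>"
      then obtain \<phi> where "\<phi> \<in> delsarte_class haar \<Omega>" "(LINT x|haar. \<phi> x) = 1 / (1 + s)"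
        by (rule class_if_primal_value)
      then show "ereal (1 / (1 + s)) \<le> (SUP \<phi>\<in>delsarte_class haar \<Omega>. ereal (LINT x|haar. \<phi> x))"
        by (metis (no_types, lifting) SUP_upper)
    qed
    show "(SUP \<phi>\<in>delsarte_class haar \<Omega>. ereal (LINT x|haar. \<phi> x)) \<le> (SUP s\<in>primal_values \<Omega>. ereal (1 / (1 + s)))"
    proof (rule SUP_least)
      fix \<phi> assume \<phi>: "\<phi> \<in> delsarte_class haar \<Omega>"
      show "ereal (LINT x|haar. \<phi> x) \<le> (SUP s\<in>primal_values \<Omega>. ereal (1 / (1 + s)))"
      proof (cases "(LINT x|haar. \<phi> x) > 0")
        case True
        then obtain s where "s \<in> primal_values \<Omega>" "(LINT x|haar. \<phi> x) = 1 / (1 + s)"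
          using primal_value_if_class[OF \<phi>] by metis
        then show ?thesis by (metis (no_types, lifting) SUP_upper)
      next
        case False
        obtain s where s: "s \<in> primal_values \<Omega>" using ne by blast
        have "(LINT x|haar. \<phi> x) \<le> 1 / (1 + s)"
          using False primal_values_nonneg[OF s] by (smt (verit) divide_nonneg_nonneg)
        then show ?thesis using s by (intro SUP_upper2[OF s]) simp
      qed
    qed
  qed
  then show "delsarte haar \<Omega> = 1 / (1 + primal_lp \<Omega>)"
    using SUP_reciprocal[OF ne primal_values_nonneg] by (simp add: primal_lp_eq)
qed

section \<open>The dual problem\<close>

definition dual_values :: "'a set \<Rightarrow> real set" where
  "dual_values \<Omega> = {- \<mu> UNIV | \<mu>. \<mu> \<in> Qcone_dual \<Omega> \<and>
     (\<forall>\<gamma>\<in>dual_group - {trivial_character}. signed_integral \<mu> \<gamma> \<le> 1)}"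

lemma dual_lp_eq: "dual_lp \<Omega> = (SUP s\<in>dual_values \<Omega>. ereal s)"
  unfolding dual_lp_def dual_values_def
  by (rule arg_cong[of _ _ Sup]) blast

definition admissible :: "'a set \<Rightarrow> real set" where
  "admissible \<Omega> = {\<alpha>. \<exists>\<mu>\<in>Mstar \<Omega>. \<exists>\<tau>\<in>T0 haar.
     \<forall>B\<in>sets borel. \<alpha> * indicator B 0 - measure haar B = - \<mu> B + \<tau> B}"

text \<open>
  The dual program in terms of positive measures. The scalar \<open>c\<close> is kept apart so that rescaling a
  feasible solution leaves the measure itself unchanged.
\<close>

lemma dual_values_iff:
  "s \<in> dual_values \<Omega> \<longleftrightarrow> (\<exists>P c. carried \<Omega> P \<and> 0 \<le> c \<and> s = c * measure P UNIV \<and>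
     (\<forall>\<gamma>\<in>dual_group - {trivial_character}. - 1 \<le> of_real c * (LINT x|P. \<gamma> x)))"
proof
  assume "s \<in> dual_values \<Omega>"
  then obtain \<mu> where \<mu>: "\<mu> \<in> Qcone_dual \<Omega>" "s = - \<mu> UNIV"
    "\<And>\<gamma>. \<gamma> \<in> dual_group - {trivial_character} \<Longrightarrow> signed_integral \<mu> \<gamma> \<le> 1"
    by (auto simp: dual_values_def)
  obtain P where P: "carried \<Omega> P" "\<And>B. B \<in> sets borel \<Longrightarrow> \<mu> B = - measure P B"
    using carried_if_Qcone_dual[OF \<mu>(1)] by metis
  have "- 1 \<le> of_real 1 * (LINT x|P. \<gamma> x)" if \<gamma>: "\<gamma> \<in> dual_group - {trivial_character}" for \<gamma>
    using \<mu>(3)[OF \<gamma>] carried_signed_integral[OF P(1), of \<mu> "-1" \<gamma>] P(2) dual_groupD(1)[of \<gamma>] \<gamma>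
    by (simp add: less_eq_complex_def)
  then show "\<exists>P c. carried \<Omega> P \<and> 0 \<le> c \<and> s = c * measure P UNIV \<and>
     (\<forall>\<gamma>\<in>dual_group - {trivial_character}. - 1 \<le> of_real c * (LINT x|P. \<gamma> x))"
    using P \<mu>(2) by (intro exI[of _ P] exI[of _ 1]) auto
next
  assume "\<exists>P c. carried \<Omega> P \<and> 0 \<le> c \<and> s = c * measure P UNIV \<and>
     (\<forall>\<gamma>\<in>dual_group - {trivial_character}. - 1 \<le> of_real c * (LINT x|P. \<gamma> x))"
  then obtain P c where P: "carried \<Omega> P" "0 \<le> c" "s = c * measure P UNIV"
    "\<And>\<gamma>. \<gamma> \<in> dual_group - {trivial_character} \<Longrightarrow> - 1 \<le> of_real c * (LINT x|P. \<gamma> x)" by auto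
  define \<mu> where "\<mu> B = - c * measure P B" for B
  have "\<mu> \<in> Qcone_dual \<Omega>" using P by (intro Qcone_dual_if_carried[OF P(1,2)]) (simp add: \<mu>_def)
  moreover have "signed_integral \<mu> \<gamma> \<le> 1" if \<gamma>: "\<gamma> \<in> dual_group - {trivial_character}" for \<gamma>
    using P(4)[OF \<gamma>] carried_signed_integral[OF P(1), of \<mu> "- c" \<gamma>] dual_groupD(1)[of \<gamma>] \<gamma>
    by (simp add: less_eq_complex_def \<mu>_def)
  ultimately show "s \<in> dual_values \<Omega>"
    using P(3) unfolding dual_values_def by (intro CollectI exI[of _ \<mu>]) (auto simp: \<mu>_def)
qed

lemma dual_values_nonneg: "s \<in> dual_values \<Omega> \<Longrightarrow> 0 \<le> s"
  by (auto simp: dual_values_iff)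

lemma dual_values_nonempty: "0 \<in> dual_values \<Omega>"
proof -
  have "finite_borel (null_measure borel :: 'a measure)"
    by (auto simp: finite_borel_def intro!: finite_measureI)
  moreover have "approximable (null_measure borel :: 'a measure)"
    unfolding approximable_def
  proof (intro ballI allI impI)
    fix B :: "'a set" and e :: real assume "e > 0"
    then show "\<exists>K U. compact K \<and> K \<subseteq> B \<and> open U \<and> B \<subseteq> U \<and> measure (null_measure borel) (U - K) < e"
      by (intro exI[of _ "{}"] exI[of _ UNIV]) (simp add: measure_def)
  qed
  ultimately have "carried \<Omega> (null_measure borel)" by (simp add: carried_def measure_def)
  then show ?thesis
    unfolding dual_values_iff by (intro exI[of _ "null_measure borel"] exI[of _ 0]) (simp add: less_eq_complex_def)
qed

text \<open>
  The Jordan parts of such a \<open>\<tau>\<close> are not explicit, but neither regularity nor integrals depend on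
  the chosen representation as a combination of positive measures.
\<close>

lemma dual_measure_combination:
  fixes f :: "'a \<Rightarrow> complex"
  assumes P: "carried \<Omega> P"
    and eq: "\<And>B. B \<in> sets borel \<Longrightarrow> \<tau> B = \<alpha> * indicator B 0 - measure haar B + c * measure P B"
  shows "\<tau> \<in> regular_signed_measures"
    and "cont f \<Longrightarrow> signed_integral \<tau> f = of_real \<alpha> * f 0 - (LINT x|haar. f x) + of_real c * (LINT x|P. f x)"
      (is "_ \<Longrightarrow> _ = ?rhs")
proof -
  define Q where "Q i = (if i = 0 then dirac 0 else if i = 1 then haar else P)" for i :: nat
  define d where "d i = (if i = 0 then \<alpha> else if i = 1 then - 1 else c)" for i :: nat
  have three: "(\<Sum>i\<in>{0,1,2}. h i) = h 0 + h 1 + h 2" for h :: "nat \<Rightarrow> 'b::comm_monoid_add"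
    by (simp add: add.assoc)
  have Q: "finite_borel (Q i)" "approximable (Q i)" for i
    using P finite_borel_dirac finite_borel_haar approximable_dirac approximable_haar
    by (auto simp: Q_def carried_def)
  have \<tau>: "\<tau> B = (\<Sum>i\<in>{0,1,2}. d i * measure (Q i) B)" if "B \<in> sets borel" for B
    unfolding three using that by (simp add: Q_def d_def eq measure_dirac)
  show reg: "\<tau> \<in> regular_signed_measures"
    by (rule regular_combination[of "{0,1,2}" Q \<tau> d]) (use Q \<tau> in auto)
  assume f: "cont f"
  obtain C where C: "\<And>x. cmod (f x) \<le> C" using cont_bounded[OF f] by metis
  have "signed_integral \<tau> f = (\<Sum>i\<in>{0,1,2}. of_real (d i) * (LINT x|Q i. f x))"
    using regular_signed_measuresD(1)[OF reg] Q \<tau> C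
    by (intro signed_integral_combination[of \<tau> "{0,1,2}" Q d f C] cont_measurable f) auto
  also have "\<dots> = ?rhs"
    unfolding three by (simp add: Q_def d_def integral_dirac[OF cont_measurable[OF f]])
  finally show "signed_integral \<tau> f = ?rhs" .
qed

text \<open>
  A character is its own autocorrelation. Conversely, nonnegativity on characters extends to
  autocorrelations of trigonometric polynomials and, by density, to all autocorrelations.
\<close>

lemma positive_definite_measure_iff:
  assumes \<tau>: "signed_borel_measure \<tau>"
  shows "positive_definite_measure haar \<tau> \<longleftrightarrow> (\<forall>\<gamma>\<in>dual_group. 0 \<le> signed_integral \<tau> \<gamma>)"
proof (intro iffI ballI)
  fix \<gamma> :: "'a \<Rightarrow> complex" assume pd: "positive_definite_measure haar \<tau>" and \<gamma>: "\<gamma> \<in> dual_group"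
  have "autocorr \<gamma> = \<gamma>"
  proof
    fix x
    have "autocorr \<gamma> x = (LINT y|haar. \<gamma> x)"
      unfolding autocorr_def
      by (intro Bochner_Integration.integral_cong refl)
         (simp add: dual_groupD(3)[OF \<gamma>] dual_groupD(7)[OF \<gamma>] mult.assoc)
    then show "autocorr \<gamma> x = \<gamma> x" by simp
  qed
  then show "0 \<le> signed_integral \<tau> \<gamma>"
    using pd convolve_eq_autocorr[OF dual_groupD(1)[OF \<gamma>]] dual_groupD(1)[OF \<gamma>]
    unfolding positive_definite_measure_def by metis
next
  assume pos: "\<forall>\<gamma>\<in>dual_group. 0 \<le> signed_integral \<tau> \<gamma>"
  show "positive_definite_measure haar \<tau>"
    unfolding positive_definite_measure_def
  proof (intro allI impI)
    fix u :: "'a \<Rightarrow> complex" assume u: "cont u"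
    show "0 \<le> signed_integral \<tau> (convolve haar u (\<lambda>g. cnj (u (- g))))"
      unfolding convolve_eq_autocorr[OF u]
      by (rule functional_autocorr_nonneg[OF bounded_functional_signed[OF \<tau>] _ u]) (use pos in auto)
  qed
qed

lemma admissibleE:
  assumes \<alpha>: "\<alpha> \<in> admissible \<Omega>"
  obtains P \<tau> where "carried \<Omega> P" "\<tau> UNIV = 0" "\<And>\<gamma>. \<gamma> \<in> dual_group \<Longrightarrow> 0 \<le> signed_integral \<tau> \<gamma>"
    "\<And>B. B \<in> sets borel \<Longrightarrow> \<tau> B = \<alpha> * indicator B 0 - measure haar B + 1 * measure P B"
proof -
  obtain \<nu> \<tau> where \<nu>: "\<nu> \<in> Mstar \<Omega>" and \<tau>: "\<tau> \<in> T0 haar"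
    and eq: "\<And>B. B \<in> sets borel \<Longrightarrow> \<alpha> * indicator B 0 - measure haar B = - \<nu> B + \<tau> B"
    using \<alpha> by (auto simp: admissible_def)
  obtain P where P: "carried \<Omega> P" "\<And>B. B \<in> sets borel \<Longrightarrow> \<nu> B = measure P B"
    using carried_if_Mstar[OF \<nu>] by metis
  have "signed_borel_measure \<tau>" using \<tau> regular_signed_measuresD(1) by (auto simp: T0_def)
  then have pos: "0 \<le> signed_integral \<tau> \<gamma>" if "\<gamma> \<in> dual_group" for \<gamma>
    using \<tau> that by (auto simp: T0_def positive_definite_measure_iff)
  have \<tau>eq: "\<tau> B = \<alpha> * indicator B 0 - measure haar B + 1 * measure P B" if "B \<in> sets borel" for B
    using eq[OF that] P(2)[OF that] by simp
  have "\<tau> UNIV = 0" using \<tau> by (simp add: T0_def)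
  then show ?thesis using that P(1) pos \<tau>eq by blast
qed

text \<open>
  Integrating \<open>\<phi>\<close> against \<open>\<tau> = \<alpha> \<delta>\<^sub>0 - haar + P\<close> gives \<open>\<alpha> - \<integral> \<phi> + \<integral> \<phi> dP\<close>. This is nonnegative,
  since \<open>\<tau>\<close> is nonnegative on each term of the Fourier series of \<open>\<phi>\<close>, while the last integral is
  nonpositive.
\<close>

lemma weak_duality:
  assumes \<alpha>: "\<alpha> \<in> admissible \<Omega>" and \<phi>: "\<phi> \<in> delsarte_class haar \<Omega>"
  shows "(LINT x|haar. \<phi> x) \<le> \<alpha>"
proof -
  obtain P \<tau> where P: "carried \<Omega> P" and \<tau>: "\<tau> UNIV = 0" "\<And>\<gamma>. \<gamma> \<in> dual_group \<Longrightarrow> 0 \<le> signed_integral \<tau> \<gamma>"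
    and \<tau>eq: "\<And>B. B \<in> sets borel \<Longrightarrow> \<tau> B = \<alpha> * indicator B 0 - measure haar B + 1 * measure P B"
    using admissibleE[OF \<alpha>] by metis
  have s\<tau>: "signed_borel_measure \<tau>"
    by (rule regular_signed_measuresD(1)[OF dual_measure_combination(1)[OF P \<tau>eq]])
  have \<phi>0: "\<phi> 0 = 1" using \<phi> by (simp add: delsarte_class_iff)
  have c\<phi>: "cont \<phi>" using \<phi> by (simp add: delsarte_class_def)
  have \<phi>Q: "\<phi> \<in> Qcone \<Omega>" using \<phi> by (simp add: delsarte_class_def Qcone_def)
  obtain c where cnn: "\<forall>\<gamma>\<in>dual_group. 0 \<le> c \<gamma>" and sm: "c summable_on dual_group"
    and inv: "(\<lambda>x. complex_of_real (\<phi> x)) = (\<lambda>x. \<Sum>\<^sub>\<infinity>\<gamma>\<in>dual_group. complex_of_real (c \<gamma>) * \<gamma> x)"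
    and "c trivial_character = (LINT x|haar. \<phi> x)"
    by (rule delsarte_class_series[OF \<phi>])
  have "((\<lambda>\<gamma>. complex_of_real (c \<gamma>) * signed_integral \<tau> \<gamma>) has_sum signed_integral \<tau> (\<lambda>x. complex_of_real (\<phi> x))) dual_group"
    unfolding inv by (rule fourier_series(2)[OF sm bspec[OF cnn] order_refl bounded_functional_signed[OF s\<tau>]])
  then have "((\<lambda>\<gamma>. Re (complex_of_real (c \<gamma>) * signed_integral \<tau> \<gamma>)) has_sum Re (signed_integral \<tau> (\<lambda>x. complex_of_real (\<phi> x)))) dual_group"
    by (rule has_sum_Re)
  then have "0 \<le> Re (signed_integral \<tau> (\<lambda>x. complex_of_real (\<phi> x)))"
    by (rule has_sum_nonneg) (use cnn \<tau>(2) in \<open>auto simp: less_eq_complex_def\<close>)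
  also have "signed_integral \<tau> (\<lambda>x. complex_of_real (\<phi> x)) = of_real (\<alpha> - (LINT x|haar. \<phi> x) + (LINT x|P. \<phi> x))"
    using dual_measure_combination(2)[OF P \<tau>eq, of "\<lambda>x. complex_of_real (\<phi> x)"] c\<phi> \<phi>0
    by (simp add: continuous_intros)
  finally show ?thesis using carried_nonpos[OF P \<phi>Q] by simp
qed

text \<open>
  The mass and the Fourier coefficients of \<open>\<tau> = \<alpha> \<delta>\<^sub>0 - haar + P\<close> show that \<open>\<tau>\<close> belongs to
  \<open>T0 haar\<close> exactly if \<open>P\<close> has mass \<open>1 - \<alpha>\<close> and \<open>\<alpha> + \<integral> \<gamma> dP \<ge> 0\<close> for all nontrivial \<open>\<gamma>\<close>. After
  division by \<open>\<alpha>\<close> these are the conditions of the dual program. That \<open>\<alpha>\<close> is positive follows from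
  weak duality and a function of the class with positive integral.
\<close>

lemma admissible_eq:
  assumes \<Omega>: "0 \<in> interior \<Omega>"
  shows "admissible \<Omega> = (\<lambda>s. 1 / (1 + s)) ` dual_values \<Omega>"
proof (intro set_eqI iffI)
  fix \<alpha> assume \<alpha>: "\<alpha> \<in> admissible \<Omega>"
  obtain \<phi> where "\<phi> \<in> delsarte_class haar \<Omega>" "(LINT x|haar. \<phi> x) > 0"
    by (rule delsarte_class_positive_integral[OF \<Omega>])
  then have \<alpha>pos: "\<alpha> > 0" using weak_duality[OF \<alpha>] by fastforce
  obtain P \<tau> where P: "carried \<Omega> P" and \<tau>: "\<tau> UNIV = 0" "\<And>\<gamma>. \<gamma> \<in> dual_group \<Longrightarrow> 0 \<le> signed_integral \<tau> \<gamma>"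
    and \<tau>eq: "\<And>B. B \<in> sets borel \<Longrightarrow> \<tau> B = \<alpha> * indicator B 0 - measure haar B + 1 * measure P B"
    using admissibleE[OF \<alpha>] by metis
  have total: "measure P UNIV = 1 - \<alpha>" using \<tau>eq[of UNIV] \<tau>(1) by simp
  have "- 1 \<le> of_real (1 / \<alpha>) * (LINT x|P. \<gamma> x)" if \<gamma>: "\<gamma> \<in> dual_group - {trivial_character}" for \<gamma>
  proof -
    have "0 \<le> signed_integral \<tau> \<gamma>"
      using \<tau>(2) \<gamma> by simp
    also have "signed_integral \<tau> \<gamma> = of_real \<alpha> + (LINT x|P. \<gamma> x)"
      using dual_measure_combination(2)[OF P \<tau>eq, of \<gamma>] \<gamma> dual_groupD(1,4)[of \<gamma>] integral_character[of \<gamma>]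
      by simp
    finally show ?thesis using \<alpha>pos by (simp add: less_eq_complex_def field_simps)
  qed
  then have "(1 - \<alpha>) / \<alpha> \<in> dual_values \<Omega>"
    unfolding dual_values_iff using P \<alpha>pos total by (intro exI[of _ P] exI[of _ "1 / \<alpha>"]) auto
  moreover have "\<alpha> = 1 / (1 + (1 - \<alpha>) / \<alpha>)" using \<alpha>pos by (simp add: field_simps)
  ultimately show "\<alpha> \<in> (\<lambda>s. 1 / (1 + s)) ` dual_values \<Omega>" by blast
next
  fix \<alpha> assume "\<alpha> \<in> (\<lambda>s. 1 / (1 + s)) ` dual_values \<Omega>"
  then obtain s where s: "s \<in> dual_values \<Omega>" "\<alpha> = 1 / (1 + s)" by blast
  have snn: "0 \<le> s" by (rule dual_values_nonneg[OF s(1)])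
  have \<alpha>pos: "\<alpha> > 0" using s(2) snn by simp
  obtain P c where P: "carried \<Omega> P" "0 \<le> c" "s = c * measure P UNIV"
    "\<And>\<gamma>. \<gamma> \<in> dual_group - {trivial_character} \<Longrightarrow> - 1 \<le> of_real c * (LINT x|P. \<gamma> x)"
    using s(1) unfolding dual_values_iff by auto
  define \<nu> where "\<nu> B = (\<alpha> * c) * measure P B" for B
  define \<tau> where "\<tau> B = \<alpha> * indicator B 0 - measure haar B + (\<alpha> * c) * measure P B" for B
  have \<nu>: "\<nu> \<in> Mstar \<Omega>" using P \<alpha>pos by (intro Mstar_if_carried[OF P(1), of "\<alpha> * c"]) (auto simp: \<nu>_def)
  note comb = dual_measure_combination[OF P(1), of \<tau> \<alpha> "\<alpha> * c", OF \<tau>_def]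
  have reg: "\<tau> \<in> regular_signed_measures" by (rule comb(1))
  have total: "\<tau> UNIV = 0"
  proof -
    have "\<tau> UNIV = \<alpha> * (1 + s) - 1" by (simp add: \<tau>_def P(3) algebra_simps)
    then show ?thesis using s(2) snn by simp
  qed
  have "0 \<le> signed_integral \<tau> \<gamma>" if \<gamma>: "\<gamma> \<in> dual_group" for \<gamma>
  proof (cases "\<gamma> = trivial_character")
    case True
    have "signed_integral \<tau> \<gamma> = of_real (\<tau> UNIV)"
      using comb(2)[OF dual_groupD(1)[OF \<gamma>]] finite_borelD(3)[of P] P(1) True
      by (simp add: \<tau>_def carried_def scaleR_conv_of_real)
    then show ?thesis by (simp add: total)
  next
    case False
    have "signed_integral \<tau> \<gamma> = of_real \<alpha> * (1 + of_real c * (LINT x|P. \<gamma> x))"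
      using comb(2)[OF dual_groupD(1)[OF \<gamma>]] dual_groupD(4)[OF \<gamma>] integral_character[OF \<gamma> False]
      by (simp add: algebra_simps)
    moreover have "0 \<le> 1 + of_real c * (LINT x|P. \<gamma> x)"
      using P(4)[of \<gamma>] \<gamma> False by (simp add: less_eq_complex_def)
    ultimately show ?thesis using \<alpha>pos by (simp add: less_eq_complex_def)
  qed
  then have "\<tau> \<in> T0 haar"
    using reg total positive_definite_measure_iff[OF regular_signed_measuresD(1)[OF reg]] by (simp add: T0_def)
  then show "\<alpha> \<in> admissible \<Omega>"
    using \<nu> unfolding admissible_def by (intro CollectI bexI[of _ \<nu>] bexI[of _ \<tau>]) (auto simp: \<nu>_def \<tau>_def)
qed

lemma delsarte_dual_eq:
  assumes "0 \<in> interior \<Omega>"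
  shows "delsarte_dual haar \<Omega> = 1 / (1 + dual_lp \<Omega>)"
proof -
  have "delsarte_dual haar \<Omega> = (INF \<alpha>\<in>admissible \<Omega>. ereal \<alpha>)"
    by (simp add: delsarte_dual_def admissible_def)
  also have "\<dots> = (INF s\<in>dual_values \<Omega>. ereal (1 / (1 + s)))"
    unfolding admissible_eq[OF assms] by (simp add: image_image)
  also have "\<dots> = 1 / (1 + dual_lp \<Omega>)"
    unfolding dual_lp_eq using dual_values_nonempty dual_values_nonneg
    by (intro INF_reciprocal) auto
  finally show ?thesis .
qed

end

section \<open>Strong duality\<close>

context compact_abelian_group
begin

text \<open>
  Positive normalised functionals on all bounded functions that are symmetric and concentrated on
  \<open>K\<close>. The value \<open>0\<close> on unbounded functions is a convention that makes the set compact for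
  pointwise convergence on the whole function space.
\<close>

definition symmetric_states :: "'a set \<Rightarrow> (('a \<Rightarrow> real) \<Rightarrow> real) set" where
  "symmetric_states K = {\<Lambda>. state \<Lambda> \<and> (\<forall>f. bdd f \<longrightarrow> \<Lambda> (\<lambda>x. f (- x)) = \<Lambda> f) \<and>
     \<Lambda> (indicator K) = 1 \<and> (\<forall>f. \<not> bdd f \<longrightarrow> \<Lambda> f = 0)}"

lemma symmetric_statesD:
  assumes "\<Lambda> \<in> symmetric_states K"
  shows "state \<Lambda>" "bdd f \<Longrightarrow> \<Lambda> (\<lambda>x. f (- x)) = \<Lambda> f" "\<Lambda> (indicator K) = 1" "\<not> bdd f \<Longrightarrow> \<Lambda> f = 0"
    "compact_state \<Lambda>"
  using assms compact_group by (auto simp: symmetric_states_def compact_state_def)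

lemma compact_symmetric_states: "compact (symmetric_states K)"
proof -
  define N where "N f = (if bdd f then SOME C. \<forall>x. \<bar>f x\<bar> \<le> C else 0)" for f :: "'a \<Rightarrow> real"
  have N: "\<bar>f x\<bar> \<le> N f" if "bdd f" for f x
    using that someI_ex[of "\<lambda>C. \<forall>x. \<bar>f x\<bar> \<le> C"] by (auto simp: N_def bdd_def)
  define box where "box = PiE (UNIV :: ('a \<Rightarrow> real) set) (\<lambda>f. {- N f..N f})"
  have "compactin (product_topology (\<lambda>_. euclidean) UNIV) box"
    unfolding compactin_PiE box_def by simp
  then have box: "compact box" by (simp add: euclidean_product_topology)
  have "symmetric_states K \<subseteq> box"
  proof
    fix \<Lambda> assume \<Lambda>: "\<Lambda> \<in> symmetric_states K"
    interpret compact_state \<Lambda> using \<Lambda> by (rule symmetric_statesD)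
    have "\<Lambda> f \<in> {- N f..N f}" for f
    proof (cases "bdd f")
      case True
      have "\<Lambda> f \<le> \<Lambda> (\<lambda>_. N f)" "\<Lambda> (\<lambda>_. - N f) \<le> \<Lambda> f"
        using N[OF True] by (auto intro!: mono True simp: abs_le_iff) (metis minus_le_iff)
      then show ?thesis by (simp add: const)
    next
      case False
      then show ?thesis using symmetric_statesD(4)[OF \<Lambda>] by (simp add: N_def)
    qed
    then show "\<Lambda> \<in> box" by (auto simp: box_def)
  qed
  moreover have "closed (symmetric_states K)"
    unfolding symmetric_states_def state_def
    by (intro closed_Collect_conj closed_Collect_all closed_Collect_imp closed_Collect_eq closed_Collect_le
        open_Collect_const continuous_on_add continuous_on_mult continuous_on_const
        continuous_on_product_coordinates)
  ultimately show ?thesis using box compact_Int_closed[of box "symmetric_states K"] by (simp add: Int_absorb1)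
qed

lemma symmetric_states_convex:
  assumes "\<Lambda> \<in> symmetric_states K" "\<Lambda>' \<in> symmetric_states K" "0 \<le> t" "t \<le> 1"
  shows "(\<lambda>f. (1 - t) * \<Lambda> f + t * \<Lambda>' f) \<in> symmetric_states K"
proof -
  have "0 \<le> (1 - t) * \<Lambda> f + t * \<Lambda>' f" if "bdd f" "\<forall>x. 0 \<le> f x" for f
    using assms that by (auto simp: symmetric_states_def state_def)
  then show ?thesis
    using assms unfolding symmetric_states_def state_def by (auto simp: algebra_simps)
qed

lemma symmetric_point_state:
  assumes "k \<in> K" "- k \<in> K"
  shows "(\<lambda>f. if bdd f then (f k + f (- k)) / 2 else 0) \<in> symmetric_states K"
proof -
  have "bdd (\<lambda>x. f (- x)) \<longleftrightarrow> bdd f" for f :: "'a \<Rightarrow> real"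
    unfolding bdd_def by (metis minus_minus)
  then show ?thesis
    using assms unfolding symmetric_states_def state_def by (auto simp: field_simps)
qed

lemma bdd_Re_character: "\<gamma> \<in> dual_group \<Longrightarrow> bdd (\<lambda>x. Re (\<gamma> x))"
  by (rule bddI[of _ 1]) (metis abs_Re_le_cmod dual_groupD(2))

lemma positive_definite_character: "\<gamma> \<in> dual_group \<Longrightarrow> positive_definite \<gamma>"
  by (auto simp: positive_definite_def character_orthogonality dual_groupD(1) less_eq_complex_def)

lemma positive_definite_add:
  assumes "positive_definite \<phi>" "positive_definite \<psi>"
  shows "positive_definite (\<lambda>x. \<phi> x + \<psi> x)"
proof -
  have c: "cont \<phi>" "cont \<psi>" using assms by (auto simp: positive_definite_def)
  have "(LINT x|haar. (\<phi> x + \<psi> x) * cnj (\<gamma> x)) = coeff \<phi> \<gamma> + coeff \<psi> \<gamma>"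
    if "\<gamma> \<in> dual_group" for \<gamma>
    by (rule bounded_functionalD(1)[OF bounded_functional_weight[OF continuous_on_cnj[OF dual_groupD(1)[OF that]]] c])
  then show ?thesis using assms c unfolding positive_definite_def
    by (auto intro!: continuous_on_add add_nonneg_nonneg)
qed

lemma positive_definite_scale:
  assumes "positive_definite \<phi>" "0 \<le> c"
  shows "positive_definite (\<lambda>x. complex_of_real c * \<phi> x)"
proof -
  have "(LINT x|haar. complex_of_real c * \<phi> x * cnj (\<gamma> x)) = of_real c * coeff \<phi> \<gamma>" for \<gamma>
    by (simp add: mult.assoc)
  then show ?thesis using assms unfolding positive_definite_def
    by (auto simp: less_eq_complex_def intro!: continuous_intros)
qed

lemma positive_definite_sum:
  "finite F \<Longrightarrow> (\<And>i. i \<in> F \<Longrightarrow> positive_definite (\<phi> i)) \<Longrightarrow> positive_definite (\<lambda>x. \<Sum>i\<in>F. \<phi> i x)"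
proof (induction F rule: finite_induct)
  case empty
  show ?case by (simp add: positive_definite_def)
next
  case (insert i F)
  then show ?case using positive_definite_add[of "\<phi> i" "\<lambda>x. \<Sum>i\<in>F. \<phi> i x"] by simp
qed

text \<open>
  A nonnegative combination of real parts of characters that is bounded above by \<open>- b'\<close> off \<open>\<Omega>\<close>
  becomes, after adding the constant \<open>b'\<close> and normalising, a function of the class. Its integral is
  the share of \<open>b'\<close> in the value \<open>b' + \<Sum> c \<gamma>\<close> at \<open>0\<close>.
\<close>

lemma delsarte_class_combination:
  assumes F: "finite F" "F \<subseteq> dual_group - {trivial_character}" and c: "\<And>\<gamma>. \<gamma> \<in> F \<Longrightarrow> 0 \<le> c \<gamma>"
    and b: "0 < b'" and neg: "\<And>x. x \<in> - \<Omega> \<Longrightarrow> (\<Sum>\<gamma>\<in>F. c \<gamma> * Re (\<gamma> x)) \<le> - b'"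
  obtains \<phi> where "\<phi> \<in> delsarte_class haar \<Omega>" "(LINT x|haar. \<phi> x) = b' / (b' + sum c F)"
proof -
  define C where "C = sum c F"
  have C: "0 \<le> C" unfolding C_def using c by (rule sum_nonneg)
  have D: "b' + C > 0" using b C by simp
  define \<phi> where "\<phi> x = (1 / (b' + C)) * (b' + (\<Sum>\<gamma>\<in>F. c \<gamma> * Re (\<gamma> x)))" for x
  have rep: "complex_of_real (\<phi> x) = of_real (1 / (b' + C)) * (of_real b' * 1 + (\<Sum>\<gamma>\<in>F. of_real (c \<gamma> / 2) * (\<gamma> x + cnj (\<gamma> x))))" for x
  proof -
    have "of_real (c \<gamma> / 2) * (\<gamma> x + cnj (\<gamma> x)) = complex_of_real (c \<gamma> * Re (\<gamma> x))" for \<gamma>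
      by (simp add: complex_add_cnj)
    then have "(\<Sum>\<gamma>\<in>F. of_real (c \<gamma> / 2) * (\<gamma> x + cnj (\<gamma> x))) = complex_of_real (\<Sum>\<gamma>\<in>F. c \<gamma> * Re (\<gamma> x))"
      by (simp only: of_real_sum)
    then show ?thesis unfolding \<phi>_def by simp
  qed
  have "positive_definite (\<lambda>x. of_real (1 / (b' + C)) * (of_real b' * 1 + (\<Sum>\<gamma>\<in>F. of_real (c \<gamma> / 2) * (\<gamma> x + cnj (\<gamma> x)))))"
  proof (intro positive_definite_scale positive_definite_add positive_definite_sum F(1))
    show "positive_definite (\<lambda>x. 1)" by (rule positive_definite_character[OF one_dual_group])
    show "positive_definite \<gamma>" "positive_definite (\<lambda>x. cnj (\<gamma> x))" if "\<gamma> \<in> F" for \<gamma>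
      using that F(2) by (auto intro!: positive_definite_character cnj_dual_group)
  qed (use b D c in auto)
  then have pd: "positive_definite (\<lambda>x. complex_of_real (\<phi> x))" by (simp only: rep)
  have "\<phi> \<in> delsarte_class haar \<Omega>"
    unfolding delsarte_class_iff
  proof (intro conjI ballI pd)
    have "(\<Sum>\<gamma>\<in>F. c \<gamma> * Re (\<gamma> 0)) = C"
      using F(2) by (auto simp: C_def dual_groupD(4) subset_iff intro!: sum.cong)
    then show "\<phi> 0 = 1" using D by (simp add: \<phi>_def)
    show "\<phi> x \<le> 0" if "x \<in> - \<Omega>" for x
      using neg[OF that] D by (simp add: \<phi>_def divide_nonpos_pos)
  qed
  moreover have "(LINT x|haar. \<phi> x) = b' / (b' + C)"
  proof -
    have i: "integrable haar (\<lambda>x. c \<gamma> * Re (\<gamma> x))" and z: "(LINT x|haar. Re (\<gamma> x)) = 0" if "\<gamma> \<in> F" for \<gamma>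
    proof -
      have \<gamma>: "\<gamma> \<in> dual_group" "\<gamma> \<noteq> trivial_character" using that F(2) by auto
      show "integrable haar (\<lambda>x. c \<gamma> * Re (\<gamma> x))"
        by (intro haar_integrable continuous_intros dual_groupD(1)[OF \<gamma>(1)])
      show "(LINT x|haar. Re (\<gamma> x)) = 0"
        using integral_Re[OF haar_integrable[OF dual_groupD(1)[OF \<gamma>(1)]]] integral_character[OF \<gamma>] by simp
    qed
    have "(LINT x|haar. \<phi> x) = (1 / (b' + C)) * (LINT x|haar. b' + (\<Sum>\<gamma>\<in>F. c \<gamma> * Re (\<gamma> x)))"
      unfolding \<phi>_def by (rule integral_mult_right_zero)
    also have "(LINT x|haar. b' + (\<Sum>\<gamma>\<in>F. c \<gamma> * Re (\<gamma> x))) = b' + (LINT x|haar. (\<Sum>\<gamma>\<in>F. c \<gamma> * Re (\<gamma> x)))"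
      using i by (subst Bochner_Integration.integral_add) auto
    also have "(LINT x|haar. (\<Sum>\<gamma>\<in>F. c \<gamma> * Re (\<gamma> x))) = (\<Sum>\<gamma>\<in>F. LINT x|haar. c \<gamma> * Re (\<gamma> x))"
      using i by (rule Bochner_Integration.integral_sum)
    also have "\<dots> = 0" using z by simp
    finally show ?thesis by simp
  qed
  ultimately show ?thesis using that by (simp add: C_def)
qed

text \<open>
  The finitely many inequalities \<open>\<Lambda> (Re \<gamma>) \<ge> - b\<close> are solved by least squares: a state \<open>\<Lambda>0\<close> that
  minimises the sum of the squared violations exists by compactness. The conclusion is the
  first-order optimality condition along the segments from \<open>\<Lambda>0\<close> to other states, with the
  violations \<open>c \<gamma>\<close> as weights.
\<close>

lemma least_squares_state:
  assumes ne: "symmetric_states K \<noteq> {}"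
  obtains \<Lambda>0 c where "\<Lambda>0 \<in> symmetric_states K" "\<And>\<gamma>. c \<gamma> = max 0 (- b - \<Lambda>0 (\<lambda>x. Re (\<gamma> x)))"
    "\<And>\<Lambda>. \<Lambda> \<in> symmetric_states K \<Longrightarrow>
       (\<Sum>\<gamma>\<in>F. c \<gamma> * \<Lambda> (\<lambda>x. Re (\<gamma> x))) \<le> (\<Sum>\<gamma>\<in>F. c \<gamma> * \<Lambda>0 (\<lambda>x. Re (\<gamma> x)))"
proof -
  define S where "S = symmetric_states K"
  define d where "d \<Lambda> = (\<Sum>\<gamma>\<in>F. (max 0 (- b - \<Lambda> (\<lambda>x. Re (\<gamma> x))))\<^sup>2)" for \<Lambda> :: "('a \<Rightarrow> real) \<Rightarrow> real"
  have "compact S" unfolding S_def by (rule compact_symmetric_states)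
  moreover have "S \<noteq> {}" using ne by (simp add: S_def)
  moreover have "continuous_on S d"
    unfolding d_def
    by (intro continuous_on_sum continuous_on_power continuous_on_max continuous_on_diff continuous_on_const
        continuous_on_subset[OF continuous_on_product_coordinates subset_UNIV])
  ultimately obtain \<Lambda>0 where \<Lambda>0: "\<Lambda>0 \<in> S" "\<And>\<Lambda>. \<Lambda> \<in> S \<Longrightarrow> d \<Lambda>0 \<le> d \<Lambda>"
    using continuous_attains_inf[of S d] by auto
  define c where "c \<gamma> = max 0 (- b - \<Lambda>0 (\<lambda>x. Re (\<gamma> x)))" for \<gamma> :: "'a \<Rightarrow> complex"
  have cnn: "0 \<le> c \<gamma>" for \<gamma> by (simp add: c_def)
  have first_order: "(\<Sum>\<gamma>\<in>F. c \<gamma> * \<Lambda> (\<lambda>x. Re (\<gamma> x))) \<le> (\<Sum>\<gamma>\<in>F. c \<gamma> * \<Lambda>0 (\<lambda>x. Re (\<gamma> x)))" if \<Lambda>: "\<Lambda> \<in> S" for \<Lambda>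
  proof -
    define y where "y \<gamma> = \<Lambda> (\<lambda>x. Re (\<gamma> x)) - \<Lambda>0 (\<lambda>x. Re (\<gamma> x))" for \<gamma> :: "'a \<Rightarrow> complex"
    define A where "A = (\<Sum>\<gamma>\<in>F. c \<gamma> * y \<gamma>)"
    define B where "B = (\<Sum>\<gamma>\<in>F. (y \<gamma>)\<^sup>2)"
    have step: "2 * A \<le> t * B" if t: "0 < t" "t \<le> 1" for t
    proof -
      define \<Lambda>t where "\<Lambda>t = (\<lambda>f. (1 - t) * \<Lambda>0 f + t * \<Lambda> f)"
      have "\<Lambda>t \<in> S" unfolding \<Lambda>t_def S_def using \<Lambda>0(1) \<Lambda> t by (intro symmetric_states_convex) (auto simp: S_def)
      then have "d \<Lambda>0 \<le> d \<Lambda>t" by (rule \<Lambda>0)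
      also have "d \<Lambda>t \<le> (\<Sum>\<gamma>\<in>F. (c \<gamma> - t * y \<gamma>)\<^sup>2)"
        unfolding d_def
      proof (rule sum_mono)
        fix \<gamma> assume "\<gamma> \<in> F"
        have "- b - \<Lambda>t (\<lambda>x. Re (\<gamma> x)) = (- b - \<Lambda>0 (\<lambda>x. Re (\<gamma> x))) - t * y \<gamma>"
          by (simp add: \<Lambda>t_def y_def algebra_simps)
        then have "max 0 (- b - \<Lambda>t (\<lambda>x. Re (\<gamma> x))) \<le> \<bar>c \<gamma> - t * y \<gamma>\<bar>"
          unfolding c_def by linarith
        then have "(max 0 (- b - \<Lambda>t (\<lambda>x. Re (\<gamma> x))))\<^sup>2 \<le> \<bar>c \<gamma> - t * y \<gamma>\<bar>\<^sup>2" by (intro power_mono) auto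
        then show "(max 0 (- b - \<Lambda>t (\<lambda>x. Re (\<gamma> x))))\<^sup>2 \<le> (c \<gamma> - t * y \<gamma>)\<^sup>2" by simp
      qed
      also have "\<dots> = (\<Sum>\<gamma>\<in>F. (c \<gamma>)\<^sup>2 - 2 * t * (c \<gamma> * y \<gamma>) + t\<^sup>2 * (y \<gamma>)\<^sup>2)"
        by (intro sum.cong refl) (simp add: power2_eq_square algebra_simps)
      also have "\<dots> = d \<Lambda>0 - 2 * t * A + t\<^sup>2 * B"
        by (simp add: d_def c_def[symmetric] A_def B_def sum.distrib sum_subtractf sum_distrib_left)
      finally have "t * (2 * A) \<le> t * (t * B)" by (simp add: power2_eq_square algebra_simps)
      then show ?thesis using t by simp
    qed
    have "A \<le> 0"
    proof (rule ccontr)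
      assume "\<not> A \<le> 0"
      then have A: "A > 0" by simp
      have B: "B \<ge> 0" unfolding B_def by (intro sum_nonneg) auto
      \<comment> \<open>Small enough for \<open>t B < 2 A\<close>.\<close>
      define t where "t = min 1 (A / (B + 1))"
      have t: "0 < t" "t \<le> 1" using A B by (auto simp: t_def)
      have "t * B \<le> A / (B + 1) * B" using B by (intro mult_right_mono) (auto simp: t_def)
      also have "\<dots> \<le> A / (B + 1) * (B + 1)" using A B by (intro mult_left_mono) auto
      also have "\<dots> = A" using B by simp
      finally show False using step[OF t] A by simp
    qed
    then show ?thesis by (simp add: A_def y_def right_diff_distrib sum_subtractf)
  qed
  then show ?thesis using that[of \<Lambda>0 c] \<Lambda>0(1) by (auto simp: S_def c_def)
qed

text \<open>
  Suppose that the least squares state violates a constraint. Optimality, tested at the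
  symmetrised point states, bounds the combination of the \<open>Re \<gamma>\<close> with the violations as
  coefficients by \<open>- (b C + R)\<close> off \<open>\<Omega>\<close>, where \<open>C\<close> is the sum and \<open>R\<close> the sum of squares of the
  violations. The function of the Delsarte class built from this combination has integral above
  \<open>b / (b + 1)\<close>, because \<open>R > 0\<close>.
\<close>

lemma finitely_many_constraints:
  assumes sym: "\<And>k. k \<in> closure (- \<Omega>) \<Longrightarrow> - k \<in> closure (- \<Omega>)" and ne: "closure (- \<Omega>) \<noteq> {}"
    and b: "b > 0" and opt: "\<And>\<phi>. \<phi> \<in> delsarte_class haar \<Omega> \<Longrightarrow> (LINT x|haar. \<phi> x) \<le> b / (b + 1)"
    and F: "finite F" "F \<subseteq> dual_group - {trivial_character}"
  shows "\<exists>\<Lambda>\<in>symmetric_states (closure (- \<Omega>)). \<forall>\<gamma>\<in>F. - b \<le> \<Lambda> (\<lambda>x. Re (\<gamma> x))"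
proof -
  define S where "S = symmetric_states (closure (- \<Omega>))"
  obtain k0 where k0: "k0 \<in> closure (- \<Omega>)" using ne by (metis all_not_in_conv)
  have "symmetric_states (closure (- \<Omega>)) \<noteq> {}" using symmetric_point_state[OF k0 sym[OF k0]] by auto
  then obtain \<Lambda>0 c where \<Lambda>0: "\<Lambda>0 \<in> S" and c_def: "\<And>\<gamma>. c \<gamma> = max 0 (- b - \<Lambda>0 (\<lambda>x. Re (\<gamma> x)))"
    and first_order: "\<And>\<Lambda>. \<Lambda> \<in> S \<Longrightarrow>
       (\<Sum>\<gamma>\<in>F. c \<gamma> * \<Lambda> (\<lambda>x. Re (\<gamma> x))) \<le> (\<Sum>\<gamma>\<in>F. c \<gamma> * \<Lambda>0 (\<lambda>x. Re (\<gamma> x)))"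
    using least_squares_state[of "closure (- \<Omega>)" b F thesis] unfolding S_def by blast
  have cnn: "0 \<le> c \<gamma>" for \<gamma> by (simp add: c_def)
  have "c \<gamma> = 0" if "\<gamma> \<in> F" for \<gamma>
  proof (rule ccontr)
    assume "c \<gamma> \<noteq> 0"
    define C where "C = sum c F"
    define R where "R = (\<Sum>\<gamma>\<in>F. (c \<gamma>)\<^sup>2)"
    have C: "C > 0" unfolding C_def using F(1) cnn that \<open>c \<gamma> \<noteq> 0\<close>
      by (intro sum_pos2[of F \<gamma>]) (auto simp: less_le)
    have R: "R > 0" unfolding R_def using F(1) that \<open>c \<gamma> \<noteq> 0\<close> by (intro sum_pos2[of F \<gamma>]) auto
    have val: "(\<Sum>\<gamma>\<in>F. c \<gamma> * \<Lambda>0 (\<lambda>x. Re (\<gamma> x))) = - (b * C + R)"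
    proof -
      have "c \<gamma> * \<Lambda>0 (\<lambda>x. Re (\<gamma> x)) = - (b * c \<gamma>) - (c \<gamma>)\<^sup>2" for \<gamma>
      proof (cases "c \<gamma> = 0")
        case False
        then have eq: "\<Lambda>0 (\<lambda>x. Re (\<gamma> x)) = - b - c \<gamma>" by (simp add: c_def max_def split: if_splits)
        show ?thesis unfolding eq by (simp add: power2_eq_square algebra_simps)
      qed simp
      then show ?thesis by (simp add: C_def R_def sum_subtractf sum_negf sum_distrib_left)
    qed
    have neg: "(\<Sum>\<gamma>\<in>F. c \<gamma> * Re (\<gamma> k)) \<le> - (b * C + R)" if k: "k \<in> - \<Omega>" for k
    proof -
      have kK: "k \<in> closure (- \<Omega>)" by (rule subsetD[OF closure_subset k])
      define P where "P = (\<lambda>f::'a \<Rightarrow> real. if bdd f then (f k + f (- k)) / 2 else 0)"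
      have "P \<in> S" unfolding P_def S_def by (intro symmetric_point_state kK sym)
      then have "(\<Sum>\<gamma>\<in>F. c \<gamma> * P (\<lambda>x. Re (\<gamma> x))) \<le> - (b * C + R)" using first_order val by simp
      moreover have "P (\<lambda>x. Re (\<gamma> x)) = Re (\<gamma> k)" if "\<gamma> \<in> F" for \<gamma>
      proof -
        have \<gamma>: "\<gamma> \<in> dual_group" using that F(2) by auto
        show ?thesis using bdd_Re_character[OF \<gamma>] by (simp add: P_def dual_groupD(5)[OF \<gamma>])
      qed
      ultimately show ?thesis by simp
    qed
    have b': "0 < b * C + R" using b C R by (simp add: add_pos_pos)
    obtain \<phi> where \<phi>: "\<phi> \<in> delsarte_class haar \<Omega>" "(LINT x|haar. \<phi> x) = (b * C + R) / (b * C + R + sum c F)"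
      using delsarte_class_combination[OF F cnn b' neg] by metis
    have "(b * C + R) / (b * C + R + C) \<le> b / (b + 1)" using opt[OF \<phi>(1)] \<phi>(2) by (simp add: C_def)
    then have "(b * C + R) * (b + 1) \<le> b * (b * C + R + C)"
      using b C R b' by (simp add: divide_le_eq pos_le_divide_eq frac_le_eq field_simps)
    then show False using R by (simp add: algebra_simps)
  qed
  moreover have "- b - \<Lambda>0 (\<lambda>x. Re (\<gamma> x)) \<le> c \<gamma>" for \<gamma> by (simp add: c_def)
  ultimately have "- b \<le> \<Lambda>0 (\<lambda>x. Re (\<gamma> x))" if "\<gamma> \<in> F" for \<gamma>
    using that by (metis add_0 diff_le_eq diff_le_0_iff_le)
  then show ?thesis using \<Lambda>0 by (auto simp: S_def)
qed

text \<open>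
  Compactness of the states allows all constraints to be satisfied at once, and the Radon measure
  of the resulting state is feasible after division by \<open>b\<close>. The symmetry of the state makes the
  imaginary parts of the integrals of characters vanish, as the complex inequalities require.
\<close>

lemma optimal_dual_value:
  assumes sym: "\<And>k. k \<in> closure (- \<Omega>) \<Longrightarrow> - k \<in> closure (- \<Omega>)" and ne: "closure (- \<Omega>) \<noteq> {}"
    and b: "b > 0" and opt: "\<And>\<phi>. \<phi> \<in> delsarte_class haar \<Omega> \<Longrightarrow> (LINT x|haar. \<phi> x) \<le> b / (b + 1)"
  shows "1 / b \<in> dual_values \<Omega>"
proof -
  define S where "S = symmetric_states (closure (- \<Omega>))"
  have "S \<inter> (\<Inter>\<gamma>\<in>dual_group - {trivial_character}. {\<Lambda>. - b \<le> \<Lambda> (\<lambda>x. Re (\<gamma> x))}) \<noteq> {}"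
  proof (rule compact_imp_fip_image)
    show "compact S" unfolding S_def by (rule compact_symmetric_states)
    show "closed {\<Lambda>. - b \<le> \<Lambda> (\<lambda>x. Re (\<gamma> x))}" for \<gamma> :: "'a \<Rightarrow> complex"
      by (intro closed_Collect_le continuous_intros) auto
    fix F assume "finite F" "F \<subseteq> dual_group - {trivial_character :: 'a \<Rightarrow> complex}"
    from finitely_many_constraints[OF sym ne b opt this]
    show "S \<inter> (\<Inter>\<gamma>\<in>F. {\<Lambda>. - b \<le> \<Lambda> (\<lambda>x. Re (\<gamma> x))}) \<noteq> {}" unfolding S_def by blast
  qed
  then obtain \<Lambda> where \<Lambda>: "\<Lambda> \<in> symmetric_states (closure (- \<Omega>))"
    and ge: "\<And>\<gamma>. \<gamma> \<in> dual_group - {trivial_character} \<Longrightarrow> - b \<le> \<Lambda> (\<lambda>x. Re (\<gamma> x))"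
    unfolding S_def by blast
  interpret compact_state \<Lambda> using \<Lambda> by (rule symmetric_statesD)
  have carried: "carried \<Omega> radon"
    using finite_borel_radon approximable_radon radon_outside[OF closed_closure symmetric_statesD(3)[OF \<Lambda>]]
    by (simp add: carried_def)
  have "- 1 \<le> of_real (1 / b) * (LINT x|radon. \<gamma> x)" if \<gamma>: "\<gamma> \<in> dual_group - {trivial_character}" for \<gamma>
  proof -
    have \<gamma>': "\<gamma> \<in> dual_group" using \<gamma> by simp
    have i: "integrable radon \<gamma>" by (rule cont_integrable[OF finite_borel_radon dual_groupD(1)[OF \<gamma>']])
    have re: "Re (LINT x|radon. \<gamma> x) = \<Lambda> (\<lambda>x. Re (\<gamma> x))"
      using integral_Re[OF i] integral_radon[OF continuous_on_Re[OF dual_groupD(1)[OF \<gamma>']]] by simp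
    have im: "Im (LINT x|radon. \<gamma> x) = \<Lambda> (\<lambda>x. Im (\<gamma> x))"
      using integral_Im[OF i] integral_radon[OF continuous_on_Im[OF dual_groupD(1)[OF \<gamma>']]] by simp
    have bi: "bdd (\<lambda>x. Im (\<gamma> x))" by (rule bddI[of _ 1]) (metis abs_Im_le_cmod dual_groupD(2)[OF \<gamma>'])
    have "\<Lambda> (\<lambda>x. Im (\<gamma> x)) = \<Lambda> (\<lambda>x. Im (\<gamma> (- x)))" using symmetric_statesD(2)[OF \<Lambda> bi] by simp
    also have "\<dots> = \<Lambda> (\<lambda>x. (-1) * Im (\<gamma> x))" by (simp add: dual_groupD(5)[OF \<gamma>'])
    also have "\<dots> = - \<Lambda> (\<lambda>x. Im (\<gamma> x))" using cmult[OF bi, of "-1"] by simp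
    finally have "\<Lambda> (\<lambda>x. Im (\<gamma> x)) = 0" by simp
    then show ?thesis using ge[OF \<gamma>] re im b by (simp add: less_eq_complex_def field_simps)
  qed
  then show ?thesis
    unfolding dual_values_iff using carried b measure_radon_UNIV
    by (intro exI[of _ radon] exI[of _ "1 / b"]) auto
qed

lemma integral_le_1:
  assumes \<phi>: "\<phi> \<in> delsarte_class haar \<Omega>" and \<Omega>: "0 \<in> interior \<Omega>"
  shows "(LINT x|haar. \<phi> x) \<le> 1"
proof -
  have "1 \<in> admissible \<Omega>" unfolding admissible_eq[OF \<Omega>] using dual_values_nonempty by (force simp: image_iff)
  then show ?thesis using \<phi> by (rule weak_duality)
qed

text \<open>
  For \<open>D < 1\<close> the closure of \<open>- \<Omega>\<close> is nonempty, since otherwise the constant \<open>1\<close> would be in the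
  class, and \<open>(1 - D) / D\<close> is a value of the dual program by compactness. For \<open>D = 1\<close> it is the value
  of the zero measure.
\<close>

theorem strong_duality:
  assumes sym: "uminus ` \<Omega> = \<Omega>" and \<Omega>: "0 \<in> interior \<Omega>"
  shows "delsarte haar \<Omega> = delsarte_dual haar \<Omega>"
proof -
  have dual: "delsarte_dual haar \<Omega> = (INF \<alpha>\<in>admissible \<Omega>. ereal \<alpha>)"
    by (simp add: delsarte_dual_def admissible_def)
  obtain \<phi>0 where \<phi>0: "\<phi>0 \<in> delsarte_class haar \<Omega>" "(LINT x|haar. \<phi>0 x) > 0"
    by (rule delsarte_class_positive_integral[OF \<Omega>])
  have "ereal (LINT x|haar. \<phi>0 x) \<le> delsarte haar \<Omega>" unfolding delsarte_def by (rule SUP_upper[OF \<phi>0(1)])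
  moreover have "delsarte haar \<Omega> \<le> 1"
    unfolding delsarte_def using integral_le_1[OF _ \<Omega>] by (intro SUP_least) (simp add: one_ereal_def)
  ultimately obtain D where D: "delsarte haar \<Omega> = ereal D" "0 < D" "D \<le> 1"
    using \<phi>0(2) by (cases "delsarte haar \<Omega>") (auto simp: one_ereal_def)
  have opt: "(LINT x|haar. \<phi> x) \<le> D" if "\<phi> \<in> delsarte_class haar \<Omega>" for \<phi>
    using SUP_upper[OF that, of "\<lambda>\<phi>. ereal (LINT x|haar. \<phi> x)"] D(1) by (simp add: delsarte_def)
  have "D \<in> admissible \<Omega>"
  proof (cases "D = 1")
    case True
    then show ?thesis unfolding admissible_eq[OF \<Omega>] using dual_values_nonempty by (force simp: image_iff)
  next
    case False
    then have D1: "D < 1" using D by simp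
    have symc: "- x \<in> - \<Omega>" if "x \<in> - \<Omega>" for x
    proof -
      have "- x \<in> \<Omega> \<Longrightarrow> x \<in> \<Omega>" using sym by (metis image_eqI minus_minus)
      then show ?thesis using that by auto
    qed
    have "uminus ` closure (- \<Omega>) \<subseteq> closure (- \<Omega>)"
      using symc closure_subset[of "- \<Omega>"] by (intro image_closure_subset continuous_intros) auto
    then have symK: "- k \<in> closure (- \<Omega>)" if "k \<in> closure (- \<Omega>)" for k using that by blast
    have ne: "closure (- \<Omega>) \<noteq> {}"
    proof
      assume "closure (- \<Omega>) = {}"
      then have "\<Omega> = UNIV" using closure_eq_empty by blast
      then have "(\<lambda>_. 1) \<in> delsarte_class haar \<Omega>"
        using positive_definite_character[OF one_dual_group] by (simp add: delsarte_class_iff)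
      then show False using opt[of "\<lambda>_. 1"] D1 by simp
    qed
    \<comment> \<open>Chosen such that the dual value \<open>1 / b\<close> corresponds to \<open>\<alpha> = D\<close>.\<close>
    define b where "b = D / (1 - D)"
    have b: "b > 0" "b / (b + 1) = D" using D(2) D1 by (auto simp: b_def field_simps)
    have "1 / b \<in> dual_values \<Omega>" using opt b by (intro optimal_dual_value symK ne) auto
    moreover have "D = 1 / (1 + 1 / b)" using b by (simp add: field_simps)
    ultimately show ?thesis unfolding admissible_eq[OF \<Omega>] by blast
  qed
  then have "delsarte_dual haar \<Omega> \<le> ereal D" unfolding dual by (rule INF_lower)
  moreover have "ereal D \<le> delsarte_dual haar \<Omega>"
    unfolding dual D(1)[symmetric] delsarte_def using weak_duality by (intro SUP_least INF_greatest) auto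
  ultimately show ?thesis using D(1) by simp
qed

end

theorem theorem2:
  fixes haar :: "'a::{topological_ab_group_add, t2_space} measure"
    and \<Omega> :: "'a set"
  assumes "compact (UNIV :: 'a set)"
    and "normalized_haar haar"
    and "\<Omega> \<in> sets borel"
    and "uminus ` \<Omega> = \<Omega>"
    and "0 \<in> interior \<Omega>"
  shows "delsarte haar \<Omega> = 1 / (1 + primal_lp \<Omega>) \<and>
         delsarte_dual haar \<Omega> = 1 / (1 + dual_lp \<Omega>) \<and>
         delsarte haar \<Omega> = delsarte_dual haar \<Omega>"
proof -
  interpret compact_abelian_group haar using assms by unfold_locales
  show ?thesis using delsarte_eq delsarte_dual_eq strong_duality assms by blast
qed

end
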